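(* Let $\mathcal{A}$ be a solid involutive Banach convolution algebra over a lattice $\Lambda\subseteq\mathbb{R}^{2d}$, let $g$ with $V_gg\in W(\mathcal{A})$ generate a tight Gabor frame $\{\pi(\lambda)g\}_{\lambda\in\Lambda}$, and let $\mathcal{Y}$ be a solid Banach sequence space on $\Lambda$ in which finitely supported sequences are dense and such that $\|\mathbf a*\mathbf c\|_{\mathcal{Y}}\le\|\mathbf a\|_{\mathcal{A}}\|\mathbf c\|_{\mathcal{Y}}$ for $\mathbf a\in\mathcal{A}$, $\mathbf c\in\mathcal{Y}$. If $\sigma\in\widetilde M^{\infty,\mathcal{A}}$, then $\sigma^w$ extends to a bounded operator on $M(\mathcal{Y})$ with $$\|\sigma^w\|_{M(\mathcal{Y})\to M(\mathcal{Y})}\le\|M(\sigma)\|_{\mathcal{C}_{\mathcal{A}}}\le\|\sigma\|_{\widetilde M^{\infty,\mathcal{A}}},$$ the last norm computed with window $W(g,g)$.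
   Context: Solid involutive Banach convolution algebra $\mathcal{A}$ over $\Lambda$: Banach space of sequences closed under convolution ($\|\mathbf a*\mathbf b\|\le\|\mathbf a\|\|\mathbf b\|$), under $\mathbf a^*(\lambda)=\overline{\mathbf a(-\lambda)}$ ($\|\mathbf a^*\|\le\|\mathbf a\|$), solid; all $\delta_\lambda\in\mathcal{A}$. Solid sequence space: $\mathbf b\in\mathcal{Y}$, $|\mathbf a|\le|\mathbf b|$ imply $\mathbf a\in\mathcal{Y}$, $\|\mathbf a\|\le\|\mathbf b\|$. $W(\mathcal{A})$: $F\in L^\infty_{loc}(\mathbb{R}^{2d})$ with $(\operatorname{ess\,sup}_{\zeta\in\lambda+C}|F|)_\lambda\in\mathcal{A}$. $\pi(x,\xi)f(t)=e^{2\pi i\xi\cdot t}f(t-x)$, $V_gf(z)=\langle f,\pi(z)g\rangle$; $\mathcal V_\Phi\sigma(z,\zeta)=\langle\sigma,\pi(z,\zeta)\Phi\rangle$; grand symbol $\mathcal G_\Phi(\sigma)(\zeta)=\operatorname{ess\,sup}_z|\mathcal V_\Phi\sigma(z,\zeta)|$; $j(\zeta_1,\zeta_2)=(\zeta_2,-\zeta_1)$; $\widetilde M^{\infty,\mathcal{A}}$: symbols with $\mathcal G_\Phi(\sigma)\circ j\in W(\mathcal{A})$, norm $\|\mathcal G_\Phi(\sigma)\circ j\|_{W(\mathcal{A})}$. Weyl transform $\langle\sigma^wf,h\rangle=\langle\sigma,W(h,f)\rangle$, $W$ the cross-Wigner distribution. Tight Gabor frame: $\|f\|_2^2=\sum_\lambda|\langle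 f,\pi(\lambda)g\rangle|^2$. $M(\sigma)_{\lambda\mu}=\langle\sigma^w\pi(\mu)g,\pi(\lambda)g\rangle$; $\mathbf d_A(\mu)=\sup_\lambda|a_{\lambda,\lambda-\mu}|$, $\|A\|_{\mathcal{C}_{\mathcal{A}}}=\|\mathbf d_A\|_{\mathcal{A}}$. Modulation space $M(\mathcal{Y})$: on $\mathcal L_0$, the finite linear combinations $\sum c_\lambda\pi(\lambda)g$, define $\|f\|_{M(\mathcal{Y})}=\|(\langle f,\pi(\lambda)g\rangle)_{\lambda\in\Lambda}\|_{\mathcal{Y}}$; $M(\mathcal{Y})$ is the completion of $\mathcal L_0$ in this norm. *)

theory Defs
  imports "HOL-Probability.Probability"
begin

definition tfs :: "'c::euclidean_space \<times> 'c \<Rightarrow> ('c \<Rightarrow> complex) \<Rightarrow> 'c \<Rightarrow> complex" where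
  "tfs z f = (\<lambda>t. cis (2 * pi * (snd z \<bullet> t)) * f (t - fst z))"

definition l2_inner :: "('c::euclidean_space \<Rightarrow> complex) \<Rightarrow> ('c \<Rightarrow> complex) \<Rightarrow> complex" where
  "l2_inner f h = (LINT t|lborel. f t * cnj (h t))"

definition l2_normsq :: "('c::euclidean_space \<Rightarrow> complex) \<Rightarrow> real" where
  "l2_normsq f = (LINT t|lborel. (cmod (f t))\<^sup>2)"

definition L2 :: "('c::euclidean_space \<Rightarrow> complex) set" where
  "L2 = {f. f \<in> borel_measurable lborel \<and> integrable lborel (\<lambda>t. (cmod (f t))\<^sup>2)}"

definition stft :: "('c::euclidean_space \<Rightarrow> complex) \<Rightarrow> ('c \<Rightarrow> complex) \<Rightarrow> 'c \<times> 'c \<Rightarrow> complex" where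
  "stft g f z = l2_inner f (tfs z g)"

definition wigner :: "('c::euclidean_space \<Rightarrow> complex) \<Rightarrow> ('c \<Rightarrow> complex) \<Rightarrow> 'c \<times> 'c \<Rightarrow> complex" where
  "wigner f h = (\<lambda>(x, \<xi>). LINT t|lborel.
      f (x + (1/2) *\<^sub>R t) * cnj (h (x - (1/2) *\<^sub>R t)) * cis (- 2 * pi * (\<xi> \<bullet> t)))"

definition gaussian :: "'c::euclidean_space \<Rightarrow> complex" where
  "gaussian t = complex_of_real (exp (- pi * (norm t)\<^sup>2))"

definition S0 :: "('c::euclidean_space \<Rightarrow> complex) set" where
  "S0 = {F. F \<in> L2 \<and> integrable lborel (\<lambda>z. cmod (stft gaussian F z))}"

definition S0_norm :: "('c::euclidean_space \<Rightarrow> complex) \<Rightarrow> real" where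
  "S0_norm F = (LINT z|lborel. cmod (stft gaussian F z))"

text \<open>A distribution sigma in S_0', given through the sesquilinear pairing
  F |-> <sigma, F> (antilinear and bounded on S_0).\<close>
definition S0_dual :: "(('c::euclidean_space \<Rightarrow> complex) \<Rightarrow> complex) set" where
  "S0_dual = {\<sigma>. (\<forall>F\<in>S0. \<forall>G\<in>S0. \<sigma> (\<lambda>w. F w + G w) = \<sigma> F + \<sigma> G)
              \<and> (\<forall>c. \<forall>F\<in>S0. \<sigma> (\<lambda>w. c * F w) = cnj c * \<sigma> F)
              \<and> (\<exists>C. \<forall>F\<in>S0. cmod (\<sigma> F) \<le> C * S0_norm F)}"

text \<open>Weyl transform: <sigma^w f, h> = <sigma, W(h,f)>.\<close>
definition weyl_pair :: "((('c::euclidean_space) \<times> 'c \<Rightarrow> complex) \<Rightarrow> complex)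
     \<Rightarrow> ('c \<Rightarrow> complex) \<Rightarrow> ('c \<Rightarrow> complex) \<Rightarrow> complex" where
  "weyl_pair \<sigma> f h = \<sigma> (wigner h f)"

definition lat :: "('b::euclidean_space \<Rightarrow> 'b) \<Rightarrow> 'b set" where
  "lat T = T ` {x. \<forall>i\<in>Basis. x \<bullet> i \<in> \<int>}"

definition fund :: "('b::euclidean_space \<Rightarrow> 'b) \<Rightarrow> 'b set" where
  "fund T = T ` {x. \<forall>i\<in>Basis. 0 \<le> x \<bullet> i \<and> x \<bullet> i < 1}"

definition delta :: "'b \<Rightarrow> 'b \<Rightarrow> complex" where
  "delta l = (\<lambda>x. if x = l then 1 else 0)"

definition conv_ok :: "'b::ab_group_add set \<Rightarrow> ('b \<Rightarrow> complex) \<Rightarrow> ('b \<Rightarrow> complex) \<Rightarrow> bool" where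
  "conv_ok \<Lambda> a b = (\<forall>x\<in>\<Lambda>. (\<lambda>\<mu>. a \<mu> * b (x - \<mu>)) summable_on \<Lambda>)"

definition conv :: "'b::ab_group_add set \<Rightarrow> ('b \<Rightarrow> complex) \<Rightarrow> ('b \<Rightarrow> complex) \<Rightarrow> 'b \<Rightarrow> complex" where
  "conv \<Lambda> a b = (\<lambda>x. if x \<in> \<Lambda> then (\<Sum>\<^sub>\<infinity>\<mu>\<in>\<Lambda>. a \<mu> * b (x - \<mu>)) else 0)"

definition invol :: "('b::ab_group_add \<Rightarrow> complex) \<Rightarrow> 'b \<Rightarrow> complex" where
  "invol a = (\<lambda>x. cnj (a (- x)))"

text \<open>Banach space of sequences on Lambda (sequences are functions vanishing off Lambda).\<close>
definition banach_seq_space :: "'b set \<Rightarrow> ('b \<Rightarrow> complex) set \<Rightarrow> (('b \<Rightarrow> complex) \<Rightarrow> real) \<Rightarrow> bool" where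
  "banach_seq_space \<Lambda> X n \<longleftrightarrow>
     (\<forall>a\<in>X. \<forall>x. x \<notin> \<Lambda> \<longrightarrow> a x = 0) \<and>
     (\<lambda>_. 0) \<in> X \<and>
     (\<forall>a\<in>X. \<forall>b\<in>X. (\<lambda>x. a x + b x) \<in> X) \<and>
     (\<forall>c. \<forall>a\<in>X. (\<lambda>x. c * a x) \<in> X) \<and>
     (\<forall>a\<in>X. 0 \<le> n a) \<and>
     (\<forall>a\<in>X. n a = 0 \<longleftrightarrow> a = (\<lambda>_. 0)) \<and>
     (\<forall>c. \<forall>a\<in>X. n (\<lambda>x. c * a x) = cmod c * n a) \<and>
     (\<forall>a\<in>X. \<forall>b\<in>X. n (\<lambda>x. a x + b x) \<le> n a + n b) \<and>
     (\<forall>u::nat \<Rightarrow> 'b \<Rightarrow> complex. (\<forall>k. u k \<in> X) \<and>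
         (\<forall>e>0. \<exists>N. \<forall>m\<ge>N. \<forall>k\<ge>N. n (\<lambda>x. u m x - u k x) < e) \<longrightarrow>
         (\<exists>a\<in>X. (\<lambda>k. n (\<lambda>x. u k x - a x)) \<longlonglongrightarrow> 0))"

definition solid :: "'b set \<Rightarrow> ('b \<Rightarrow> complex) set \<Rightarrow> (('b \<Rightarrow> complex) \<Rightarrow> real) \<Rightarrow> bool" where
  "solid \<Lambda> X n \<longleftrightarrow> (\<forall>a b. b \<in> X \<and> (\<forall>x. x \<notin> \<Lambda> \<longrightarrow> a x = 0) \<and> (\<forall>x. cmod (a x) \<le> cmod (b x))
       \<longrightarrow> a \<in> X \<and> n a \<le> n b)"

definition solid_inv_conv_alg :: "'b::ab_group_add set \<Rightarrow> ('b \<Rightarrow> complex) set \<Rightarrow> (('b \<Rightarrow> complex) \<Rightarrow> real) \<Rightarrow> bool" where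
  "solid_inv_conv_alg \<Lambda> A n \<longleftrightarrow>
     banach_seq_space \<Lambda> A n \<and> solid \<Lambda> A n \<and>
     (\<forall>a\<in>A. \<forall>b\<in>A. conv_ok \<Lambda> a b \<and> conv \<Lambda> a b \<in> A \<and> n (conv \<Lambda> a b) \<le> n a * n b) \<and>
     (\<forall>a\<in>A. invol a \<in> A \<and> n (invol a) \<le> n a) \<and>
     (\<forall>l\<in>\<Lambda>. delta l \<in> A)"

definition locsup :: "('b::euclidean_space \<Rightarrow> 'b) \<Rightarrow> ('b \<Rightarrow> ereal) \<Rightarrow> 'b \<Rightarrow> ereal" where
  "locsup T F l = esssup (restrict_space lborel ((\<lambda>c. l + c) ` fund T)) F"

definition amalg_seq :: "('b::euclidean_space \<Rightarrow> 'b) \<Rightarrow> ('b \<Rightarrow> ereal) \<Rightarrow> 'b \<Rightarrow> complex" where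
  "amalg_seq T F = (\<lambda>l. if l \<in> lat T then complex_of_real (real_of_ereal (locsup T F l)) else 0)"

text \<open>F (given through |F|, as a nonnegative ereal function) belongs to W(A).\<close>
definition in_WA :: "('b::euclidean_space \<Rightarrow> 'b) \<Rightarrow> ('b \<Rightarrow> complex) set \<Rightarrow> ('b \<Rightarrow> ereal) \<Rightarrow> bool" where
  "in_WA T A F \<longleftrightarrow> F \<in> borel_measurable lborel \<and> (\<forall>l\<in>lat T. locsup T F l \<noteq> \<infinity>)
      \<and> amalg_seq T F \<in> A"

definition WA_norm :: "('b::euclidean_space \<Rightarrow> 'b) \<Rightarrow> (('b \<Rightarrow> complex) \<Rightarrow> real) \<Rightarrow> ('b \<Rightarrow> ereal) \<Rightarrow> real" where
  "WA_norm T n F = n (amalg_seq T F)"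

text \<open>G_Phi(sigma)(zeta) = ess sup_z |V_Phi sigma(z,zeta)|, V_Phi sigma(z,zeta) = <sigma, pi(z,zeta) Phi>.\<close>
definition grand_symbol :: "((('c::euclidean_space) \<times> 'c \<Rightarrow> complex) \<Rightarrow> complex)
     \<Rightarrow> ('c \<times> 'c \<Rightarrow> complex) \<Rightarrow> 'c \<times> 'c \<Rightarrow> ereal" where
  "grand_symbol \<sigma> \<Phi> \<zeta> = esssup lborel (\<lambda>z. ereal (cmod (\<sigma> (tfs (z, \<zeta>) \<Phi>))))"

definition jmap :: "'c::euclidean_space \<times> 'c \<Rightarrow> 'c \<times> 'c" where
  "jmap \<zeta> = (snd \<zeta>, - fst \<zeta>)"

definition gabor_matrix :: "((('c::euclidean_space) \<times> 'c \<Rightarrow> complex) \<Rightarrow> complex)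
     \<Rightarrow> ('c \<Rightarrow> complex) \<Rightarrow> 'c \<times> 'c \<Rightarrow> 'c \<times> 'c \<Rightarrow> complex" where
  "gabor_matrix \<sigma> g l \<mu> = weyl_pair \<sigma> (tfs \<mu> g) (tfs l g)"

definition gabor_diag :: "('c::euclidean_space \<times> 'c) set \<Rightarrow> ((('c) \<times> 'c \<Rightarrow> complex) \<Rightarrow> complex)
     \<Rightarrow> ('c \<Rightarrow> complex) \<Rightarrow> 'c \<times> 'c \<Rightarrow> complex" where
  "gabor_diag \<Lambda> \<sigma> g = (\<lambda>\<mu>. if \<mu> \<in> \<Lambda>
      then complex_of_real (SUP l\<in>\<Lambda>. cmod (gabor_matrix \<sigma> g l (l - \<mu>))) else 0)"

definition L0 :: "('c::euclidean_space \<times> 'c) set \<Rightarrow> ('c \<Rightarrow> complex) \<Rightarrow> ('c \<Rightarrow> complex) set" where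
  "L0 \<Lambda> g = {f. \<exists>S c. finite S \<and> S \<subseteq> \<Lambda> \<and> f = (\<lambda>t. \<Sum>l\<in>S. c l * tfs l g t)}"

definition coeff :: "('c::euclidean_space \<times> 'c) set \<Rightarrow> ('c \<Rightarrow> complex) \<Rightarrow> ('c \<Rightarrow> complex) \<Rightarrow> 'c \<times> 'c \<Rightarrow> complex" where
  "coeff \<Lambda> g f = (\<lambda>l. if l \<in> \<Lambda> then l2_inner f (tfs l g) else 0)"

definition weyl_coeff :: "('c::euclidean_space \<times> 'c) set \<Rightarrow> ((('c) \<times> 'c \<Rightarrow> complex) \<Rightarrow> complex)
    \<Rightarrow> ('c \<Rightarrow> complex) \<Rightarrow> ('c \<Rightarrow> complex) \<Rightarrow> 'c \<times> 'c \<Rightarrow> complex" where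
  "weyl_coeff \<Lambda> \<sigma> g f = (\<lambda>l. if l \<in> \<Lambda> then weyl_pair \<sigma> f (tfs l g) else 0)"

definition tight_gabor_frame :: "('c::euclidean_space \<times> 'c) set \<Rightarrow> ('c \<Rightarrow> complex) \<Rightarrow> bool" where
  "tight_gabor_frame \<Lambda> g \<longleftrightarrow> g \<in> L2 \<and>
     (\<forall>f\<in>L2. (\<lambda>l. (cmod (l2_inner f (tfs l g)))\<^sup>2) summable_on \<Lambda> \<and>
              l2_normsq f = (\<Sum>\<^sub>\<infinity>l\<in>\<Lambda>. (cmod (l2_inner f (tfs l g)))\<^sup>2))"

end

theory Submission
  imports Defs
begin

text \<open>
  Every solid involutive convolution algebra is contained in \<open>\<ell>\<^sup>1\<close>, so \<open>V\<^sub>g g \<in> W(\<A>)\<close> is integrable.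
  Some frame element has nonzero inner product with the Gaussian, and Moyal's formula then shows
  that \<open>g\<close> lies in Feichtinger's algebra \<open>S\<^sub>0\<close>. Time-frequency shifts act continuously on \<open>S\<^sub>0\<close>, and
  the Wigner distribution is a bounded sesquilinear map \<open>S\<^sub>0 \<times> S\<^sub>0 \<rightarrow> S\<^sub>0\<close>, so \<open>M(\<sigma>)\<close> is the restriction
  of a continuous function. Covariance of the Wigner distribution gives
  \<open>|M(\<sigma>)\<^sub>\<lambda>\<^sub>\<mu>| = |\<V>\<^sub>\<Phi> \<sigma>((\<lambda> + \<mu>)/2, j(\<lambda> - \<mu>))|\<close> with \<open>\<Phi> = W(g, g)\<close>, and by continuity the local
  suprema of the grand symbol dominate these point values. Frame expansions converge in \<open>S\<^sub>0\<close>, so the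
  coefficients of \<open>\<sigma>\<^sup>w f\<close> are \<open>M(\<sigma>)\<close> applied to those of \<open>f\<close>, which convolution with the diagonal
  suprema dominates. They are fixed by the Gram matrix of the frame; hence synthesis of finite
  sequences that approximate them yields approximants in \<open>\<L>\<^sub>0\<close>.\<close>

section \<open>Integration over Euclidean spaces\<close>

abbreviation nn_integral_lborel :: "('a::euclidean_space \<Rightarrow> ennreal) \<Rightarrow> ennreal"
    (binder \<open>LBINT\<^sup>+\<close> 10) where
  "nn_integral_lborel f \<equiv> integral\<^sup>N lborel f"

lemma integrable_dominated:
  fixes f :: "'a \<Rightarrow> 'b::{banach, second_countable_topology}" and g :: "'a \<Rightarrow> real"
  assumes "integrable M g" "f \<in> borel_measurable M" and "\<And>x. norm (f x) \<le> g x"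
  shows "integrable M f"
  using assms(1,2) by (rule Bochner_Integration.integrable_bound)
    (auto intro!: AE_I2 order.trans[OF assms(3)])

lemma ennreal_norm_integral_le:
  fixes f :: "'a \<Rightarrow> 'b::{banach, second_countable_topology}"
  shows "ennreal (norm (integral\<^sup>L M f)) \<le> (\<integral>\<^sup>+x. ennreal (norm (f x)) \<partial>M)"
  by (cases "integrable M f") (simp_all add: integral_norm_bound_ennreal not_integrable_integral_eq)

lemma borel_measurable_cis [measurable (raw)]:
  "f \<in> borel_measurable M \<Longrightarrow> (\<lambda>x. cis (f x)) \<in> borel_measurable M"
  by (erule measurable_compose) (intro borel_measurable_continuous_onI continuous_intros)

lemma borel_measurable_cnj [measurable (raw)]:
  "f \<in> borel_measurable M \<Longrightarrow> (\<lambda>x. cnj (f x)) \<in> borel_measurable M"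
  by (erule measurable_compose) (intro borel_measurable_continuous_onI continuous_intros)

lemma borel_measurable_fst [measurable (raw)]:
  fixes f :: "'a \<Rightarrow> 'b::topological_space \<times> 'c::topological_space"
  shows "f \<in> borel_measurable M \<Longrightarrow> (\<lambda>x. fst (f x)) \<in> borel_measurable M"
  by (erule measurable_compose) (intro borel_measurable_continuous_onI continuous_intros)

lemma borel_measurable_snd [measurable (raw)]:
  fixes f :: "'a \<Rightarrow> 'b::topological_space \<times> 'c::topological_space"
  shows "f \<in> borel_measurable M \<Longrightarrow> (\<lambda>x. snd (f x)) \<in> borel_measurable M"
  by (erule measurable_compose) (intro borel_measurable_continuous_onI continuous_intros)

subsection \<open>Affine substitutions\<close>

lemma nn_integral_lborel_affine:
  fixes f :: "'a::euclidean_space \<Rightarrow> ennreal"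
  assumes [measurable]: "f \<in> borel_measurable borel" and c: "c \<noteq> 0"
  shows "(LBINT\<^sup>+x. f x) = ennreal (\<bar>c\<bar> ^ DIM('a)) * (LBINT\<^sup>+x. f (t + c *\<^sub>R x))"
  by (subst lborel_affine[OF c, of t])
     (simp add: nn_integral_density nn_integral_distr nn_integral_cmult ennreal_power)

lemma lborel_integrable_affine:
  fixes f :: "'a::euclidean_space \<Rightarrow> 'b::{banach, second_countable_topology}"
  assumes f: "integrable lborel f" and c: "c \<noteq> 0"
  shows "integrable lborel (\<lambda>x. f (t + c *\<^sub>R x))"
proof -
  have [measurable]: "f \<in> borel_measurable borel" using f by auto
  have "(LBINT\<^sup>+x. norm (f x)) < \<infinity>" using f by (simp add: integrable_iff_bounded)
  then have "(LBINT\<^sup>+x. norm (f (t + c *\<^sub>R x))) < \<infinity>"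
    using nn_integral_lborel_affine[of "\<lambda>x. ennreal (norm (f x))" c t] c
    by (auto simp: ennreal_mult_less_top)
  then show ?thesis by (auto simp: integrable_iff_bounded)
qed

lemma lborel_integral_affine:
  fixes f :: "'a::euclidean_space \<Rightarrow> 'b::{banach, second_countable_topology}"
  assumes [measurable]: "f \<in> borel_measurable borel" and c: "c \<noteq> 0"
  shows "(LBINT x. f x) = \<bar>c\<bar> ^ DIM('a) *\<^sub>R (LBINT x. f (t + c *\<^sub>R x))"
proof -
  have "(LBINT x. f x)
      = (\<integral>x. f x \<partial>density (distr lborel borel (\<lambda>x. t + c *\<^sub>R x)) (\<lambda>_. ennreal (\<bar>c\<bar> ^ DIM('a))))"
    by (subst lborel_affine[OF c, of t]) (simp add: ennreal_power)
  also have "\<dots> = \<bar>c\<bar> ^ DIM('a) *\<^sub>R (LBINT x. f (t + c *\<^sub>R x))"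
    by (subst integral_density) (auto simp: integral_distr)
  finally show ?thesis .
qed

lemma lborel_integral_shift:
  fixes f :: "'a::euclidean_space \<Rightarrow> 'b::{banach, second_countable_topology}"
  assumes "f \<in> borel_measurable borel"
  shows "(LBINT x. f (x - t)) = (LBINT x. f x)"
  using lborel_integral_affine[OF assms, of 1 "- t"] by simp

lemma lborel_integrable_shift:
  fixes f :: "'a::euclidean_space \<Rightarrow> 'b::{banach, second_countable_topology}"
  assumes "integrable lborel f"
  shows "integrable lborel (\<lambda>x. f (x - t))"
  using lborel_integrable_affine[OF assms, of 1 "- t"] by simp

lemma nn_integral_lborel_shift:
  fixes f :: "'a::euclidean_space \<Rightarrow> ennreal"
  assumes "f \<in> borel_measurable borel"
  shows "(LBINT\<^sup>+x. f (x - t)) = (LBINT\<^sup>+x. f x)"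
  using nn_integral_lborel_affine[OF assms, of 1 "- t"] by simp

subsection \<open>Iterated integrals\<close>

lemma nn_integral_lborel_pair:
  fixes f :: "'a::euclidean_space \<times> 'b::euclidean_space \<Rightarrow> ennreal"
  assumes "f \<in> borel_measurable borel"
  shows "(LBINT\<^sup>+z. f z) = (LBINT\<^sup>+x. LBINT\<^sup>+y. f (x, y))"
  using lborel.nn_integral_fst[of f "lborel :: 'a measure"] assms by (simp add: lborel_prod)

lemma nn_integral_lborel_swap:
  fixes f :: "'a::euclidean_space \<times> 'b::euclidean_space \<Rightarrow> ennreal"
  assumes "f \<in> borel_measurable borel"
  shows "(LBINT\<^sup>+x. LBINT\<^sup>+y. f (x, y)) = (LBINT\<^sup>+y. LBINT\<^sup>+x. f (x, y))"
  using assms by (intro lborel_pair.Fubini'[symmetric]) (auto simp: lborel_prod)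

lemma measurable_lborel_integral:
  fixes f :: "'a::euclidean_space \<times> 'b::euclidean_space \<Rightarrow> 'c::{banach, second_countable_topology}"
  assumes "f \<in> borel_measurable borel"
  shows "(\<lambda>x. LBINT y. f (x, y)) \<in> borel_measurable borel"
  using lborel.borel_measurable_lebesgue_integral[of "\<lambda>x y. f (x, y)" "lborel :: 'a measure"] assms
  by (simp add: lborel_prod)

lemma measurable_lborel_nn_integral:
  fixes f :: "'a::euclidean_space \<times> 'b::euclidean_space \<Rightarrow> ennreal"
  assumes "f \<in> borel_measurable borel"
  shows "(\<lambda>x. LBINT\<^sup>+y. f (x, y)) \<in> borel_measurable borel"
  using lborel.borel_measurable_nn_integral_fst[of f "lborel :: 'a measure"] assms
  by (simp add: lborel_prod)

lemma lborel_pair_integral: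
  fixes f :: "'a::euclidean_space \<times> 'b::euclidean_space \<Rightarrow> 'c::{banach, second_countable_topology}"
  assumes "integrable lborel f"
  shows "(LBINT z. f z) = (LBINT x. LBINT y. f (x, y))"
  using lborel_pair.integral_fst'[of f] assms by (simp add: lborel_prod)

lemma lborel_swap_integral:
  fixes f :: "'a::euclidean_space \<times> 'b::euclidean_space \<Rightarrow> 'c::{banach, second_countable_topology}"
  assumes "integrable lborel f"
  shows "(LBINT x. LBINT y. f (x, y)) = (LBINT y. LBINT x. f (x, y))"
  using lborel_pair.Fubini_integral[of "\<lambda>x y. f (x, y)"] assms by (simp add: lborel_prod)

lemma integrable_lborel_pairI:
  fixes f :: "'a::euclidean_space \<times> 'b::euclidean_space \<Rightarrow> 'c::{banach, second_countable_topology}"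
  assumes [measurable]: "f \<in> borel_measurable borel"
    and "(LBINT\<^sup>+x. LBINT\<^sup>+y. ennreal (norm (f (x, y)))) < \<infinity>"
  shows "integrable lborel f"
  using assms nn_integral_lborel_pair[of "\<lambda>z. ennreal (norm (f z))"]
  by (simp add: integrable_iff_bounded)

lemma integrable_tensor_product:
  fixes u :: "'a::euclidean_space \<Rightarrow> 'c::{real_normed_field, banach, second_countable_topology}"
    and v :: "'b::euclidean_space \<Rightarrow> 'c"
  assumes u: "integrable lborel u" and v: "integrable lborel v"
  shows "integrable lborel (\<lambda>p. u (fst p) * v (snd p))"
proof (rule integrable_lborel_pairI)
  have [measurable]: "u \<in> borel_measurable borel" "v \<in> borel_measurable borel" using u v by auto
  show "(\<lambda>p. u (fst p) * v (snd p)) \<in> borel_measurable borel" by measurable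
  show "(LBINT\<^sup>+x. LBINT\<^sup>+y. ennreal (norm (u (fst (x, y)) * v (snd (x, y))))) < \<infinity>"
    using u v
    by (simp add: norm_mult ennreal_mult nn_integral_cmult nn_integral_multc ennreal_mult_less_top
      integrable_iff_bounded)
qed

lemma integrable_convolution_kernel:
  fixes u v :: "'a::euclidean_space \<Rightarrow> 'c::{real_normed_field, banach, second_countable_topology}"
  assumes u: "integrable lborel u" and v: "integrable lborel v"
  shows "integrable lborel (\<lambda>p. u (fst p) * v (snd p - fst p))"
proof (rule integrable_lborel_pairI)
  have [measurable]: "u \<in> borel_measurable borel" "v \<in> borel_measurable borel" using u v by auto
  show "(\<lambda>p. u (fst p) * v (snd p - fst p)) \<in> borel_measurable borel" by measurable
  show "(LBINT\<^sup>+x. LBINT\<^sup>+y. ennreal (norm (u (fst (x, y)) * v (snd (x, y) - fst (x, y))))) < \<infinity>"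
    using u v nn_integral_lborel_shift[of "\<lambda>y. ennreal (norm (v y))"]
    by (simp add: norm_mult ennreal_mult nn_integral_cmult nn_integral_multc ennreal_mult_less_top
      integrable_iff_bounded)
qed

lemma integral_convolution_reflected:
  fixes u v :: "'a::euclidean_space \<Rightarrow> 'c::{real_normed_field, banach, second_countable_topology}"
  assumes u: "integrable lborel u" and v: "integrable lborel v"
  shows "(LBINT x. LBINT t. u t * v (t - x)) = (LBINT t. u t) * (LBINT t. v t)"
proof -
  have [measurable]: "u \<in> borel_measurable borel" "v \<in> borel_measurable borel" using u v by auto
  have v': "integrable lborel (\<lambda>t. v (- t))"
    using lborel_integrable_affine[OF v, of "-1" 0] by simp
  have reflect: "(LBINT x. v (t - x)) = (LBINT t. v t)" for t
    using lborel_integral_affine[of v "-1" t] by simp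
  have "(LBINT x. LBINT t. u t * v (t - x)) = (LBINT t. LBINT x. u t * v (t - x))"
    using lborel_swap_integral[OF integrable_convolution_kernel[OF u v']] by simp
  then show ?thesis by (simp add: reflect)
qed

text \<open>The coordinates \<open>(x + t/2, x - t/2)\<close> have Jacobian \<open>\<plusminus>1\<close>: two successive affine substitutions
  contribute the factors \<open>(1/2)\<^sup>d\<close> and \<open>2\<^sup>d\<close>.\<close>
lemma nn_integral_midpoint_coordinates:
  fixes G :: "'a::euclidean_space \<times> 'a \<Rightarrow> ennreal"
  assumes [measurable]: "G \<in> borel_measurable borel"
  shows "(LBINT\<^sup>+x. LBINT\<^sup>+t. G (x + (1/2) *\<^sub>R t, x - (1/2) *\<^sub>R t)) = (LBINT\<^sup>+p. G p)"
proof -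
  let ?I = "LBINT\<^sup>+x. LBINT\<^sup>+t. G (x + (1/2) *\<^sub>R t, x - (1/2) *\<^sub>R t)"
  let ?c = "ennreal ((1/2) ^ DIM('a))" and ?d = "ennreal (2 ^ DIM('a))"
  have first: "(LBINT\<^sup>+u. G (u, 2 *\<^sub>R x - u))
      = ?c * (LBINT\<^sup>+t. G (x + (1/2) *\<^sub>R t, x - (1/2) *\<^sub>R t))" for x
  proof -
    have reflected: "2 *\<^sub>R x - (x + (1/2) *\<^sub>R t) = x - (1/2) *\<^sub>R t" for t by (simp add: scaleR_2)
    show ?thesis
      using nn_integral_lborel_affine[of "\<lambda>u. G (u, 2 *\<^sub>R x - u)" "1/2" x, unfolded reflected]
      by simp
  qed
  have second: "(LBINT\<^sup>+v. G (u, v)) = ?d * (LBINT\<^sup>+x. G (u, 2 *\<^sub>R x - u))" for u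
    using nn_integral_lborel_affine[of "\<lambda>v. G (u, v)" 2 "- u"] by simp
  have [measurable]: "(\<lambda>x. LBINT\<^sup>+t. G (x + (1/2) *\<^sub>R t, x - (1/2) *\<^sub>R t)) \<in> borel_measurable borel"
    using measurable_lborel_nn_integral[of "\<lambda>p. G (fst p + (1/2) *\<^sub>R snd p, fst p - (1/2) *\<^sub>R snd p)"]
    by simp
  have [measurable]: "(\<lambda>u. LBINT\<^sup>+x. G (u, 2 *\<^sub>R x - u)) \<in> borel_measurable borel"
    using measurable_lborel_nn_integral[of "\<lambda>p. G (fst p, 2 *\<^sub>R snd p - fst p)"] by simp
  have "(LBINT\<^sup>+p. G p) = ?d * (LBINT\<^sup>+u. LBINT\<^sup>+x. G (u, 2 *\<^sub>R x - u))"
    by (simp add: nn_integral_lborel_pair second nn_integral_cmult)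
  also have "(LBINT\<^sup>+u. LBINT\<^sup>+x. G (u, 2 *\<^sub>R x - u)) = (LBINT\<^sup>+x. LBINT\<^sup>+u. G (u, 2 *\<^sub>R x - u))"
    using nn_integral_lborel_swap[of "\<lambda>p. G (fst p, 2 *\<^sub>R snd p - fst p)"] by simp
  also have "\<dots> = ?c * ?I"
    by (simp add: first nn_integral_cmult)
  also have "?d * (?c * ?I) = ?I"
    by (simp flip: mult.assoc ennreal_mult power_mult_distrib)
  finally show ?thesis ..
qed

lemma lborel_distr_midpoint_coordinates:
  "distr lborel borel (\<lambda>p. (fst p + (1/2) *\<^sub>R snd p, fst p - (1/2) *\<^sub>R snd p))
    = (lborel :: ('a::euclidean_space \<times> 'a) measure)"
    (is "distr lborel borel ?m = _")
proof (rule measure_eqI)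
  fix S :: "('a \<times> 'a) set" assume "S \<in> sets (distr lborel borel ?m)"
  then have [measurable]: "S \<in> sets borel" by simp
  have "emeasure (distr lborel borel ?m) S = (LBINT\<^sup>+p. indicator S (?m p))"
    by (subst nn_integral_indicator[symmetric])
      (simp_all add: nn_integral_distr del: nn_integral_indicator)
  also have "\<dots> = (LBINT\<^sup>+x. LBINT\<^sup>+t. indicator S (x + (1/2) *\<^sub>R t, x - (1/2) *\<^sub>R t))"
    by (subst nn_integral_lborel_pair) simp_all
  finally show "emeasure (distr lborel borel ?m) S = emeasure lborel S"
    by (simp add: nn_integral_midpoint_coordinates)
qed simp

lemma integral_midpoint_coordinates:
  fixes G :: "'a::euclidean_space \<times> 'a \<Rightarrow> 'b::{banach, second_countable_topology}"
  assumes G: "integrable lborel G"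
  shows "(LBINT x. LBINT t. G (x + (1/2) *\<^sub>R t, x - (1/2) *\<^sub>R t)) = (LBINT p. G p)"
proof -
  define m :: "'a \<times> 'a \<Rightarrow> 'a \<times> 'a"
    where "m p = (fst p + (1/2) *\<^sub>R snd p, fst p - (1/2) *\<^sub>R snd p)" for p
  have [measurable]: "m \<in> borel_measurable borel" unfolding m_def by measurable
  have distr: "distr lborel borel m = lborel"
    using lborel_distr_midpoint_coordinates by (simp add: m_def[abs_def])
  have "integrable (distr lborel borel m) G" using G by (simp add: distr)
  then have "integrable lborel (\<lambda>p. G (m p))"
    by (subst (asm) integrable_distr_eq) (use G in auto)
  from lborel_pair_integral[OF this]
  have "(LBINT x. LBINT t. G (x + (1/2) *\<^sub>R t, x - (1/2) *\<^sub>R t)) = (LBINT p. G (m p))"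
    by (simp add: m_def)
  also have "\<dots> = (\<integral>p. G p \<partial>distr lborel borel m)"
    by (rule integral_distr[symmetric]) (use G in auto)
  finally show ?thesis by (simp only: distr)
qed

section \<open>Square-integrable functions and time-frequency shifts\<close>

lemma L2_measurable: "f \<in> L2 \<Longrightarrow> f \<in> borel_measurable borel"
  by (simp add: L2_def)

lemma L2_integrable: "f \<in> L2 \<Longrightarrow> integrable lborel (\<lambda>t. (cmod (f t))\<^sup>2)"
  by (simp add: L2_def)

lemma L2_zero: "(\<lambda>t. 0) \<in> L2"
  by (simp add: L2_def)

lemma L2_cnj: "f \<in> L2 \<Longrightarrow> (\<lambda>t. cnj (f t)) \<in> L2"
  by (auto simp: L2_def)

lemma L2_scale: "f \<in> L2 \<Longrightarrow> (\<lambda>t. c * f t) \<in> L2"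
  by (auto simp: L2_def norm_mult power_mult_distrib)

lemma norm_mult_le_squares:
  fixes a b :: "'a::real_normed_algebra"
  shows "2 * norm (a * b) \<le> (norm a)\<^sup>2 + (norm b)\<^sup>2"
  using norm_mult_ineq[of a b] sum_squares_bound[of "norm a" "norm b"] by simp

lemma norm_add_squared_le:
  fixes a b :: "'a::real_normed_vector"
  shows "(norm (a + b))\<^sup>2 \<le> 2 * (norm a)\<^sup>2 + 2 * (norm b)\<^sup>2"
proof -
  have "(norm (a + b))\<^sup>2 \<le> (norm a + norm b)\<^sup>2"
    by (intro power_mono norm_triangle_ineq) auto
  then show ?thesis
    using sum_squares_bound[of "norm a" "norm b"] by (simp add: power2_sum)
qed

lemma L2_mult_integrable:
  assumes f: "f \<in> L2" and h: "h \<in> L2"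
  shows "integrable lborel (\<lambda>t. f t * h t)"
proof (rule integrable_dominated)
  show "integrable lborel (\<lambda>t. (cmod (f t))\<^sup>2 + (cmod (h t))\<^sup>2)"
    using L2_integrable[OF f] L2_integrable[OF h] by simp
  show "(\<lambda>t. f t * h t) \<in> borel_measurable lborel"
    using L2_measurable[OF f] L2_measurable[OF h] by simp
  show "norm (f t * h t) \<le> (cmod (f t))\<^sup>2 + (cmod (h t))\<^sup>2" for t
    using norm_mult_le_squares[of "f t" "h t"] norm_ge_zero[of "f t * h t"] by linarith
qed

lemma L2_inner_integrable: "f \<in> L2 \<Longrightarrow> h \<in> L2 \<Longrightarrow> integrable lborel (\<lambda>t. f t * cnj (h t))"
  using L2_mult_integrable L2_cnj by blast

lemma L2_add:
  assumes f: "f \<in> L2" and h: "h \<in> L2"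
  shows "(\<lambda>t. f t + h t) \<in> L2"
proof -
  have [measurable]: "f \<in> borel_measurable borel" "h \<in> borel_measurable borel"
    using f h by (auto intro: L2_measurable)
  have "integrable lborel (\<lambda>t. (cmod (f t + h t))\<^sup>2)"
  proof (rule integrable_dominated)
    show "integrable lborel (\<lambda>t. 2 * (cmod (f t))\<^sup>2 + 2 * (cmod (h t))\<^sup>2)"
      using L2_integrable[OF f] L2_integrable[OF h] by simp
  qed (use norm_add_squared_le in auto)
  then show ?thesis by (simp add: L2_def)
qed

lemma L2_diff: "f \<in> L2 \<Longrightarrow> h \<in> L2 \<Longrightarrow> (\<lambda>t. f t - h t) \<in> L2"
  using L2_add[of f "\<lambda>t. - 1 * h t"] L2_scale[of h "- 1"] by simp

lemma L2_affine:
  assumes f: "f \<in> L2" and c: "c \<noteq> 0"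
  shows "(\<lambda>t. f (x + c *\<^sub>R t)) \<in> L2"
  using L2_measurable[OF f] lborel_integrable_affine[OF L2_integrable[OF f] c, of x]
  by (simp add: L2_def)

lemma l2_normsq_nonneg: "0 \<le> l2_normsq f"
  by (simp add: l2_normsq_def)

lemma l2_normsq_affine:
  fixes f :: "'a::euclidean_space \<Rightarrow> complex"
  assumes "f \<in> L2" and "c \<noteq> 0"
  shows "l2_normsq f = \<bar>c\<bar> ^ DIM('a) * l2_normsq (\<lambda>t. f (x + c *\<^sub>R t))"
  using lborel_integral_affine[of "\<lambda>t. (cmod (f t))\<^sup>2" c x] assms L2_measurable[of f]
  by (simp add: l2_normsq_def)

subsection \<open>The inner product\<close>

lemma l2_inner_add_left: "f \<in> L2 \<Longrightarrow> h \<in> L2 \<Longrightarrow> u \<in> L2 \<Longrightarrow>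
  l2_inner (\<lambda>t. f t + h t) u = l2_inner f u + l2_inner h u"
  by (simp add: l2_inner_def distrib_right L2_inner_integrable)

lemma l2_inner_diff_left: "f \<in> L2 \<Longrightarrow> h \<in> L2 \<Longrightarrow> u \<in> L2 \<Longrightarrow>
  l2_inner (\<lambda>t. f t - h t) u = l2_inner f u - l2_inner h u"
  by (simp add: l2_inner_def left_diff_distrib L2_inner_integrable)

lemma l2_inner_sum_left: "(\<And>m. m \<in> S \<Longrightarrow> F m \<in> L2) \<Longrightarrow> u \<in> L2 \<Longrightarrow>
  l2_inner (\<lambda>t. \<Sum>m\<in>S. F m t) u = (\<Sum>m\<in>S. l2_inner (F m) u)"
  by (simp add: l2_inner_def sum_distrib_right L2_inner_integrable)

lemma l2_inner_scale_left: "l2_inner (\<lambda>t. c * f t) u = c * l2_inner f u"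
  by (simp add: l2_inner_def mult.assoc)

lemma cnj_l2_inner: "cnj (l2_inner f u) = l2_inner u f"
  unfolding l2_inner_def by (simp add: mult.commute flip: Bochner_Integration.integral_cnj)

lemma l2_inner_scale_right: "l2_inner f (\<lambda>t. c * u t) = cnj c * l2_inner f u"
  using cnj_l2_inner[of "\<lambda>t. c * u t" f] cnj_l2_inner[of u f] by (simp add: l2_inner_scale_left)

lemma l2_inner_add_right: "f \<in> L2 \<Longrightarrow> h \<in> L2 \<Longrightarrow> u \<in> L2 \<Longrightarrow>
  l2_inner u (\<lambda>t. f t + h t) = l2_inner u f + l2_inner u h"
  using cnj_l2_inner[of "\<lambda>t. f t + h t" u] cnj_l2_inner[of f u] cnj_l2_inner[of h u]
  by (simp add: l2_inner_add_left)

lemma l2_inner_Cauchy_Schwarz: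
  assumes f: "f \<in> L2" and h: "h \<in> L2"
  shows "(cmod (l2_inner f h))\<^sup>2 \<le> l2_normsq f * l2_normsq h"
proof -
  have [measurable]: "f \<in> borel_measurable borel" "h \<in> borel_measurable borel"
    using f h by (auto intro: L2_measurable)
  have "ennreal ((cmod (l2_inner f h))\<^sup>2) \<le> (LBINT\<^sup>+t. ennreal (cmod (f t * cnj (h t))))\<^sup>2"
    unfolding l2_inner_def by (simp add: power_mono ennreal_norm_integral_le flip: ennreal_power)
  also have "\<dots> = (LBINT\<^sup>+t. ennreal (cmod (f t)) * ennreal (cmod (h t)))\<^sup>2"
    by (simp add: norm_mult ennreal_mult)
  also have "\<dots> \<le> (LBINT\<^sup>+t. ennreal (cmod (f t))^2) * (LBINT\<^sup>+t. ennreal (cmod (h t))^2)"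
    by (rule Cauchy_Schwarz_nn_integral) auto
  also have "\<dots> = ennreal (l2_normsq f * l2_normsq h)"
    using nn_integral_eq_integral[OF L2_integrable[OF f]]
      nn_integral_eq_integral[OF L2_integrable[OF h]]
    by (simp add: ennreal_power l2_normsq_def ennreal_mult)
  finally show ?thesis
    by (simp add: l2_normsq_nonneg)
qed

lemma cmod_l2_inner_le: "f \<in> L2 \<Longrightarrow> h \<in> L2 \<Longrightarrow> cmod (l2_inner f h) \<le> sqrt (l2_normsq f * l2_normsq h)"
  by (rule real_le_rsqrt[OF l2_inner_Cauchy_Schwarz])

lemma of_real_l2_normsq: "complex_of_real (l2_normsq f) = l2_inner f f"
  unfolding l2_normsq_def l2_inner_def
  by (simp add: complex_norm_square flip: integral_complex_of_real del: of_real_power)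

lemma l2_inner_polarization:
  assumes f: "f \<in> L2" and h: "h \<in> L2"
  shows "l2_inner f h = (of_real (l2_normsq (\<lambda>t. f t + h t)) - of_real (l2_normsq (\<lambda>t. f t - h t))
    + \<i> * of_real (l2_normsq (\<lambda>t. f t + \<i> * h t))
        - \<i> * of_real (l2_normsq (\<lambda>t. f t - \<i> * h t))) / 4"
proof -
  have sum: "of_real (l2_normsq (\<lambda>t. f t + c * h t))
      = l2_inner f f + cnj c * l2_inner f h + c * l2_inner h f + c * cnj c * l2_inner h h" for c
    unfolding of_real_l2_normsq
    by (simp add: l2_inner_add_left l2_inner_add_right L2_add L2_scale f h
      l2_inner_scale_left l2_inner_scale_right algebra_simps)
  show ?thesis
    using sum[of 1] sum[of "-1"] sum[of \<i>] sum[of "- \<i>"] by (simp add: ring_distribs)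
qed

subsection \<open>Time-frequency shifts\<close>

lemma tfs_measurable [measurable]:
  assumes [measurable]: "f \<in> borel_measurable borel"
  shows "tfs z f \<in> borel_measurable borel"
  unfolding tfs_def by measurable

lemma cmod_tfs: "cmod (tfs z f t) = cmod (f (t - fst z))"
  by (simp add: tfs_def norm_mult)

lemma tfs_0 [simp]: "tfs 0 f = f"
  by (simp add: tfs_def)

lemma L2_tfs:
  assumes f: "f \<in> L2" shows "tfs z f \<in> L2"
  using L2_measurable[OF f] lborel_integrable_shift[OF L2_integrable[OF f], of "fst z"]
  by (simp add: L2_def cmod_tfs tfs_measurable)

lemma tfs_tfs: "tfs w (tfs z f) = (\<lambda>t. cis (- 2 * pi * (snd z \<bullet> fst w)) * tfs (w + z) f t)"
proof (rule ext)
  fix t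
  have "cis (2 * pi * (snd w \<bullet> t)) * cis (2 * pi * (snd z \<bullet> (t - fst w)))
      = cis (- 2 * pi * (snd z \<bullet> fst w)) * cis (2 * pi * (snd (w + z) \<bullet> t))"
    by (simp add: cis_mult inner_diff_right inner_add_left algebra_simps)
  then show "tfs w (tfs z f) t = cis (- 2 * pi * (snd z \<bullet> fst w)) * tfs (w + z) f t"
    by (simp add: tfs_def diff_diff_eq flip: mult.assoc)
qed

lemma l2_inner_tfs_tfs:
  assumes [measurable]: "f \<in> borel_measurable borel" "h \<in> borel_measurable borel"
  shows "l2_inner (tfs w f) (tfs w h) = l2_inner f h"
proof -
  have "tfs w f t * cnj (tfs w h t) = f (t - fst w) * cnj (h (t - fst w))" for t
    by (simp add: tfs_def cis_cnj cis_mult)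
  then show ?thesis unfolding l2_inner_def
    using lborel_integral_shift[of "\<lambda>t. f t * cnj (h t)" "fst w"] by simp
qed

subsection \<open>The short-time Fourier transform\<close>

lemma stft_tfs:
  assumes "f \<in> borel_measurable borel" "h \<in> borel_measurable borel"
  shows "stft h (tfs w f) z = cis (- 2 * pi * ((snd z - snd w) \<bullet> fst w)) * stft h f (z - w)"
proof -
  have "tfs z h = (\<lambda>t. cis (2 * pi * ((snd z - snd w) \<bullet> fst w)) * tfs w (tfs (z - w) h) t)"
    by (simp add: tfs_tfs cis_mult flip: mult.assoc)
  then show ?thesis
    using l2_inner_tfs_tfs[of f "tfs (z - w) h" w] assms
    by (simp add: stft_def l2_inner_scale_right cis_cnj)
qed

lemma cmod_stft_tfs:
  "f \<in> borel_measurable borel \<Longrightarrow> h \<in> borel_measurable borel \<Longrightarrow>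
    cmod (stft h (tfs w f) z) = cmod (stft h f (z - w))"
  by (simp add: stft_tfs norm_mult)

lemma cmod_stft_window_tfs: "cmod (stft (tfs w h) f z) = cmod (stft h f (z + w))"
  by (simp add: stft_def tfs_tfs l2_inner_scale_right norm_mult)

lemma stft_add: "f \<in> L2 \<Longrightarrow> f' \<in> L2 \<Longrightarrow> h \<in> L2 \<Longrightarrow>
  stft h (\<lambda>t. f t + f' t) = (\<lambda>z. stft h f z + stft h f' z)"
  by (rule ext) (simp add: stft_def l2_inner_add_left L2_tfs)

lemma stft_diff: "f \<in> L2 \<Longrightarrow> f' \<in> L2 \<Longrightarrow> h \<in> L2 \<Longrightarrow>
  stft h (\<lambda>t. f t - f' t) = (\<lambda>z. stft h f z - stft h f' z)"
  by (rule ext) (simp add: stft_def l2_inner_diff_left L2_tfs)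

lemma stft_scale: "stft h (\<lambda>t. c * f t) = (\<lambda>z. c * stft h f z)"
  by (rule ext) (simp add: stft_def l2_inner_scale_left)

lemma stft_measurable [measurable]:
  fixes f h :: "'a::euclidean_space \<Rightarrow> complex"
  assumes [measurable]: "f \<in> borel_measurable borel" "h \<in> borel_measurable borel"
  shows "stft h f \<in> borel_measurable borel"
proof -
  have "(\<lambda>p::('a \<times> 'a) \<times> 'a. f (snd p)
      * cnj (cis (2 * pi * (snd (fst p) \<bullet> snd p)) * h (snd p - fst (fst p))))
      \<in> borel_measurable borel"
    by measurable
  from measurable_lborel_integral[OF this] show ?thesis
    by (simp add: stft_def[abs_def] l2_inner_def tfs_def)
qed

lemma cmod_stft_le:
  assumes f: "f \<in> L2" and h: "h \<in> L2"
  shows "cmod (stft h f z) \<le> sqrt (l2_normsq f * l2_normsq h)"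
  using cmod_l2_inner_le[OF f L2_tfs[OF h], of z] L2_measurable[OF h]
    lborel_integral_shift[of "\<lambda>t. (cmod (h t))\<^sup>2" "fst z"]
  by (simp add: stft_def l2_normsq_def cmod_tfs)

section \<open>Fourier integrals and Gaussians\<close>

definition fourier :: "('a::euclidean_space \<Rightarrow> complex) \<Rightarrow> 'a \<Rightarrow> complex" where
  "fourier u \<xi> = (LBINT t. u t * cis (- 2 * pi * (\<xi> \<bullet> t)))"

lemma stft_eq_fourier: "stft h f (x, \<xi>) = fourier (\<lambda>t. f t * cnj (h (t - x))) \<xi>"
  by (simp add: stft_def l2_inner_def tfs_def fourier_def cis_cnj mult_ac)

lemma fourier_measurable [measurable]:
  fixes u :: "'a::euclidean_space \<Rightarrow> complex"
  assumes [measurable]: "u \<in> borel_measurable borel"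
  shows "fourier u \<in> borel_measurable borel"
  unfolding fourier_def
  using measurable_lborel_integral[of "\<lambda>p. u (snd p) * cis (- 2 * pi * (fst p \<bullet> snd p))"] by simp

lemma cmod_fourier_le: "cmod (fourier u \<xi>) \<le> (LBINT t. cmod (u t))"
  unfolding fourier_def
  using integral_norm_bound[of lborel "\<lambda>t. u t * cis (- 2 * pi * (\<xi> \<bullet> t))"] by (simp add: norm_mult)

lemma fourier_scale: "fourier (\<lambda>t. c * u t) \<xi> = c * fourier u \<xi>"
  by (simp add: fourier_def mult.assoc)

lemma fourier_tfs:
  assumes [measurable]: "u \<in> borel_measurable borel"
  shows "fourier (tfs z u) \<xi> = cis (- 2 * pi * ((\<xi> - snd z) \<bullet> fst z)) * fourier u (\<xi> - snd z)"
proof -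
  let ?v = "\<lambda>t. u t * cis (- 2 * pi * ((\<xi> - snd z) \<bullet> t))"
  have "cis (2 * pi * (snd z \<bullet> t)) * cis (- 2 * pi * (\<xi> \<bullet> t))
      = cis (- 2 * pi * ((\<xi> - snd z) \<bullet> fst z)) * cis (- 2 * pi * ((\<xi> - snd z) \<bullet> (t - fst z)))" for t
    by (simp add: cis_mult inner_diff_left inner_diff_right algebra_simps)
  then have "tfs z u t * cis (- 2 * pi * (\<xi> \<bullet> t))
      = cis (- 2 * pi * ((\<xi> - snd z) \<bullet> fst z)) * ?v (t - fst z)" for t
    by (simp add: tfs_def mult_ac)
  then have "fourier (tfs z u) \<xi>
      = cis (- 2 * pi * ((\<xi> - snd z) \<bullet> fst z)) * (LBINT t. ?v (t - fst z))"
    unfolding fourier_def by (simp only: integral_mult_right_zero)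
  also have "(LBINT t. ?v (t - fst z)) = fourier u (\<xi> - snd z)"
    unfolding fourier_def by (rule lborel_integral_shift) measurable
  finally show ?thesis .
qed

lemma fourier_multiplication:
  fixes u v :: "'a::euclidean_space \<Rightarrow> complex"
  assumes u: "integrable lborel u" and v: "integrable lborel v"
  shows "(LBINT \<xi>. fourier u \<xi> * v \<xi>) = (LBINT t. u t * fourier v t)"
proof -
  let ?G = "\<lambda>p. u (snd p) * v (fst p) * cis (- 2 * pi * (fst p \<bullet> snd p))"
  have [measurable]: "u \<in> borel_measurable borel" "v \<in> borel_measurable borel" using u v by auto
  have "integrable lborel ?G"
  proof (rule integrable_dominated)
    show "integrable lborel (\<lambda>p. cmod (v (fst p) * u (snd p)))"
      using integrable_tensor_product[OF v u] by simp
  qed (simp_all add: norm_mult)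
  from lborel_swap_integral[OF this]
  have "(LBINT \<xi>. LBINT t. ?G (\<xi>, t)) = (LBINT t. LBINT \<xi>. ?G (\<xi>, t))" .
  moreover have "(LBINT t. ?G (\<xi>, t)) = fourier u \<xi> * v \<xi>" for \<xi>
    unfolding fourier_def
    by (subst integral_mult_left_zero[symmetric]) (simp add: mult_ac)
  moreover have "(LBINT \<xi>. ?G (\<xi>, t)) = u t * fourier v t" for t
    unfolding fourier_def
    by (subst integral_mult_right_zero[symmetric]) (simp add: mult_ac inner_commute)
  ultimately show ?thesis by simp
qed

subsection \<open>Gaussians\<close>

definition gauss :: "real \<Rightarrow> 'a::euclidean_space \<Rightarrow> real" where
  "gauss a t = exp (- pi * a * (norm t)\<^sup>2)"

lemma gauss_nonneg [simp]: "0 \<le> gauss a t"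
  by (simp add: gauss_def)

lemma gauss_uminus [simp]: "gauss a (- t) = gauss a t"
  by (simp add: gauss_def)

lemma gauss_measurable [measurable (raw)]:
  "f \<in> borel_measurable M \<Longrightarrow> (\<lambda>x. gauss a (f x)) \<in> borel_measurable M"
  unfolding gauss_def by measurable

lemma gaussian_eq_gauss: "gaussian t = complex_of_real (gauss 1 t)"
  by (simp add: gaussian_def gauss_def)

lemma gauss_Pair: "gauss a (x, y) = gauss a x * gauss a y"
  by (simp add: gauss_def norm_Pair algebra_simps flip: exp_add)

lemma gauss_power2: "(gauss a t)\<^sup>2 = gauss (2 * a) t"
  by (simp add: gauss_def power2_eq_square flip: exp_add)

lemma gauss_parallelogram:
  "gauss (2 * a) x * gauss (a / 2) t = gauss a (x + (1/2) *\<^sub>R t) * gauss a (x - (1/2) *\<^sub>R t)"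
proof -
  have "(norm (x + (1/2) *\<^sub>R t))\<^sup>2 + (norm (x - (1/2) *\<^sub>R t))\<^sup>2 = 2 * (norm x)\<^sup>2 + (1/2) * (norm t)\<^sup>2"
    unfolding power2_norm_eq_inner
    by (simp add: inner_diff_left inner_diff_right inner_add_left inner_add_right inner_commute)
  then have "- pi * a * ((norm (x + (1/2) *\<^sub>R t))\<^sup>2 + (norm (x - (1/2) *\<^sub>R t))\<^sup>2)
      = - pi * (2 * a) * (norm x)\<^sup>2 + - pi * (a / 2) * (norm t)\<^sup>2"
    by (simp add: algebra_simps)
  then show ?thesis
    unfolding gauss_def by (simp add: algebra_simps flip: exp_add)
qed

lemma gauss_eq_prod: "gauss a t = (\<Prod>b\<in>Basis. gauss a (t \<bullet> b))"
proof -
  have "(norm t)\<^sup>2 = (\<Sum>b\<in>Basis. (t \<bullet> b)\<^sup>2)"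
    by (subst power2_norm_eq_inner, subst euclidean_inner) (simp add: power2_eq_square)
  then show ?thesis
    by (simp add: gauss_def exp_sum[symmetric] sum_distrib_left)
qed

lemma gauss_eq_std_normal_density:
  "0 < a \<Longrightarrow> gauss a x = sqrt (2 * pi) * std_normal_density (sqrt (2 * pi * a) * x)"
  by (simp add: gauss_def std_normal_density_def power_mult_distrib)

lemma gauss_integrable_real:
  assumes "0 < a"
  shows "integrable lborel (gauss a :: real \<Rightarrow> real)"
proof -
  have "gauss a = (\<lambda>x::real. sqrt (2 * pi) * std_normal_density (0 + sqrt (2 * pi * a) * x))"
    using gauss_eq_std_normal_density[OF assms] by auto
  moreover have "integrable lborel (\<lambda>x. std_normal_density (0 + sqrt (2 * pi * a) * x))"
    using integrable_std_normal_moment[of 0] assms by (intro lborel_integrable_real_affine) simp_all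
  ultimately show ?thesis by simp
qed

lemma gauss_integrable:
  assumes "0 < a"
  shows "integrable lborel (gauss a :: 'a::euclidean_space \<Rightarrow> real)"
proof -
  have "(LBINT\<^sup>+t. ennreal (gauss a (t::'a)))
      = (LBINT\<^sup>+t. (\<Prod>b\<in>Basis. ennreal (gauss a ((t::'a) \<bullet> b))))"
    by (simp only: prod_ennreal[OF gauss_nonneg] gauss_eq_prod[where 'a='a])
  also have "\<dots> = (\<Prod>b\<in>(Basis::'a set). (LBINT\<^sup>+x. ennreal (gauss a (x::real))))"
    by (subst nn_integral_lborel_prod) auto
  also have "\<dots> < \<infinity>"
    using gauss_integrable_real[OF assms]
    by (simp add: integrable_iff_bounded power_less_top_ennreal)
  finally show ?thesis by (simp add: integrable_iff_bounded)
qed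

lemma complex_gauss_integrable:
  "0 < a \<Longrightarrow> integrable lborel (\<lambda>t. complex_of_real (gauss a t))"
  by (simp only: integrable_of_real gauss_integrable)

lemma fourier_gauss_real:
  fixes \<xi> :: real
  assumes a: "0 < a"
  shows "fourier (\<lambda>x. complex_of_real (gauss a x)) \<xi> = complex_of_real (gauss (1 / a) \<xi> / sqrt a)"
proof -
  define c where "c = sqrt (2 * pi * a)"
  define s where "s = - 2 * pi * \<xi> / c"
  have c: "c > 0" using a by (simp add: c_def)
  have "s\<^sup>2 / 2 = pi * (1 / a) * \<xi>\<^sup>2"
    using a by (simp add: s_def c_def power_divide power_mult_distrib field_simps power2_eq_square)
  then have "complex_of_real (gauss (1 / a) \<xi>) = char std_normal_distribution s"
    by (simp add: gauss_def char_std_normal_distribution)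
  also have "\<dots> = (LBINT x. std_normal_density x *\<^sub>R iexp (s * x))"
    unfolding char_def by (subst integral_density) auto
  also have "\<dots> = c *\<^sub>R (LBINT x. std_normal_density (c * x) *\<^sub>R iexp (s * (c * x)))"
    using c lborel_integral_real_affine[of c "\<lambda>x. std_normal_density x *\<^sub>R iexp (s * x)" 0] by simp
  also have "(\<lambda>x. std_normal_density (c * x) *\<^sub>R iexp (s * (c * x)))
      = (\<lambda>x. complex_of_real (1 / sqrt (2 * pi))
          * (complex_of_real (gauss a x) * cis (- 2 * pi * (\<xi> \<bullet> x))))"
  proof (rule ext)
    fix x :: real
    have "s * (c * x) = - 2 * pi * (\<xi> \<bullet> x)" using c by (simp add: s_def)
    then have "iexp (s * (c * x)) = cis (- 2 * pi * (\<xi> \<bullet> x))"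
      by (simp only: cis_conv_exp)
    then show "std_normal_density (c * x) *\<^sub>R iexp (s * (c * x))
        = complex_of_real (1 / sqrt (2 * pi))
            * (complex_of_real (gauss a x) * cis (- 2 * pi * (\<xi> \<bullet> x)))"
      by (simp add: gauss_eq_std_normal_density[OF a] c_def scaleR_conv_of_real)
  qed
  also have "c *\<^sub>R (LBINT x. complex_of_real (1 / sqrt (2 * pi))
      * (complex_of_real (gauss a x) * cis (- 2 * pi * (\<xi> \<bullet> x))))
      = complex_of_real (sqrt a) * fourier (\<lambda>x. complex_of_real (gauss a x)) \<xi>"
    by (simp add: fourier_def c_def real_sqrt_mult scaleR_conv_of_real)
  finally show ?thesis using a by (simp add: field_simps)
qed

lemma fourier_gauss:
  fixes \<xi> :: "'a::euclidean_space"
  assumes a: "0 < a"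
  shows "fourier (\<lambda>t. complex_of_real (gauss a t)) \<xi>
      = complex_of_real ((1 / sqrt a) ^ DIM('a) * gauss (1 / a) \<xi>)"
proof -
  interpret product_sigma_finite "\<lambda>_::'a. lborel :: real measure" ..
  let ?f = "\<lambda>b x. complex_of_real (gauss a x) * cis (- 2 * pi * ((\<xi> \<bullet> b) \<bullet> x))"
  have "complex_of_real (gauss a t) * cis (- 2 * pi * (\<xi> \<bullet> t))
      = (\<Prod>b\<in>Basis. ?f b (t \<bullet> b))" for t :: 'a
  proof -
    have "cis (- 2 * pi * (\<xi> \<bullet> t)) = (\<Prod>b\<in>Basis. cis (- 2 * pi * ((\<xi> \<bullet> b) \<bullet> (t \<bullet> b))))"
      unfolding cis_conv_exp by (subst euclidean_inner)
        (simp add: exp_sum[symmetric] sum_distrib_left mult_ac)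
    then show ?thesis by (simp add: gauss_eq_prod[of a t] prod.distrib)
  qed
  then have "fourier (\<lambda>t. complex_of_real (gauss a t)) \<xi> = (LBINT t. (\<Prod>b\<in>Basis. ?f b (t \<bullet> b)))"
    unfolding fourier_def by (simp only:)
  also have "\<dots> = (\<integral>f. (\<Prod>b\<in>Basis. ?f b (f b)) \<partial>Pi\<^sub>M Basis (\<lambda>_. lborel))"
    by (subst lborel_eq, subst integral_distr)
      (auto intro!: Bochner_Integration.integral_cong prod.cong)
  also have "\<dots> = (\<Prod>b\<in>Basis. fourier (\<lambda>x. complex_of_real (gauss a x)) (\<xi> \<bullet> b))"
    unfolding fourier_def
  proof (rule product_integral_prod)
    show "integrable lborel (?f b)" for b
      by (rule Bochner_Integration.integrable_bound[OF gauss_integrable_real[OF a]])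
        (auto simp: norm_mult)
  qed simp
  also have "\<dots> = complex_of_real ((1 / sqrt a) ^ DIM('a) * gauss (1 / a) \<xi>)"
    by (simp add: fourier_gauss_real[OF a] gauss_eq_prod[of "1/a" \<xi>]
      prod_dividef power_one_over field_simps)
  finally show ?thesis .
qed

lemma gauss_integral:
  assumes a: "0 < a"
  shows "(LBINT t. gauss a (t::'a::euclidean_space)) = (1 / sqrt a) ^ DIM('a)"
proof -
  have "complex_of_real (LBINT t. gauss a (t::'a)) = complex_of_real ((1 / sqrt a) ^ DIM('a))"
    using fourier_gauss[OF a, of "0::'a"] by (simp add: fourier_def gauss_def)
  then show ?thesis by (simp only: of_real_eq_iff)
qed

lemma gauss_nn_integral:
  assumes "0 < a"
  shows "(LBINT\<^sup>+t. ennreal (gauss a (t::'a::euclidean_space))) = ennreal ((1 / sqrt a) ^ DIM('a))"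
  using nn_integral_eq_integral[OF gauss_integrable[OF assms, where 'a='a]]
  by (simp add: gauss_integral[OF assms])

lemma gauss_normalized_nn_integral:
  assumes "0 < a"
  shows "(LBINT\<^sup>+t. ennreal ((1 / sqrt a) ^ DIM('a) * gauss (1 / a) (t::'a::euclidean_space))) = 1"
proof -
  have "(LBINT\<^sup>+t. ennreal ((1 / sqrt a) ^ DIM('a) * gauss (1 / a) (t::'a)))
      = ennreal ((1 / sqrt a) ^ DIM('a) * (1 / sqrt (1 / a)) ^ DIM('a))"
    using assms by (simp add: ennreal_mult nn_integral_cmult gauss_nn_integral)
  also have "(1 / sqrt a) ^ DIM('a) * (1 / sqrt (1 / a)) ^ DIM('a) = 1"
    using assms by (simp add: real_sqrt_divide flip: power_mult_distrib)
  finally show ?thesis by simp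
qed

lemma gaussian_L2: "gaussian \<in> L2"
  using gauss_integrable[of 2]
  by (simp add: L2_def gaussian_eq_gauss[abs_def] gauss_power2)

lemma gaussian_measurable [measurable]: "gaussian \<in> borel_measurable borel"
  by (rule L2_measurable[OF gaussian_L2])

lemma gaussian_normsq_pos: "0 < l2_normsq gaussian"
  using gauss_integral[of 2, where 'a='a]
  by (simp add: l2_normsq_def gaussian_eq_gauss gauss_power2)

subsection \<open>The Plancherel inequality\<close>

text \<open>Schur's test for an even convolution kernel of mass one, by the inequality of arithmetic and
  geometric means.\<close>
lemma nn_integral_convolution_form_le:
  fixes u :: "'a::euclidean_space \<Rightarrow> complex" and k :: "'a \<Rightarrow> real"
  assumes [measurable]: "u \<in> borel_measurable borel" "k \<in> borel_measurable borel"
    and k: "\<And>x. 0 \<le> k x" "\<And>x. k (- x) = k x" "(LBINT\<^sup>+x. ennreal (k x)) = 1"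
  shows "(LBINT\<^sup>+t. LBINT\<^sup>+s. ennreal (cmod (u t * u s) * k (s - t)))
      \<le> (LBINT\<^sup>+t. ennreal ((cmod (u t))\<^sup>2))"
proof -
  let ?N = "\<lambda>t. ennreal ((cmod (u t))\<^sup>2 / 2)" and ?k = "\<lambda>s t. ennreal (k (s - t))"
  have mass: "(LBINT\<^sup>+s. ?k s t) = 1" for t
    using nn_integral_lborel_shift[of "\<lambda>s. ennreal (k s)" t] k(3) by simp
  have "?k s t = ?k t s" for s t
    using k(2)[of "t - s"] by simp
  then have mass': "(LBINT\<^sup>+t. ?k s t) = 1" for s
    using mass[of s] by simp
  have [measurable]: "(\<lambda>t. LBINT\<^sup>+s. ?N s * ?k s t) \<in> borel_measurable borel"
    using measurable_lborel_nn_integral[of "\<lambda>p. ?N (snd p) * ?k (snd p) (fst p)"] by simp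
  have "ennreal (cmod (u t * u s) * k (s - t)) \<le> ?N t * ?k s t + ?N s * ?k s t" for s t
  proof -
    have "cmod (u t * u s) * k (s - t) \<le> ((cmod (u t))\<^sup>2 / 2 + (cmod (u s))\<^sup>2 / 2) * k (s - t)"
      using norm_mult_le_squares[of "u t" "u s"] by (intro mult_right_mono k(1)) simp
    then show ?thesis
      using k(1) by (simp add: distrib_right flip: ennreal_mult ennreal_plus)
  qed
  then have "(LBINT\<^sup>+t. LBINT\<^sup>+s. ennreal (cmod (u t * u s) * k (s - t)))
      \<le> (LBINT\<^sup>+t. LBINT\<^sup>+s. ?N t * ?k s t + ?N s * ?k s t)"
    by (intro nn_integral_mono)
  also have "\<dots> = (LBINT\<^sup>+t. ?N t) + (LBINT\<^sup>+t. LBINT\<^sup>+s. ?N s * ?k s t)"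
    by (simp add: nn_integral_add nn_integral_cmult mass)
  also have "(LBINT\<^sup>+t. LBINT\<^sup>+s. ?N s * ?k s t) = (LBINT\<^sup>+s. LBINT\<^sup>+t. ?N s * ?k s t)"
    using nn_integral_lborel_swap[of "\<lambda>p. ?N (snd p) * ?k (snd p) (fst p)"] by simp
  also have "\<dots> = (LBINT\<^sup>+s. ?N s)"
    by (simp add: nn_integral_cmult mass')
  also have "(LBINT\<^sup>+t. ?N t) + (LBINT\<^sup>+t. ?N t) = (LBINT\<^sup>+t. ennreal ((cmod (u t))\<^sup>2))"
    by (simp flip: nn_integral_add ennreal_plus)
  finally show ?thesis .
qed

lemma integral_fourier_squared_gauss:
  fixes u :: "'a::euclidean_space \<Rightarrow> complex"
  assumes u: "integrable lborel u" and a: "0 < a"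
  shows "complex_of_real (LBINT \<xi>. (cmod (fourier u \<xi>))\<^sup>2 * gauss a \<xi>)
    = (LBINT t. u t * cnj (LBINT s. u s
        * complex_of_real ((1 / sqrt a) ^ DIM('a) * gauss (1 / a) (s - t))))"
proof -
  have [measurable]: "u \<in> borel_measurable borel" using u by auto
  let ?g = "\<lambda>\<xi>::'a. complex_of_real (gauss a \<xi>)"
  have g: "integrable lborel ?g" by (rule complex_gauss_integrable[OF a])
  let ?v = "\<lambda>\<xi>. cnj (fourier u \<xi>) * ?g \<xi>"
  have v: "integrable lborel ?v"
  proof (rule integrable_dominated)
    show "integrable lborel (\<lambda>\<xi>::'a. (LBINT t. cmod (u t)) * gauss a \<xi>)"
      by (simp add: gauss_integrable[OF a])
  qed (auto simp: norm_mult intro!: mult_right_mono cmod_fourier_le)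
  have "fourier ?v t = cnj (LBINT s. u s
      * complex_of_real ((1 / sqrt a) ^ DIM('a) * gauss (1 / a) (s - t)))" for t
  proof -
    have "fourier ?v t = cnj (LBINT \<xi>. fourier u \<xi> * tfs (0, t) ?g \<xi>)"
      unfolding fourier_def[of ?v]
      by (simp add: tfs_def cis_cnj mult_ac flip: Bochner_Integration.integral_cnj)
    also have "(LBINT \<xi>. fourier u \<xi> * tfs (0, t) ?g \<xi>)
        = (LBINT s. u s * fourier (tfs (0, t) ?g) s)"
    proof (rule fourier_multiplication[OF u])
      show "integrable lborel (tfs (0, t) ?g)"
        by (rule integrable_dominated[OF gauss_integrable[OF a]]) (simp_all add: cmod_tfs)
    qed
    finally show ?thesis by (simp add: fourier_tfs fourier_gauss[OF a])
  qed
  moreover have "complex_of_real (LBINT \<xi>. (cmod (fourier u \<xi>))\<^sup>2 * gauss a \<xi>)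
      = (LBINT \<xi>. fourier u \<xi> * ?v \<xi>)"
    by (simp add: complex_norm_square mult.assoc flip: integral_complex_of_real del: of_real_power)
  ultimately show ?thesis
    using fourier_multiplication[OF u v] by simp
qed

lemma nn_integral_fourier_squared_gauss_le:
  fixes u :: "'a::euclidean_space \<Rightarrow> complex"
  assumes u: "integrable lborel u" and a: "0 < a"
  shows "(LBINT\<^sup>+\<xi>. ennreal ((cmod (fourier u \<xi>))\<^sup>2 * gauss a \<xi>))
      \<le> (LBINT\<^sup>+t. ennreal ((cmod (u t))\<^sup>2))"
proof -
  have [measurable]: "u \<in> borel_measurable borel" using u by auto
  define k where "k s = (1 / sqrt a) ^ DIM('a) * gauss (1 / a) s" for s :: 'a
  have k_nonneg: "0 \<le> k s" for s using a by (simp add: k_def)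
  have [measurable]: "k \<in> borel_measurable borel" unfolding k_def by measurable
  have "integrable lborel (\<lambda>\<xi>. (cmod (fourier u \<xi>))\<^sup>2 * gauss a \<xi>)"
  proof (rule integrable_dominated)
    show "integrable lborel (\<lambda>\<xi>::'a. (LBINT t. cmod (u t))\<^sup>2 * gauss a \<xi>)"
      by (simp add: gauss_integrable[OF a])
  qed (auto intro!: mult_right_mono power_mono cmod_fourier_le)
  then have "(LBINT\<^sup>+\<xi>. ennreal ((cmod (fourier u \<xi>))\<^sup>2 * gauss a \<xi>))
      = ennreal (cmod (complex_of_real (LBINT \<xi>. (cmod (fourier u \<xi>))\<^sup>2 * gauss a \<xi>)))"
    by (simp add: nn_integral_eq_integral)
  also have "\<dots> \<le> (LBINT\<^sup>+t. ennreal (cmod (u t * cnj (LBINT s. u s * complex_of_real (k (s - t))))))"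
    unfolding integral_fourier_squared_gauss[OF u a] k_def by (rule ennreal_norm_integral_le)
  also have "\<dots> \<le> (LBINT\<^sup>+t. LBINT\<^sup>+s. ennreal (cmod (u t * u s) * k (s - t)))"
  proof (rule nn_integral_mono)
    fix t
    have "ennreal (cmod (u t * cnj (LBINT s. u s * complex_of_real (k (s - t)))))
        = ennreal (cmod (LBINT s. u t * (u s * complex_of_real (k (s - t)))))"
      by (simp add: norm_mult)
    also have "\<dots> \<le> (LBINT\<^sup>+s. ennreal (cmod (u t * (u s * complex_of_real (k (s - t))))))"
      by (rule ennreal_norm_integral_le)
    finally show "ennreal (cmod (u t * cnj (LBINT s. u s * complex_of_real (k (s - t)))))
        \<le> (LBINT\<^sup>+s. ennreal (cmod (u t * u s) * k (s - t)))"
      using k_nonneg by (simp add: norm_mult mult_ac)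
  qed
  also have "\<dots> \<le> (LBINT\<^sup>+t. ennreal ((cmod (u t))\<^sup>2))"
    using k_nonneg gauss_normalized_nn_integral[OF a, where 'a='a]
    by (intro nn_integral_convolution_form_le) (simp_all add: k_def)
  finally show ?thesis .
qed

text \<open>Fatou's lemma removes the Gaussian damping.\<close>
lemma nn_integral_fourier_squared_le:
  fixes u :: "'a::euclidean_space \<Rightarrow> complex"
  assumes u: "integrable lborel u"
  shows "(LBINT\<^sup>+\<xi>. ennreal ((cmod (fourier u \<xi>))\<^sup>2)) \<le> (LBINT\<^sup>+t. ennreal ((cmod (u t))\<^sup>2))"
proof -
  have [measurable]: "u \<in> borel_measurable borel" using u by auto
  define D where "D n \<xi> = ennreal ((cmod (fourier u \<xi>))\<^sup>2 * gauss (1 / real (Suc n)) \<xi>)" for n \<xi>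
  have "ennreal ((cmod (fourier u \<xi>))\<^sup>2) = liminf (\<lambda>n. D n \<xi>)" for \<xi>
  proof -
    have "(\<lambda>n. (1::real) / real (Suc n)) \<longlonglongrightarrow> 0" by (rule LIMSEQ_Suc) (rule lim_1_over_n)
    then have "(\<lambda>n. D n \<xi>) \<longlonglongrightarrow> ennreal ((cmod (fourier u \<xi>))\<^sup>2 * exp (- pi * 0 * (norm \<xi>)\<^sup>2))"
      unfolding D_def gauss_def by (intro tendsto_intros)
    from lim_imp_Liminf[OF _ this] show ?thesis by simp
  qed
  then have "(LBINT\<^sup>+\<xi>. ennreal ((cmod (fourier u \<xi>))\<^sup>2)) = (LBINT\<^sup>+\<xi>. liminf (\<lambda>n. D n \<xi>))"
    by simp
  also have "\<dots> \<le> liminf (\<lambda>n. LBINT\<^sup>+\<xi>. D n \<xi>)"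
    by (rule nn_integral_liminf) (simp add: D_def)
  also have "\<dots> \<le> (LBINT\<^sup>+t. ennreal ((cmod (u t))\<^sup>2))"
    unfolding D_def
    by (rule Liminf_le)
      (auto intro!: always_eventually nn_integral_fourier_squared_gauss_le[OF u]
        simp del: of_nat_Suc)
  finally show ?thesis .
qed

section \<open>Continuity of translations\<close>

lemma integral_translation_diff_le:
  fixes f u :: "'a::euclidean_space \<Rightarrow> 'b::{banach, second_countable_topology}"
  assumes f: "integrable lborel f" and u: "integrable lborel u"
  shows "(LBINT x. norm (f (x - w) - f x))
      \<le> (LBINT x. norm (u (x - w) - u x)) + 2 * (LBINT x. norm (f x - u x))"
proof -
  have d: "integrable lborel (\<lambda>x. norm (f x - u x))" using f u by simp
  note shift = lborel_integrable_shift[OF f, of w]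
    lborel_integrable_shift[OF u, of w] lborel_integrable_shift[OF d, of w]
  have "(LBINT x. norm (f (x - w) - f x))
      \<le> (LBINT x. norm (u (x - w) - u x) + norm (f x - u x) + norm (f (x - w) - u (x - w)))"
  proof (rule integral_mono)
    fix x
    show "norm (f (x - w) - f x)
        \<le> norm (u (x - w) - u x) + norm (f x - u x) + norm (f (x - w) - u (x - w))"
      using norm_triangle_ineq4[of "(u (x - w) - u x) + (f (x - w) - u (x - w))" "f x - u x"]
        norm_triangle_ineq[of "u (x - w) - u x" "f (x - w) - u (x - w)"]
      by simp
  qed (use f u shift in simp_all)
  also have "\<dots> = (LBINT x. norm (u (x - w) - u x))
      + (LBINT x. norm (f x - u x)) + (LBINT x. norm (f (x - w) - u (x - w)))"
    using f u shift d by simp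
  also have "(LBINT x. norm (f (x - w) - u (x - w))) = (LBINT x. norm (f x - u x))"
    using lborel_integral_shift[of "\<lambda>x. norm (f x - u x)" w] d by simp
  finally show ?thesis by simp
qed

lemma L1_translation_tendsto_closure:
  fixes f :: "'a::euclidean_space \<Rightarrow> 'b::{banach, second_countable_topology}"
  assumes f: "integrable lborel f"
    and approx: "\<And>e. e > 0 \<Longrightarrow> \<exists>u. integrable lborel u \<and> (LBINT x. norm (f x - u x)) < e
      \<and> (\<lambda>n. LBINT x. norm (u (x - w n) - u x)) \<longlonglongrightarrow> 0"
  shows "(\<lambda>n. LBINT x. norm (f (x - w n) - f x)) \<longlonglongrightarrow> 0"
proof (rule LIMSEQ_I)
  fix e :: real assume e: "e > 0"
  obtain u where u: "integrable lborel u" "(LBINT x. norm (f x - u x)) < e / 3"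
    and lim: "(\<lambda>n. LBINT x. norm (u (x - w n) - u x)) \<longlonglongrightarrow> 0"
    using approx[of "e / 3"] e by auto
  have "\<forall>\<^sub>F n in sequentially. (LBINT x. norm (u (x - w n) - u x)) < e / 3"
    using order_tendstoD(2)[OF lim, of "e / 3"] e by simp
  then have "\<forall>\<^sub>F n in sequentially. norm ((LBINT x. norm (f (x - w n) - f x)) - 0) < e"
  proof eventually_elim
    case (elim n)
    then show ?case using integral_translation_diff_le[OF f u(1), of "w n"] u(2) by simp
  qed
  then show "\<exists>N. \<forall>n\<ge>N. norm ((LBINT x. norm (f (x - w n) - f x)) - 0) < e"
    by (simp add: eventually_sequentially)
qed

text \<open>The defect of an open set is twice the part that leaves the set, since translation preserves
  measure, and that part tends to zero pointwise.\<close>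
lemma L1_translation_tendsto_open_indicator:
  fixes U :: "'a::euclidean_space set"
  assumes U: "open U" "emeasure lborel U < \<infinity>" and w: "w \<longlonglongrightarrow> 0"
  shows "(\<lambda>n. LBINT x. \<bar>indicator U (x - w n) - indicator U x :: real\<bar>) \<longlonglongrightarrow> 0"
proof -
  let ?i = "indicator U :: 'a \<Rightarrow> real"
  let ?loss = "\<lambda>n x. max 0 (?i x - ?i (x - w n))"
  have [measurable]: "U \<in> sets borel" using U(1) by simp
  have integrable: "integrable lborel ?i" using U by (intro integrable_real_indicator) auto
  note int_shift = lborel_integrable_shift[OF integrable]
  have "(\<lambda>n. LBINT x. ?loss n x) \<longlonglongrightarrow> (\<integral>x. 0 \<partial>(lborel :: 'a measure))"
  proof (rule integral_dominated_convergence[OF _ _ integrable])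
    show "AE x in lborel. (\<lambda>n. ?loss n x) \<longlonglongrightarrow> 0"
    proof (rule AE_I2)
      fix x
      have "\<forall>\<^sub>F n in sequentially. ?loss n x = 0"
      proof (cases "x \<in> U")
        case True
        have "(\<lambda>n. x - w n) \<longlonglongrightarrow> x" using tendsto_diff[OF tendsto_const w, of x] by simp
        from topological_tendstoD[OF this U(1) True] show ?thesis
          by eventually_elim simp
      qed simp
      then show "(\<lambda>n. ?loss n x) \<longlonglongrightarrow> 0" by (rule tendsto_eventually)
    qed
  qed (auto simp: indicator_def)
  then have lim: "(\<lambda>n. 2 * (LBINT x. ?loss n x)) \<longlonglongrightarrow> 0" using tendsto_mult_left by fastforce
  have "(LBINT x. \<bar>?i (x - w n) - ?i x\<bar>) = 2 * (LBINT x. ?loss n x)" for n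
  proof -
    have "integrable lborel (?loss n)"
      by (rule integrable_dominated[OF integrable]) (auto simp: indicator_def)
    moreover have "\<bar>?i (x - w n) - ?i x\<bar> = 2 * ?loss n x + (?i (x - w n) - ?i x)" for x
      by (auto simp: indicator_def)
    ultimately show ?thesis
      using integrable int_shift[of "w n"] lborel_integral_shift[of ?i "w n"] by simp
  qed
  then show ?thesis using lim by simp
qed

lemma L1_translation_tendsto_indicator:
  fixes A :: "'a::euclidean_space set"
  assumes A: "A \<in> sets borel" "emeasure lborel A < \<infinity>" and w: "w \<longlonglongrightarrow> 0"
  shows "(\<lambda>n. LBINT x. \<bar>indicator A (x - w n) - indicator A x :: real\<bar>) \<longlonglongrightarrow> 0"
proof -
  have "\<exists>u :: 'a \<Rightarrow> real. integrable lborel u \<and> (LBINT x. norm (indicator A x - u x)) < e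
      \<and> (\<lambda>n. LBINT x. norm (u (x - w n) - u x)) \<longlonglongrightarrow> 0" if e: "e > 0" for e
  proof -
    obtain U where U: "open U" "A \<subseteq> U" "emeasure lborel (U - A) < ennreal e"
      using outer_regular_lborel[OF A(1) e] by blast
    have [measurable]: "U \<in> sets borel" using U(1) by simp
    have "emeasure lborel U \<le> emeasure lborel A + emeasure lborel (U - A)"
      using emeasure_subadditive[of A lborel "U - A"] A U by (simp add: Un_absorb1)
    also have "\<dots> < \<infinity>" using A(2) U(3) by (auto intro: order.strict_trans)
    finally have fin: "emeasure lborel U < \<infinity>" .
    have "(LBINT x. norm (indicator A x - indicator U x :: real)) = (LBINT x. indicator (U - A) x)"
      using U(2) by (intro Bochner_Integration.integral_cong) (auto simp: indicator_def)
    also have "\<dots> < e"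
      using U(3) e A(1) by (simp add: measure_def enn2real_less_iff order.strict_trans[OF U(3)])
    finally have "(LBINT x. norm (indicator A x - indicator U x :: real)) < e" .
    then show ?thesis
      using fin U(1) L1_translation_tendsto_open_indicator[OF U(1) fin w]
      by (intro exI[of _ "indicator U"]) (auto intro: integrable_real_indicator)
  qed
  from L1_translation_tendsto_closure[OF _ this] show ?thesis
    using A by (auto intro: integrable_real_indicator)
qed

lemma L1_translation_tendsto_add:
  fixes f h :: "'a::euclidean_space \<Rightarrow> 'b::{banach, second_countable_topology}"
  assumes f: "integrable lborel f" and h: "integrable lborel h"
    and lim: "(\<lambda>n. LBINT x. norm (f (x - w n) - f x)) \<longlonglongrightarrow> 0"
      "(\<lambda>n. LBINT x. norm (h (x - w n) - h x)) \<longlonglongrightarrow> 0"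
  shows "(\<lambda>n. LBINT x. norm ((f (x - w n) + h (x - w n)) - (f x + h x))) \<longlonglongrightarrow> 0"
proof (rule Lim_null_comparison[OF always_eventually tendsto_add_zero[OF lim]], rule allI)
  fix n
  note int = f h lborel_integrable_shift[OF f] lborel_integrable_shift[OF h]
  have "(LBINT x. norm ((f (x - w n) + h (x - w n)) - (f x + h x)))
      \<le> (LBINT x. norm (f (x - w n) - f x) + norm (h (x - w n) - h x))"
  proof (rule integral_mono)
    show "norm ((f (x - w n) + h (x - w n)) - (f x + h x))
        \<le> norm (f (x - w n) - f x) + norm (h (x - w n) - h x)" for x
      using norm_triangle_ineq[of "f (x - w n) - f x" "h (x - w n) - h x"]
      by (simp add: algebra_simps)
  qed (use int in auto)
  then show "norm (LBINT x. norm ((f (x - w n) + h (x - w n)) - (f x + h x)))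
      \<le> (LBINT x. norm (f (x - w n) - f x)) + (LBINT x. norm (h (x - w n) - h x))"
    using int by simp
qed

lemma L1_translation_tendsto:
  fixes f :: "'a::euclidean_space \<Rightarrow> 'b::{banach, second_countable_topology}"
  assumes "integrable lborel f" and w: "w \<longlonglongrightarrow> 0"
  shows "(\<lambda>n. LBINT x. norm (f (x - w n) - f x)) \<longlonglongrightarrow> 0"
  using assms(1)
proof (induction f rule: integrable_induct)
  case (base A c)
  have "norm (indicator A (x - w n) *\<^sub>R c - indicator A x *\<^sub>R c)
      = \<bar>indicator A (x - w n) - indicator A x :: real\<bar> * norm c" for n x
    by (simp flip: scaleR_diff_left)
  then show ?case
    using tendsto_mult_left_zero[OF L1_translation_tendsto_indicator[OF _ _ w]] base by simp
next
  case (add f h)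
  then show ?case by (intro L1_translation_tendsto_add)
next
  case (lim f s)
  have "(\<lambda>i. LBINT x. norm (f x - s i x)) \<longlonglongrightarrow> (\<integral>x. 0 \<partial>(lborel :: 'a measure))"
  proof (rule integral_dominated_convergence)
    show "integrable lborel (\<lambda>x. 3 * norm (f x))" using lim by simp
    have "(\<lambda>i. f x - s i x) \<longlonglongrightarrow> f x - f x" for x
      using lim(2) by (intro tendsto_intros) simp
    then show "AE x in lborel. (\<lambda>i. norm (f x - s i x)) \<longlonglongrightarrow> 0"
      by (auto intro!: AE_I2 tendsto_norm_zero)
    show "AE x in lborel. norm (norm (f x - s i x)) \<le> 3 * norm (f x)" for i
    proof (rule AE_I2)
      fix x :: 'a assume "x \<in> space lborel"
      then show "norm (norm (f x - s i x)) \<le> 3 * norm (f x)"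
        using lim(3)[of x i] norm_triangle_ineq4[of "f x" "s i x"] by simp
    qed
  qed (use lim in auto)
  then have "(\<lambda>i. LBINT x. norm (f x - s i x)) \<longlonglongrightarrow> 0" by simp
  from order_tendstoD(2)[OF this]
  have "\<exists>i. (LBINT x. norm (f x - s i x)) < e" if "e > 0" for e
    using that by (auto simp: eventually_sequentially)
  then show ?case
    using lim by (intro L1_translation_tendsto_closure) blast+
qed

text \<open>Continuity of the inverse of the Mazur map \<open>a \<mapsto> |a| a\<close>, which carries \<open>L\<^sup>2\<close> to \<open>L\<^sup>1\<close>.\<close>
lemma norm_diff_squared_le_norm_scaleR_diff:
  fixes a b :: "'a::real_inner"
  shows "(norm (a - b))\<^sup>2 \<le> 2 * norm (norm a *\<^sub>R a - norm b *\<^sub>R b)"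
proof (cases "a = b")
  case False
  define m where "m = norm a *\<^sub>R a - norm b *\<^sub>R b"
  have norm_diff_squared: "(norm (a - b))\<^sup>2 = (norm a)\<^sup>2 + (norm b)\<^sup>2 - 2 * (a \<bullet> b)"
    by (simp add: power2_norm_eq_inner inner_diff_left inner_diff_right inner_commute)
  have inner_eq: "(a - b) \<bullet> m
      = (norm a + norm b) * ((norm a)\<^sup>2 - norm a * norm b + (norm b)\<^sup>2 - a \<bullet> b)"
    by (simp add: m_def inner_diff_left inner_diff_right
      power2_norm_eq_inner[symmetric] inner_commute
      algebra_simps power2_eq_square)
  have "(norm (a - b))\<^sup>2 \<le> 2 * ((norm a)\<^sup>2 - norm a * norm b + (norm b)\<^sup>2 - a \<bullet> b)"
    using zero_le_power2[of "norm a - norm b"] unfolding norm_diff_squared power2_diff by simp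
  from mult_left_mono[OF this add_nonneg_nonneg[OF norm_ge_zero[of a] norm_ge_zero[of b]]]
  have "(norm a + norm b) * (norm (a - b))\<^sup>2 \<le> 2 * ((a - b) \<bullet> m)"
    unfolding inner_eq by (simp only: mult.left_commute)
  then have "norm (a - b) * (norm (a - b))\<^sup>2 \<le> 2 * ((a - b) \<bullet> m)"
    using mult_right_mono[OF norm_triangle_ineq4[of a b], of "(norm (a - b))\<^sup>2"] by simp
  also have "\<dots> \<le> norm (a - b) * (2 * norm m)"
    using norm_cauchy_schwarz[of "a - b" m] by simp
  finally show ?thesis using False by (simp add: m_def)
qed simp

lemma L2_translation_tendsto:
  fixes f :: "'a::euclidean_space \<Rightarrow> complex"
  assumes f: "f \<in> L2" and w: "w \<longlonglongrightarrow> w0"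
  shows "(\<lambda>n. l2_normsq (\<lambda>x. f (x - w n) - f (x - w0))) \<longlonglongrightarrow> 0"
proof -
  have [measurable]: "f \<in> borel_measurable borel" by (rule L2_measurable[OF f])
  define h where "h x = cmod (f x) *\<^sub>R f x" for x
  have [measurable]: "h \<in> borel_measurable borel" unfolding h_def by measurable
  have h: "integrable lborel h"
    by (rule integrable_dominated[OF L2_integrable[OF f]]) (simp_all add: h_def power2_eq_square)
  have "(\<lambda>n. w n - w0) \<longlonglongrightarrow> 0" using w by (simp add: LIM_zero)
  from L1_translation_tendsto[OF h this]
  have lim: "(\<lambda>n. 2 * (LBINT x. norm (h (x - (w n - w0)) - h x))) \<longlonglongrightarrow> 0"
    using tendsto_mult_left by fastforce
  have "l2_normsq (\<lambda>x. f (x - w n) - f (x - w0))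
      \<le> 2 * (LBINT x. norm (h (x - (w n - w0)) - h x))" for n
  proof -
    have "l2_normsq (\<lambda>x. f (x - w n) - f (x - w0)) = (LBINT x. (cmod (f (x - (w n - w0)) - f x))\<^sup>2)"
      unfolding l2_normsq_def
      using lborel_integral_shift[of "\<lambda>x. (cmod (f (x - (w n - w0)) - f x))\<^sup>2" w0]
      by (simp add: algebra_simps)
    also have "\<dots> \<le> (LBINT x. 2 * norm (h (x - (w n - w0)) - h x))"
    proof (rule integral_mono')
      show "integrable lborel (\<lambda>x. 2 * norm (h (x - (w n - w0)) - h x))"
        using h lborel_integrable_shift[OF h] by simp
    qed (simp_all add: h_def norm_diff_squared_le_norm_scaleR_diff)
    finally show ?thesis by simp
  qed
  then show ?thesis
    by (intro Lim_null_comparison[OF always_eventually lim]) (simp add: l2_normsq_nonneg)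
qed

lemma stft_continuous:
  fixes f h :: "'a::euclidean_space \<Rightarrow> complex"
  assumes f: "f \<in> L2" and h: "h \<in> L2"
  shows "continuous_on UNIV (stft h f)"
proof (rule continuous_at_imp_continuous_on, rule ballI, rule continuous_at_sequentiallyI)
  fix z :: "'a \<times> 'a" and s assume s: "s \<longlonglongrightarrow> z"
  have [measurable]: "f \<in> borel_measurable borel" "h \<in> borel_measurable borel"
    using f h by (auto intro: L2_measurable)
  define b where "b n = tfs (fst z, snd (s n)) h" for n
  define d where "d n t = tfs (s n) h t - b n t" for n t
  have b: "b n \<in> L2" and d: "d n \<in> L2" for n
    unfolding b_def d_def by (intro L2_diff L2_tfs h)+
  have "cmod (d n t) = cmod (h (t - fst (s n)) - h (t - fst z))" for n t
    by (simp add: d_def b_def tfs_def norm_mult flip: right_diff_distrib)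
  then have "(\<lambda>n. l2_normsq (d n)) \<longlonglongrightarrow> 0"
    using L2_translation_tendsto[OF h tendsto_fst[OF s]] by (simp add: l2_normsq_def)
  then have "(\<lambda>n. sqrt (l2_normsq f * l2_normsq (d n))) \<longlonglongrightarrow> sqrt (l2_normsq f * 0)"
    by (intro tendsto_intros)
  then have "(\<lambda>n. sqrt (l2_normsq f * l2_normsq (d n))) \<longlonglongrightarrow> 0" by simp
  then have "(\<lambda>n. l2_inner f (d n)) \<longlonglongrightarrow> 0"
    by (rule Lim_null_comparison[OF always_eventually, rotated]) (simp add: cmod_l2_inner_le f d)
  moreover have "(\<lambda>n. l2_inner f (b n)) \<longlonglongrightarrow> l2_inner f (tfs z h)"
    unfolding l2_inner_def
  proof (rule integral_dominated_convergence)
    show "integrable lborel (\<lambda>t. cmod (f t * cnj (tfs z h t)))"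
      using L2_inner_integrable[OF f L2_tfs[OF h]] by (rule integrable_norm)
    show "AE t in lborel. (\<lambda>n. f t * cnj (b n t)) \<longlonglongrightarrow> f t * cnj (tfs z h t)"
      unfolding b_def tfs_def fst_conv snd_conv by (intro AE_I2 tendsto_intros tendsto_snd[OF s])
  qed (simp_all add: b_def norm_mult cmod_tfs)
  moreover have "stft h f (s n) = l2_inner f (d n) + l2_inner f (b n)" for n
    using l2_inner_add_right[OF d b f, of n n] by (simp add: stft_def d_def)
  ultimately show "(\<lambda>n. stft h f (s n)) \<longlonglongrightarrow> stft h f z"
    using tendsto_add[of "\<lambda>n. l2_inner f (d n)" 0] by (fastforce simp: stft_def)
qed

section \<open>Cross-Wigner distributions\<close>

lemma wigner_eq_l2_inner:
  "wigner f h (x, \<xi>) = l2_inner (\<lambda>t. f (x + (1/2) *\<^sub>R t)) (tfs (0, \<xi>) (\<lambda>t. h (x - (1/2) *\<^sub>R t)))"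
  by (simp add: wigner_def l2_inner_def tfs_def cis_cnj mult_ac)

lemma L2_reflect:
  "f \<in> L2 \<Longrightarrow> (\<lambda>t. f (x - (1/2) *\<^sub>R t)) \<in> L2"
  using L2_affine[of f "- (1/2)" x] by simp

lemma wigner_add_left: "f \<in> L2 \<Longrightarrow> f' \<in> L2 \<Longrightarrow> h \<in> L2 \<Longrightarrow>
  wigner (\<lambda>t. f t + f' t) h = (\<lambda>z. wigner f h z + wigner f' h z)"
  by (auto simp: wigner_eq_l2_inner l2_inner_add_left L2_affine L2_reflect L2_tfs)

lemma wigner_add_right:
  assumes "f \<in> L2" "h \<in> L2" "h' \<in> L2"
  shows "wigner f (\<lambda>t. h t + h' t) = (\<lambda>z. wigner f h z + wigner f h' z)"
proof -
  have "tfs w (\<lambda>t. u t + v t) = (\<lambda>t. tfs w u t + tfs w v t)" for w and u v :: "'a \<Rightarrow> complex"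
    by (simp add: tfs_def distrib_left)
  then show ?thesis
    using assms by (auto simp: wigner_eq_l2_inner l2_inner_add_right L2_affine L2_reflect L2_tfs)
qed

lemma wigner_scale_left: "wigner (\<lambda>t. c * f t) h = (\<lambda>z. c * wigner f h z)"
  by (auto simp: wigner_eq_l2_inner l2_inner_scale_left)

lemma wigner_scale_right: "wigner f (\<lambda>t. c * h t) = (\<lambda>z. cnj c * wigner f h z)"
proof -
  have "tfs w (\<lambda>t. c * u t) = (\<lambda>t. c * tfs w u t)" for w and u :: "'a \<Rightarrow> complex"
    by (simp add: tfs_def mult_ac)
  then show ?thesis by (auto simp: wigner_eq_l2_inner l2_inner_scale_right)
qed

lemma cmod_wigner_le:
  fixes f h :: "'a::euclidean_space \<Rightarrow> complex"
  assumes f: "f \<in> L2" and h: "h \<in> L2"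
  shows "cmod (wigner f h z) \<le> 2 ^ DIM('a) * sqrt (l2_normsq f * l2_normsq h)"
proof (cases z)
  case (Pair x \<xi>)
  have f': "l2_normsq (\<lambda>t. f (x + (1/2) *\<^sub>R t)) = 2 ^ DIM('a) * l2_normsq f"
    using l2_normsq_affine[OF f, of "1/2" x] by (simp add: power_divide)
  have h': "l2_normsq (tfs (0, \<xi>) (\<lambda>t. h (x - (1/2) *\<^sub>R t))) = 2 ^ DIM('a) * l2_normsq h"
    using l2_normsq_affine[OF h, of "- (1/2)" x] by (simp add: power_divide l2_normsq_def cmod_tfs)
  have "cmod (wigner f h z) \<le> sqrt ((2 ^ DIM('a) * l2_normsq f) * (2 ^ DIM('a) * l2_normsq h))"
    unfolding Pair wigner_eq_l2_inner f'[symmetric] h'[symmetric]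
    by (intro cmod_l2_inner_le L2_affine L2_tfs L2_reflect f h) simp
  then show ?thesis by (simp add: real_sqrt_mult mult_ac)
qed

definition wig_prod :: "('a::euclidean_space \<Rightarrow> complex) \<Rightarrow> ('a \<Rightarrow> complex) \<Rightarrow> 'a \<Rightarrow> 'a \<Rightarrow> complex" where
  "wig_prod f h x t = f (x + (1/2) *\<^sub>R t) * cnj (h (x - (1/2) *\<^sub>R t))"

lemma wigner_eq_fourier: "wigner f h (x, \<xi>) = fourier (wig_prod f h x) \<xi>"
  by (simp add: wigner_def wig_prod_def fourier_def)

lemma wig_prod_integrable: "f \<in> L2 \<Longrightarrow> h \<in> L2 \<Longrightarrow> integrable lborel (wig_prod f h x)"
  unfolding wig_prod_def by (intro L2_inner_integrable L2_affine L2_reflect) simp_all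

lemma wig_prod_measurable [measurable (raw)]:
  fixes f h :: "'a::euclidean_space \<Rightarrow> complex"
  assumes [measurable]: "f \<in> borel_measurable borel" "h \<in> borel_measurable borel"
    "u \<in> borel_measurable M" "v \<in> borel_measurable M"
  shows "(\<lambda>p. wig_prod f h (u p) (v p)) \<in> borel_measurable M"
  unfolding wig_prod_def by measurable

lemma wigner_measurable [measurable]:
  fixes f h :: "'a::euclidean_space \<Rightarrow> complex"
  assumes [measurable]: "f \<in> borel_measurable borel" "h \<in> borel_measurable borel"
  shows "wigner f h \<in> borel_measurable borel"
proof -
  have "(\<lambda>p::('a \<times> 'a) \<times> 'a. wig_prod f h (fst (fst p)) (snd p)
      * cis (- 2 * pi * (snd (fst p) \<bullet> snd p)))
      \<in> borel_measurable borel"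
    by measurable
  from measurable_lborel_integral[OF this] show ?thesis
    by (rule measurable_cong[THEN iffD1, rotated]) (auto simp: wigner_eq_fourier fourier_def)
qed

lemma L2_wigner:
  fixes f h :: "'a::euclidean_space \<Rightarrow> complex"
  assumes f: "f \<in> L2" and h: "h \<in> L2"
  shows "wigner f h \<in> L2"
proof -
  have [measurable]: "f \<in> borel_measurable borel" "h \<in> borel_measurable borel"
    using f h by (auto intro: L2_measurable)
  have "(LBINT\<^sup>+z. ennreal ((cmod (wigner f h z))\<^sup>2))
      = (LBINT\<^sup>+x. LBINT\<^sup>+\<xi>. ennreal ((cmod (fourier (wig_prod f h x) \<xi>))\<^sup>2))"
    by (simp add: nn_integral_lborel_pair wigner_eq_fourier)
  also have "\<dots> \<le> (LBINT\<^sup>+x. LBINT\<^sup>+t. ennreal ((cmod (wig_prod f h x t))\<^sup>2))"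
    by (intro nn_integral_mono nn_integral_fourier_squared_le wig_prod_integrable f h)
  also have "\<dots> = (LBINT\<^sup>+p. ennreal ((cmod (f (fst p)))\<^sup>2) * ennreal ((cmod (h (snd p)))\<^sup>2))"
    by (subst nn_integral_midpoint_coordinates[symmetric])
       (simp_all add: wig_prod_def norm_mult power_mult_distrib ennreal_mult)
  also have "\<dots> = (LBINT\<^sup>+u. ennreal ((cmod (f u))\<^sup>2)) * (LBINT\<^sup>+v. ennreal ((cmod (h v))\<^sup>2))"
    by (simp add: nn_integral_lborel_pair nn_integral_cmult nn_integral_multc)
  also have "\<dots> < \<infinity>"
    using L2_integrable[OF f] L2_integrable[OF h]
    by (simp add: integrable_iff_bounded ennreal_mult_less_top)
  finally show ?thesis by (simp add: L2_def integrable_iff_bounded)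
qed

subsection \<open>Covariance\<close>

lemma jmap_measurable [measurable]: "jmap \<in> borel_measurable borel"
  unfolding jmap_def by measurable

lemma nn_integral_jmap:
  fixes H :: "'a::euclidean_space \<times> 'a \<Rightarrow> ennreal"
  assumes [measurable]: "H \<in> borel_measurable borel"
  shows "(LBINT\<^sup>+\<zeta>. H (jmap \<zeta>)) = (LBINT\<^sup>+y. H y)"
proof -
  have "(LBINT\<^sup>+\<zeta>. H (jmap \<zeta>)) = (LBINT\<^sup>+x. LBINT\<^sup>+y. H (y, - x))"
    by (subst nn_integral_lborel_pair) (simp_all add: jmap_def)
  also have "\<dots> = (LBINT\<^sup>+y. LBINT\<^sup>+x. H (y, - x))"
    using nn_integral_lborel_swap[of "\<lambda>p. H (snd p, - fst p)"] by simp
  also have "\<dots> = (LBINT\<^sup>+y. LBINT\<^sup>+x. H (y, x))"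
    using nn_integral_lborel_affine[of "\<lambda>x. H (y, x)" "-1" 0 for y] by simp
  finally show ?thesis by (simp add: nn_integral_lborel_pair)
qed

lemma nn_integral_midpoint_jmap:
  fixes F H :: "'a::euclidean_space \<times> 'a \<Rightarrow> ennreal"
  assumes [measurable]: "F \<in> borel_measurable borel" "H \<in> borel_measurable borel"
  shows "(LBINT\<^sup>+r. F (fst r - (1/2) *\<^sub>R jmap (snd r)) * H (fst r + (1/2) *\<^sub>R jmap (snd r)))
    = (LBINT\<^sup>+z. F z) * (LBINT\<^sup>+z. H z)"
proof -
  have "(LBINT\<^sup>+r. F (fst r - (1/2) *\<^sub>R jmap (snd r)) * H (fst r + (1/2) *\<^sub>R jmap (snd r)))
      = (LBINT\<^sup>+z. LBINT\<^sup>+\<zeta>. F (z - (1/2) *\<^sub>R jmap \<zeta>) * H (z + (1/2) *\<^sub>R jmap \<zeta>))"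
    by (subst nn_integral_lborel_pair) simp_all
  also have "\<dots> = (LBINT\<^sup>+z. LBINT\<^sup>+t. F (z - (1/2) *\<^sub>R t) * H (z + (1/2) *\<^sub>R t))"
    by (intro nn_integral_cong nn_integral_jmap[of "\<lambda>t. F (z - (1/2) *\<^sub>R t)
        * H (z + (1/2) *\<^sub>R t)" for z]) measurable
  also have "\<dots> = (LBINT\<^sup>+p. H (fst p) * F (snd p))"
    using nn_integral_midpoint_coordinates[of "\<lambda>p. H (fst p) * F (snd p)"]
    by (simp add: mult.commute)
  also have "\<dots> = (LBINT\<^sup>+z. F z) * (LBINT\<^sup>+z. H z)"
    by (simp add: nn_integral_lborel_pair nn_integral_cmult nn_integral_multc mult.commute)
  finally show ?thesis .
qed

lemma wig_prod_tfs_tfs: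
  "wig_prod (tfs l f) (tfs m h) x = (\<lambda>t. cis (2 * pi * ((snd l - snd m) \<bullet> x)) *
    tfs (fst l - fst m, (1/2) *\<^sub>R (snd l + snd m)) (wig_prod f h (x - (1/2) *\<^sub>R (fst l + fst m))) t)"
proof (rule ext)
  fix t
  define y s where "y = x - (1/2) *\<^sub>R (fst l + fst m)" and "s = t - (fst l - fst m)"
  have halves: "(1/2) *\<^sub>R a + (1/2) *\<^sub>R a = a" for a :: 'a
    by (simp flip: scaleR_add_left)
  have shifted_args: "x + (1/2) *\<^sub>R t - fst l = y + (1/2) *\<^sub>R s"
      "x - (1/2) *\<^sub>R t - fst m = y - (1/2) *\<^sub>R s"
    using halves[of "fst l"] halves[of "fst m"] by (simp_all add: y_def s_def algebra_simps)
  have "cis (2 * pi * (snd l \<bullet> (x + (1/2) *\<^sub>R t))) * cnj (cis (2 * pi * (snd m \<bullet> (x - (1/2) *\<^sub>R t))))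
      = cis (2 * pi * ((snd l - snd m) \<bullet> x)) * cis (2 * pi * ((1/2) *\<^sub>R (snd l + snd m) \<bullet> t))"
    by (simp add: cis_cnj cis_mult inner_diff_left inner_diff_right
      inner_add_left inner_add_right algebra_simps)
  then show "wig_prod (tfs l f) (tfs m h) x t = cis (2 * pi * ((snd l - snd m) \<bullet> x)) *
      tfs (fst l - fst m, (1/2) *\<^sub>R (snd l + snd m)) (wig_prod f h y) t"
    unfolding wig_prod_def tfs_def shifted_args fst_conv snd_conv s_def[symmetric]
    by (simp add: mult_ac)
qed

lemma wigner_tfs_tfs:
  fixes f h :: "'a::euclidean_space \<Rightarrow> complex"
  assumes [measurable]: "f \<in> borel_measurable borel" "h \<in> borel_measurable borel"
  shows "wigner (tfs l f) (tfs m h)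
    = (\<lambda>z. cis (pi * ((snd l + snd m) \<bullet> (fst l - fst m)))
        * tfs ((1/2) *\<^sub>R (l + m), jmap (l - m)) (wigner f h) z)"
proof (rule ext, clarify)
  fix x \<xi> :: 'a
  let ?\<eta> = "\<xi> - (1/2) *\<^sub>R (snd l + snd m)" and ?y = "x - (1/2) *\<^sub>R (fst l + fst m)"
  have "wigner (tfs l f) (tfs m h) (x, \<xi>)
      = cis (2 * pi * ((snd l - snd m) \<bullet> x))
          * cis (- 2 * pi * (?\<eta> \<bullet> (fst l - fst m))) * wigner f h (?y, ?\<eta>)"
    by (simp add: wigner_eq_fourier wig_prod_tfs_tfs fourier_scale fourier_tfs)
  also have "cis (2 * pi * ((snd l - snd m) \<bullet> x)) * cis (- 2 * pi * (?\<eta> \<bullet> (fst l - fst m)))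
      = cis (pi * ((snd l + snd m) \<bullet> (fst l - fst m))) * cis (2 * pi * (jmap (l - m) \<bullet> (x, \<xi>)))"
    unfolding cis_mult jmap_def
    by (rule arg_cong[where f=cis])
       (simp add: inner_diff_left inner_diff_right inner_add_left
         inner_add_right inner_commute algebra_simps)
  also have "(?y, ?\<eta>) = (x, \<xi>) - (1/2) *\<^sub>R (l + m)"
    by (simp add: prod_eq_iff)
  finally show "wigner (tfs l f) (tfs m h) (x, \<xi>) = cis (pi * ((snd l + snd m) \<bullet> (fst l - fst m))) *
      tfs ((1/2) *\<^sub>R (l + m), jmap (l - m)) (wigner f h) (x, \<xi>)"
    by (simp only: tfs_def fst_conv snd_conv mult.assoc)
qed

subsection \<open>Short-time Fourier transforms of Wigner distributions\<close>

lemma integral_wigner_gauss_frequency: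
  fixes f h :: "'a::euclidean_space \<Rightarrow> complex"
  assumes f: "f \<in> L2" and h: "h \<in> L2"
  shows "(LBINT \<xi>. wigner f h (x, \<xi>) * complex_of_real (gauss 2 (x, \<xi>)))
    = complex_of_real ((1 / sqrt 2) ^ DIM('a))
      * (LBINT t. f (x + (1/2) *\<^sub>R t) * cnj (gaussian (x + (1/2) *\<^sub>R t))
        * (gaussian (x - (1/2) *\<^sub>R t) * cnj (h (x - (1/2) *\<^sub>R t))))"
proof -
  let ?K = "complex_of_real ((1 / sqrt 2) ^ DIM('a))" and ?w = "wig_prod f h x"
  let ?G = "\<lambda>t. f (x + (1/2) *\<^sub>R t) * cnj (gaussian (x + (1/2) *\<^sub>R t))
    * (gaussian (x - (1/2) *\<^sub>R t) * cnj (h (x - (1/2) *\<^sub>R t)))"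
  have "wigner f h (x, \<xi>) * complex_of_real (gauss 2 (x, \<xi>))
      = complex_of_real (gauss 2 x) * (fourier ?w \<xi> * complex_of_real (gauss 2 \<xi>))" for \<xi>
    by (simp add: wigner_eq_fourier gauss_Pair)
  then have "(LBINT \<xi>. wigner f h (x, \<xi>) * complex_of_real (gauss 2 (x, \<xi>)))
      = complex_of_real (gauss 2 x) * (LBINT t. ?w t * fourier (\<lambda>\<xi>. complex_of_real (gauss 2 \<xi>)) t)"
    by (simp only: integral_mult_right_zero
      fourier_multiplication[OF wig_prod_integrable[OF f h] complex_gauss_integrable]
      zero_less_numeral)
  also have "\<dots> = (LBINT t. ?K * ?G t)"
  proof -
    have "complex_of_real (gauss 2 x) * (?w t * fourier (\<lambda>\<xi>. complex_of_real (gauss 2 \<xi>)) t)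
        = ?K * ?G t" for t
    proof -
      have "complex_of_real (gauss 2 x) * complex_of_real (gauss (1/2) t)
          = cnj (gaussian (x + (1/2) *\<^sub>R t)) * gaussian (x - (1/2) *\<^sub>R t)"
        using gauss_parallelogram[of 1 x t] by (simp add: gaussian_eq_gauss flip: of_real_mult)
      then show ?thesis by (simp add: wig_prod_def fourier_gauss mult_ac)
    qed
    then show ?thesis by (simp only: integral_mult_right_zero[symmetric])
  qed
  finally show ?thesis by (simp only: integral_mult_right_zero)
qed

lemma l2_inner_wigner_gauss:
  fixes f h :: "'a::euclidean_space \<Rightarrow> complex"
  assumes f: "f \<in> L2" and h: "h \<in> L2"
  shows "l2_inner (wigner f h) (\<lambda>y. complex_of_real (gauss 2 y))
    = complex_of_real ((1 / sqrt 2) ^ DIM('a)) * l2_inner f gaussian * l2_inner gaussian h"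
proof -
  have [measurable]: "f \<in> borel_measurable borel" "h \<in> borel_measurable borel"
    using f h by (auto intro: L2_measurable)
  let ?K = "complex_of_real ((1 / sqrt 2) ^ DIM('a))"
  let ?G = "\<lambda>p. f (fst p) * cnj (gaussian (fst p)) * (gaussian (snd p) * cnj (h (snd p)))"
  have G: "integrable lborel ?G"
    by (rule integrable_tensor_product[OF L2_inner_integrable[OF f gaussian_L2]
      L2_inner_integrable[OF gaussian_L2 h]])
  have "integrable lborel (\<lambda>y. wigner f h y * complex_of_real (gauss 2 y))"
  proof (rule integrable_dominated)
    show "integrable lborel (\<lambda>y::'a \<times> 'a. 2 ^ DIM('a)
        * sqrt (l2_normsq f * l2_normsq h) * gauss 2 y)"
      by (simp add: gauss_integrable)
  qed (auto simp: norm_mult intro!: mult_right_mono cmod_wigner_le f h)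
  from lborel_pair_integral[OF this]
  have "l2_inner (wigner f h) (\<lambda>y. complex_of_real (gauss 2 y))
      = ?K * (LBINT x. LBINT t. ?G (x + (1/2) *\<^sub>R t, x - (1/2) *\<^sub>R t))"
    by (simp add: l2_inner_def integral_wigner_gauss_frequency[OF f h])
  also have "\<dots> = ?K * (LBINT u. LBINT v. ?G (u, v))"
    by (simp only: integral_midpoint_coordinates[OF G] lborel_pair_integral[OF G])
  also have "(LBINT u. LBINT v. ?G (u, v)) = l2_inner f gaussian * l2_inner gaussian h"
    by (simp only: fst_conv snd_conv integral_mult_right_zero integral_mult_left_zero l2_inner_def)
  finally show ?thesis by (simp only: mult.assoc)
qed

lemma eq_tfs_tfs_uminus: "u = (\<lambda>t. cis (- 2 * pi * (snd r \<bullet> fst r)) * tfs r (tfs (- r) u) t)"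
  by (simp add: tfs_tfs cis_mult flip: mult.assoc)

text \<open>By covariance this is \<open>l2_inner_wigner_gauss\<close> for shifted \<open>f\<close> and \<open>h\<close>.\<close>
lemma cmod_stft_wigner:
  fixes f h :: "'a::euclidean_space \<Rightarrow> complex"
  assumes f: "f \<in> L2" and h: "h \<in> L2"
  shows "cmod (stft (\<lambda>y. complex_of_real (gauss 2 y)) (wigner f h) (z, \<zeta>))
    = (1 / sqrt 2) ^ DIM('a) * cmod (stft gaussian f (z - (1/2) *\<^sub>R jmap \<zeta>))
        * cmod (stft gaussian h (z + (1/2) *\<^sub>R jmap \<zeta>))"
proof -
  have [measurable]: "f \<in> borel_measurable borel" "h \<in> borel_measurable borel"
    using f h by (auto intro: L2_measurable)
  define p q where "p = z - (1/2) *\<^sub>R jmap \<zeta>" and "q = z + (1/2) *\<^sub>R jmap \<zeta>"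
  have halves: "(1/2) *\<^sub>R a + (1/2) *\<^sub>R a = a" for a :: "'a \<times> 'a"
    by (simp flip: scaleR_add_left)
  have "q - p = jmap \<zeta>"
    by (simp add: p_def q_def halves)
  then have "p - q = - jmap \<zeta>" by (metis minus_diff_eq)
  then have pq: "(1/2) *\<^sub>R (p + q) = z" "jmap (p - q) = \<zeta>"
    by (simp_all add: p_def q_def scaleR_add_right halves) (simp add: jmap_def)
  let ?f = "tfs (- p) f" and ?h = "tfs (- q) h" and ?g = "\<lambda>y. complex_of_real (gauss 2 y)"
  have "\<exists>c. cmod c = 1 \<and> wigner f h = (\<lambda>y. c * tfs (z, \<zeta>) (wigner ?f ?h) y)"
    by (subst eq_tfs_tfs_uminus[of f p], subst eq_tfs_tfs_uminus[of h q])
       (auto simp: wigner_scale_left wigner_scale_right wigner_tfs_tfs pq norm_mult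
         simp flip: mult.assoc intro!: exI[of _ "_ * _ * _"])
  then obtain c where "cmod c = 1" and c: "wigner f h = (\<lambda>y. c * tfs (z, \<zeta>) (wigner ?f ?h) y)"
    by blast
  then have "cmod (stft ?g (wigner f h) (z, \<zeta>)) = cmod (l2_inner (wigner ?f ?h) ?g)"
    unfolding c stft_def by (simp add: l2_inner_scale_left l2_inner_tfs_tfs norm_mult)
  also have "\<dots> = (1 / sqrt 2) ^ DIM('a) * cmod (l2_inner ?f gaussian) * cmod (l2_inner ?h gaussian)"
    using l2_inner_wigner_gauss[OF L2_tfs[OF f] L2_tfs[OF h], of "- p" "- q"]
      cnj_l2_inner[of ?h gaussian]
      complex_mod_cnj[of "l2_inner ?h gaussian"]
    by (simp add: norm_mult norm_power norm_divide)
  also have "cmod (l2_inner ?f gaussian) = cmod (stft gaussian f p)"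
    using cmod_stft_tfs[of f gaussian "- p" 0] by (simp add: stft_def)
  also have "cmod (l2_inner ?h gaussian) = cmod (stft gaussian h q)"
    using cmod_stft_tfs[of h gaussian "- q" 0] by (simp add: stft_def)
  finally show ?thesis by (simp add: p_def q_def)
qed

section \<open>The Feichtinger algebra\<close>

lemma S0_L2: "f \<in> S0 \<Longrightarrow> f \<in> L2"
  by (simp add: S0_def)

lemma S0_measurable: "f \<in> S0 \<Longrightarrow> f \<in> borel_measurable borel"
  by (simp add: S0_L2 L2_measurable)

lemma stft_gaussian_measurable:
  "f \<in> L2 \<Longrightarrow> stft gaussian f \<in> borel_measurable borel"
  by (rule stft_measurable[OF L2_measurable gaussian_measurable])

lemma stft_gaussian_integrable: "f \<in> S0 \<Longrightarrow> integrable lborel (stft gaussian f)"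
  using stft_gaussian_measurable[of f] by (simp add: S0_def integrable_iff_bounded)

lemma S0I: "f \<in> L2 \<Longrightarrow> integrable lborel (stft gaussian f) \<Longrightarrow> f \<in> S0"
  by (simp add: S0_def)

lemma S0_iff_nn_integral: "f \<in> S0 \<longleftrightarrow> f \<in> L2 \<and> (LBINT\<^sup>+z. ennreal (cmod (stft gaussian f z))) < \<infinity>"
  using stft_gaussian_measurable[of f] by (auto simp: S0_def integrable_iff_bounded)

lemma ennreal_S0_norm:
  "f \<in> S0 \<Longrightarrow> ennreal (S0_norm f) = (LBINT\<^sup>+z. ennreal (cmod (stft gaussian f z)))"
  unfolding S0_norm_def
  by (rule nn_integral_eq_integral[symmetric]) (auto simp: stft_gaussian_integrable)

lemma S0_norm_nonneg: "0 \<le> S0_norm f"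
  by (simp add: S0_norm_def)

lemma S0_add: "f \<in> S0 \<Longrightarrow> h \<in> S0 \<Longrightarrow> (\<lambda>t. f t + h t) \<in> S0"
  by (intro S0I L2_add) (simp_all add: stft_add gaussian_L2 S0_L2 stft_gaussian_integrable)

lemma S0_scale: "f \<in> S0 \<Longrightarrow> (\<lambda>t. c * f t) \<in> S0"
  by (intro S0I L2_scale) (simp_all add: stft_scale S0_L2 stft_gaussian_integrable)

lemma S0_diff: "f \<in> S0 \<Longrightarrow> h \<in> S0 \<Longrightarrow> (\<lambda>t. f t - h t) \<in> S0"
  using S0_add[of f "\<lambda>t. - 1 * h t"] S0_scale[of h "- 1"] by simp

lemma S0_sum:
  fixes F :: "'m \<Rightarrow> 'a::euclidean_space \<Rightarrow> complex"
  shows "finite S \<Longrightarrow> (\<And>m. m \<in> S \<Longrightarrow> F m \<in> S0) \<Longrightarrow> (\<lambda>t. \<Sum>m\<in>S. F m t) \<in> S0"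
proof (induction S rule: finite_induct)
  case empty
  have "stft gaussian (\<lambda>t::'a. 0) = (\<lambda>z. 0)" by (simp add: stft_def l2_inner_def fun_eq_iff)
  then show ?case by (simp add: S0_def L2_zero)
qed (simp add: S0_add)

lemma S0_tfs:
  assumes f: "f \<in> S0" shows "tfs w f \<in> S0"
proof -
  have L2: "tfs w f \<in> L2" by (rule L2_tfs[OF S0_L2[OF f]])
  have "integrable lborel (stft gaussian (tfs w f))"
  proof (rule integrable_dominated)
    show "integrable lborel (\<lambda>z. cmod (stft gaussian f (z - w)))"
      using lborel_integrable_shift[OF stft_gaussian_integrable[OF f]] by (rule integrable_norm)
    show "norm (stft gaussian (tfs w f) z) \<le> cmod (stft gaussian f (z - w))" for z
      by (simp add: cmod_stft_tfs S0_measurable[OF f])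
  qed (simp add: stft_gaussian_measurable L2)
  with L2 show ?thesis by (rule S0I)
qed

lemma S0_norm_tfs:
  assumes f: "f \<in> S0" shows "S0_norm (tfs w f) = S0_norm f"
  using lborel_integral_shift[of "\<lambda>z. cmod (stft gaussian f z)" w]
    stft_gaussian_measurable[OF S0_L2[OF f]]
  by (simp add: S0_norm_def cmod_stft_tfs S0_measurable f)

text \<open>Translates of \<open>stft gaussian f\<close> converge pointwise by continuity and have constant \<open>L\<^sup>1\<close> norm,
  so Scheffe's lemma applies.\<close>
lemma S0_norm_tfs_diff_tendsto:
  fixes f :: "'a::euclidean_space \<Rightarrow> complex"
  assumes f: "f \<in> S0" and s: "s \<longlonglongrightarrow> w"
  shows "(\<lambda>n. S0_norm (\<lambda>t. tfs (s n) f t - tfs w f t)) \<longlonglongrightarrow> 0"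
proof -
  let ?V = "\<lambda>v. stft gaussian (tfs v f)"
  have "isCont (stft gaussian f) z" for z
    using stft_continuous[OF S0_L2[OF f] gaussian_L2]
    by (simp only: continuous_on_eq_continuous_at open_UNIV) blast
  note stft_lim = isCont_tendsto_compose[OF this]
  have pointwise: "(\<lambda>n. ?V (s n) z) \<longlonglongrightarrow> ?V w z" for z
    unfolding stft_tfs[OF S0_measurable[OF f] gaussian_measurable]
    by (intro tendsto_intros stft_lim s)
  have norms: "(LBINT\<^sup>+z. ennreal (norm (?V v z))) = ennreal (S0_norm f)" for v
    using ennreal_S0_norm[OF S0_tfs[OF f]] by (simp add: S0_norm_tfs[OF f])
  have "(\<lambda>n. LBINT\<^sup>+z. ennreal (norm (?V (s n) z - ?V w z))) \<longlonglongrightarrow> 0"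
    by (rule Scheffe_lemma2)
       (simp_all add: stft_gaussian_integrable S0_tfs f
         pointwise norms stft_gaussian_measurable L2_tfs S0_L2)
  moreover have "(LBINT\<^sup>+z. ennreal (norm (?V (s n) z - ?V w z)))
      = ennreal (S0_norm (\<lambda>t. tfs (s n) f t - tfs w f t))" for n
    using ennreal_S0_norm[OF S0_diff[OF S0_tfs[OF f] S0_tfs[OF f]], of "s n" w]
    by (simp add: stft_diff L2_tfs S0_L2 f gaussian_L2)
  ultimately show ?thesis
    by (simp add: S0_norm_nonneg flip: ennreal_0)
qed

subsection \<open>Integrable short-time Fourier transforms\<close>

lemma gauss_mult_fourier_chirp:
  fixes x t :: "'a::euclidean_space"
  shows "gauss (1/2) x * fourier (tfs (0, (1/2) *\<^sub>R x) (\<lambda>\<xi>. complex_of_real (gauss (1/2) \<xi>))) t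
    = complex_of_real (sqrt 2 ^ DIM('a)) * (cnj (gaussian t) * gaussian (t - x))"
proof -
  have "t - (1/2) *\<^sub>R x - (1/2) *\<^sub>R x = t - x"
    by (simp add: diff_diff_eq flip: scaleR_add_left)
  from gauss_parallelogram[of 1 "t - (1/2) *\<^sub>R x" x, unfolded this]
  have "complex_of_real (gauss 2 (t - (1/2) *\<^sub>R x)) * complex_of_real (gauss (1/2) x)
      = cnj (gaussian t) * gaussian (t - x)"
    by (simp add: gaussian_eq_gauss flip: of_real_mult)
  then show ?thesis
    by (simp add: fourier_tfs fourier_gauss real_sqrt_divide mult_ac)
qed

lemma integral_stft_gauss_frequency:
  fixes f g :: "'a::euclidean_space \<Rightarrow> complex"
  assumes f: "f \<in> L2" and g: "g \<in> L2"
  shows "(LBINT \<xi>. stft g f (x, \<xi>) * (gauss (1/2) (x, \<xi>) * cis (pi * (\<xi> \<bullet> x))))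
    = complex_of_real (sqrt 2 ^ DIM('a))
      * (LBINT t. f t * cnj (gaussian t) * (gaussian (t - x) * cnj (g (t - x))))"
proof -
  let ?h = "\<lambda>t. f t * cnj (g (t - x))" and ?K = "complex_of_real (sqrt 2 ^ DIM('a))"
  let ?c = "complex_of_real (gauss (1/2) x)"
  let ?chirp = "tfs (0, (1/2) *\<^sub>R x) (\<lambda>\<xi>. complex_of_real (gauss (1/2) \<xi>))"
  have h: "integrable lborel ?h"
    using L2_inner_integrable[OF f L2_affine[OF g, of 1 "- x"]] by simp
  have chirp: "integrable lborel ?chirp"
    by (rule integrable_dominated[OF gauss_integrable[of "1/2"]]) (simp_all add: cmod_tfs)
  have "stft g f (x, \<xi>) * (gauss (1/2) (x, \<xi>) * cis (pi * (\<xi> \<bullet> x)))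
      = ?c * (fourier ?h \<xi> * ?chirp \<xi>)" for \<xi>
    by (simp add: stft_eq_fourier gauss_Pair tfs_def inner_commute mult_ac)
  then have "(LBINT \<xi>. stft g f (x, \<xi>) * (gauss (1/2) (x, \<xi>) * cis (pi * (\<xi> \<bullet> x))))
      = ?c * (LBINT \<xi>. fourier ?h \<xi> * ?chirp \<xi>)"
    by (simp only: integral_mult_right_zero)
  also have "\<dots> = ?c * (LBINT t. ?h t * fourier ?chirp t)"
    by (simp only: fourier_multiplication[OF h chirp])
  also have "\<dots> = (LBINT t. ?K * (f t * cnj (gaussian t) * (gaussian (t - x) * cnj (g (t - x)))))"
  proof -
    have "?c * (?h t * fourier ?chirp t)
        = ?K * (f t * cnj (gaussian t) * (gaussian (t - x) * cnj (g (t - x))))" for t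
      using gauss_mult_fourier_chirp[of x t] by (simp add: mult_ac)
    then show ?thesis by (simp only: integral_mult_right_zero[symmetric])
  qed
  finally show ?thesis by (simp only: integral_mult_right_zero)
qed

text \<open>Moyal's formula for the pairs \<open>(f, g)\<close> and \<open>(gaussian, gaussian)\<close>: the kernel is the
  conjugate of \<open>stft gaussian gaussian\<close> up to normalisation.\<close>
lemma integral_stft_gauss:
  fixes f g :: "'a::euclidean_space \<Rightarrow> complex"
  assumes f: "f \<in> L2" and g: "g \<in> L2"
  shows "(LBINT w. stft g f w * (gauss (1/2) w * cis (pi * (snd w \<bullet> fst w))))
    = complex_of_real (sqrt 2 ^ DIM('a)) * l2_inner f gaussian * l2_inner gaussian g"
proof -
  have [measurable]: "f \<in> borel_measurable borel" "g \<in> borel_measurable borel"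
    using f g by (auto intro: L2_measurable)
  have "integrable lborel (\<lambda>w. stft g f w * (gauss (1/2) w * cis (pi * (snd w \<bullet> fst w))))"
  proof (rule integrable_dominated)
    show "integrable lborel (\<lambda>w::'a \<times> 'a. sqrt (l2_normsq f * l2_normsq g) * gauss (1/2) w)"
      by (simp add: gauss_integrable)
    show "norm (stft g f w * (gauss (1/2) w * cis (pi * (snd w \<bullet> fst w))))
        \<le> sqrt (l2_normsq f * l2_normsq g) * gauss (1/2) w" for w
      using cmod_stft_le[OF f g, of w] by (simp add: norm_mult mult_right_mono)
  qed measurable
  from lborel_pair_integral[OF this]
  have "(LBINT w. stft g f w * (gauss (1/2) w * cis (pi * (snd w \<bullet> fst w))))
      = complex_of_real (sqrt 2 ^ DIM('a))
        * (LBINT x. LBINT t. f t * cnj (gaussian t) * (gaussian (t - x) * cnj (g (t - x))))"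
    by (simp only: fst_conv snd_conv integral_stft_gauss_frequency[OF f g] integral_mult_right_zero)
  also have "(LBINT x. LBINT t. f t * cnj (gaussian t) * (gaussian (t - x) * cnj (g (t - x))))
      = l2_inner f gaussian * l2_inner gaussian g"
    unfolding l2_inner_def
    by (rule integral_convolution_reflected[OF
      L2_inner_integrable[OF f gaussian_L2] L2_inner_integrable[OF gaussian_L2 g]])
  finally show ?thesis by (simp only: mult.assoc)
qed

lemma cmod_stft_gaussian_le_convolution:
  fixes f g :: "'a::euclidean_space \<Rightarrow> complex"
  assumes f: "f \<in> L2" and g: "g \<in> L2"
  shows "ennreal (sqrt 2 ^ DIM('a) * cmod (l2_inner gaussian g) * cmod (stft gaussian f z))
    \<le> (LBINT\<^sup>+w. ennreal (cmod (stft g f w)) * ennreal (gauss (1/2) (w - z)))"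
proof -
  have [measurable]: "f \<in> borel_measurable borel" "g \<in> borel_measurable borel"
    using f g by (auto intro: L2_measurable)
  have "cmod (stft gaussian f z) = cmod (l2_inner (tfs (- z) f) gaussian)"
    using cmod_stft_tfs[of f gaussian "- z" 0] by (simp add: stft_def)
  then have "ennreal (sqrt 2 ^ DIM('a) * cmod (l2_inner gaussian g) * cmod (stft gaussian f z))
      = ennreal (norm (LBINT w. stft g (tfs (- z) f) w
          * (gauss (1/2) w * cis (pi * (snd w \<bullet> fst w)))))"
    unfolding integral_stft_gauss[OF L2_tfs[OF f] g] by (simp add: norm_mult norm_power mult_ac)
  also have "\<dots> \<le> (LBINT\<^sup>+w. ennreal (cmod (stft g f (w + z))) * ennreal (gauss (1/2) w))"
    by (rule order.trans[OF ennreal_norm_integral_le])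
      (simp add: norm_mult cmod_stft_tfs ennreal_mult)
  also have "\<dots> = (LBINT\<^sup>+w. ennreal (cmod (stft g f w)) * ennreal (gauss (1/2) (w - z)))"
    using nn_integral_lborel_shift[of "\<lambda>w. ennreal (cmod (stft g f (w + z)))
        * ennreal (gauss (1/2) w)" z] by simp
  finally show ?thesis .
qed

lemma S0_of_integrable_stft:
  fixes f g :: "'a::euclidean_space \<Rightarrow> complex"
  assumes f: "f \<in> L2" and g: "g \<in> L2" and integrable: "integrable lborel (stft g f)"
    and nonzero: "l2_inner gaussian g \<noteq> 0"
  shows "f \<in> S0"
proof -
  have [measurable]: "f \<in> borel_measurable borel" "g \<in> borel_measurable borel"
    using f g by (auto intro: L2_measurable)
  define c where "c = sqrt 2 ^ DIM('a) * cmod (l2_inner gaussian g)"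
  have c: "c > 0" using nonzero by (simp add: c_def)
  have "ennreal c * (LBINT\<^sup>+z. ennreal (cmod (stft gaussian f z)))
      = (LBINT\<^sup>+z. ennreal (c * cmod (stft gaussian f z)))"
    using c by (simp add: ennreal_mult nn_integral_cmult)
  also have "\<dots> \<le> (LBINT\<^sup>+z. LBINT\<^sup>+w. ennreal (cmod (stft g f w)) * ennreal (gauss (1/2) (w - z)))"
    unfolding c_def by (intro nn_integral_mono cmod_stft_gaussian_le_convolution f g)
  also have "\<dots> = (LBINT\<^sup>+w. LBINT\<^sup>+z. ennreal (cmod (stft g f w)) * ennreal (gauss (1/2) (w - z)))"
    using nn_integral_lborel_swap[of "\<lambda>p. ennreal (cmod (stft g f (snd p)))
        * ennreal (gauss (1/2) (snd p - fst p))"]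
    by simp
  also have "\<dots> = (LBINT\<^sup>+w. ennreal (cmod (stft g f w)) * ennreal (sqrt 2 ^ DIM('a \<times> 'a)))"
  proof -
    have "(LBINT\<^sup>+z. ennreal (gauss (1/2) (w - z)))
        = ennreal (sqrt 2 ^ DIM('a \<times> 'a))" for w :: "'a \<times> 'a"
      using nn_integral_lborel_affine[of "\<lambda>z. ennreal (gauss (1/2) z)" "-1" w]
      by (simp add: gauss_nn_integral real_sqrt_divide del: DIM_prod)
    then show ?thesis by (simp add: nn_integral_cmult)
  qed
  also have "\<dots> < \<infinity>"
    using integrable by (simp add: nn_integral_multc integrable_iff_bounded ennreal_mult_less_top)
  finally show ?thesis
    using f c by (auto simp: S0_iff_nn_integral ennreal_mult_less_top)
qed

subsection \<open>Wigner distributions\<close>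

lemma stft_window_scale: "stft (\<lambda>t. c * h t) f z = cnj c * stft h f z"
proof -
  have "tfs z (\<lambda>t. c * h t) = (\<lambda>t. c * tfs z h t)" by (simp add: tfs_def mult_ac)
  then show ?thesis by (simp add: stft_def l2_inner_scale_right)
qed

lemma stft_convolution_window:
  fixes F k h :: "'b::euclidean_space \<Rightarrow> complex"
  assumes [measurable]: "F \<in> borel_measurable borel" and F: "\<And>y. cmod (F y) \<le> B"
    and k: "integrable lborel k" and h: "integrable lborel h"
  shows "stft (\<lambda>y. LBINT w. k w * h (y - w)) F (z, \<zeta>) = (LBINT w. cnj (k w) * stft h F (z + w, \<zeta>))"
proof -
  have [measurable]: "k \<in> borel_measurable borel" "h \<in> borel_measurable borel" using k h by auto
  let ?e = "\<lambda>y. F y * cnj (cis (2 * pi * (\<zeta> \<bullet> y)))"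
  let ?G = "\<lambda>p. ?e (snd p) * cnj (k (fst p) * h (snd p - fst p - z))"
  have "integrable lborel ?G"
  proof (rule integrable_dominated)
    show "integrable lborel (\<lambda>p. B * cmod (k (fst p) * h (snd p - fst p - z)))"
      using integrable_convolution_kernel[OF k lborel_integrable_shift[OF h, of z]] by simp
  qed (auto simp: norm_mult intro!: mult_right_mono F)
  from lborel_swap_integral[OF this]
  have swap: "(LBINT y. LBINT w. ?G (w, y)) = (LBINT w. LBINT y. ?G (w, y))" by simp
  have inner_w: "(LBINT w. ?G (w, y))
      = F y * cnj (tfs (z, \<zeta>) (\<lambda>y. LBINT w. k w * h (y - w)) y)" for y
  proof -
    have "(LBINT w. ?G (w, y)) = ?e y * (LBINT w. cnj (k w * h (y - w - z)))"
      by (simp only: fst_conv snd_conv integral_mult_right_zero)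
    also have "\<dots> = ?e y * cnj (LBINT w. k w * h (y - z - w))"
      by (simp only: Bochner_Integration.integral_cnj
        cancel_ab_semigroup_add_class.diff_right_commute[of y])
    finally show ?thesis by (simp add: tfs_def)
  qed
  have inner_y: "(LBINT y. ?G (w, y)) = cnj (k w) * stft h F (z + w, \<zeta>)" for w
    unfolding stft_def l2_inner_def
    by (subst integral_mult_right_zero[symmetric])
      (simp add: tfs_def diff_diff_eq mult_ac add.commute)
  have "stft (\<lambda>y. LBINT w. k w * h (y - w)) F (z, \<zeta>) = (LBINT y. LBINT w. ?G (w, y))"
    unfolding inner_w by (simp only: stft_def l2_inner_def)
  also note swap
  finally show ?thesis unfolding inner_y .
qed

lemma nn_integral_stft_convolution_window_le:
  fixes F k h :: "'b::euclidean_space \<Rightarrow> complex"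
  assumes [measurable]: "F \<in> borel_measurable borel" and F: "\<And>y. cmod (F y) \<le> B"
    and k: "integrable lborel k" and h: "integrable lborel h"
  shows "(LBINT\<^sup>+r. ennreal (cmod (stft (\<lambda>y. LBINT w. k w * h (y - w)) F r)))
    \<le> (LBINT\<^sup>+w. ennreal (cmod (k w))) * (LBINT\<^sup>+r. ennreal (cmod (stft h F r)))"
proof -
  have [measurable]: "k \<in> borel_measurable borel" "h \<in> borel_measurable borel" using k h by auto
  let ?H = "\<lambda>r. ennreal (cmod (stft h F r))" and ?k = "\<lambda>w. ennreal (cmod (k w))"
  have "ennreal (cmod (stft (\<lambda>y. LBINT w. k w * h (y - w)) F r))
      \<le> (LBINT\<^sup>+w. ?k w * ?H (r - (- w, 0)))" for r
    using ennreal_norm_integral_le[of lborel "\<lambda>w. cnj (k w) * stft h F (r - (- w, 0))"]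
      stft_convolution_window[OF assms, of "fst r" "snd r"]
    by (cases r) (simp add: norm_mult ennreal_mult)
  then have "(LBINT\<^sup>+r. ennreal (cmod (stft (\<lambda>y. LBINT w. k w * h (y - w)) F r)))
      \<le> (LBINT\<^sup>+r. LBINT\<^sup>+w. ?k w * ?H (r - (- w, 0)))"
    by (intro nn_integral_mono)
  also have "\<dots> = (LBINT\<^sup>+w. LBINT\<^sup>+r. ?k w * ?H (r - (- w, 0)))"
    using nn_integral_lborel_swap[of "\<lambda>q. ?k (snd q) * ?H (fst q - (- snd q, 0))"] by simp
  also have "\<dots> = (LBINT\<^sup>+w. ?k w) * (LBINT\<^sup>+r. ?H r)"
    by (simp add: nn_integral_cmult nn_integral_multc nn_integral_lborel_shift[of ?H])
  finally show ?thesis .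
qed

text \<open>The STFT of a Wigner distribution factorises for the window \<open>gauss 2\<close>, not for \<open>gaussian\<close>.\<close>
lemma gaussian_eq_gauss_convolution:
  fixes y :: "'b::euclidean_space"
  shows "gaussian y = complex_of_real (2 ^ DIM('b))
      * (LBINT w. complex_of_real (gauss 2 w) * complex_of_real (gauss 2 (y - w)))"
proof -
  have "gauss 2 w * gauss 2 (y - w) = gauss 4 (w - (1/2) *\<^sub>R y) * gauss 1 y" for w
  proof -
    have "w - (1/2) *\<^sub>R y - (1/2) *\<^sub>R y = - (y - w)"
      by (simp add: diff_diff_eq flip: scaleR_add_left)
    then show ?thesis using gauss_parallelogram[of 2 "w - (1/2) *\<^sub>R y" y]
      by (simp only: gauss_uminus) simp
  qed
  then have "(LBINT w. gauss 2 w * gauss 2 (y - w))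
      = (LBINT w. gauss 4 (w - (1/2) *\<^sub>R y)) * gauss 1 y"
    by simp
  also have "(LBINT w. gauss 4 (w - (1/2) *\<^sub>R y)) = (1/2) ^ DIM('b)"
    by (subst lborel_integral_shift) (simp_all add: gauss_integral)
  finally have "(LBINT w. gauss 2 w * gauss 2 (y - w)) = (1/2) ^ DIM('b) * gauss 1 y" .
  then show ?thesis
    by (simp add: gaussian_eq_gauss power_divide flip: of_real_mult)
qed

lemma nn_integral_stft_wigner:
  fixes f h :: "'a::euclidean_space \<Rightarrow> complex"
  assumes f: "f \<in> L2" and h: "h \<in> L2"
  shows "(LBINT\<^sup>+r. ennreal (cmod (stft (\<lambda>y. complex_of_real (gauss 2 y)) (wigner f h) r)))
    = ennreal ((1 / sqrt 2) ^ DIM('a))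
      * ((LBINT\<^sup>+z. ennreal (cmod (stft gaussian f z)))
          * (LBINT\<^sup>+z. ennreal (cmod (stft gaussian h z))))"
proof -
  have [measurable]: "f \<in> borel_measurable borel" "h \<in> borel_measurable borel"
    using f h by (auto intro: L2_measurable)
  let ?F = "\<lambda>z. ennreal (cmod (stft gaussian f z))"
    and ?H = "\<lambda>z. ennreal (cmod (stft gaussian h z))"
  have "ennreal (cmod (stft (\<lambda>y. complex_of_real (gauss 2 y)) (wigner f h) r))
      = ennreal ((1 / sqrt 2) ^ DIM('a)) *
      (?F (fst r - (1/2) *\<^sub>R jmap (snd r)) * ?H (fst r + (1/2) *\<^sub>R jmap (snd r)))" for r
    using cmod_stft_wigner[OF f h, of "fst r" "snd r"] by (simp add: ennreal_mult mult.assoc)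
  then show ?thesis
    by (simp add: nn_integral_cmult nn_integral_midpoint_jmap[of ?F ?H])
qed

lemma two_power_eq_sqrt_power: "(2::real) ^ n = sqrt 2 ^ n * sqrt 2 ^ n"
  by (simp flip: power_mult_distrib)

lemma nn_integral_stft_gaussian_wigner_le:
  fixes f h :: "'a::euclidean_space \<Rightarrow> complex"
  assumes f: "f \<in> L2" and h: "h \<in> L2"
  shows "(LBINT\<^sup>+r. ennreal (cmod (stft gaussian (wigner f h) r)))
    \<le> ennreal (sqrt 2 ^ DIM('a))
      * ((LBINT\<^sup>+z. ennreal (cmod (stft gaussian f z)))
          * (LBINT\<^sup>+z. ennreal (cmod (stft gaussian h z))))"
proof -
  have [measurable]: "f \<in> borel_measurable borel" "h \<in> borel_measurable borel"
    using f h by (auto intro: L2_measurable)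
  let ?D = "DIM('a \<times> 'a)" and ?W = "wigner f h"
  let ?g = "\<lambda>y :: 'a \<times> 'a. complex_of_real (gauss 2 y)"
  have window: "gaussian = (\<lambda>y. complex_of_real (2 ^ ?D) * (LBINT w. ?g w * ?g (y - w)))"
    by (rule ext) (rule gaussian_eq_gauss_convolution)
  have "cmod (stft gaussian ?W r)
      = 2 ^ ?D * cmod (stft (\<lambda>y. LBINT w. ?g w * ?g (y - w)) ?W r)" for r
    unfolding window by (simp add: stft_window_scale norm_mult norm_power del: DIM_prod)
  then have "(LBINT\<^sup>+r. ennreal (cmod (stft gaussian ?W r)))
      = (LBINT\<^sup>+r. ennreal (2 ^ ?D) * ennreal (cmod (stft (\<lambda>y. LBINT w. ?g w * ?g (y - w)) ?W r)))"
    by (simp add: ennreal_mult del: DIM_prod)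
  also have "\<dots> = ennreal (2 ^ ?D)
      * (LBINT\<^sup>+r. ennreal (cmod (stft (\<lambda>y. LBINT w. ?g w * ?g (y - w)) ?W r)))"
    by (rule nn_integral_cmult)
      (intro measurable_compose[OF _ measurable_ennreal] borel_measurable_norm, measurable)
  also have "\<dots> \<le> ennreal (2 ^ ?D)
      * ((LBINT\<^sup>+w. ennreal (cmod (?g w))) * (LBINT\<^sup>+r. ennreal (cmod (stft ?g ?W r))))"
    by (intro mult_left_mono nn_integral_stft_convolution_window_le[OF _ cmod_wigner_le[OF f h]]
      complex_gauss_integrable) simp_all
  also have "\<dots> = ennreal (2 ^ ?D * (1 / sqrt 2) ^ ?D * (1 / sqrt 2) ^ DIM('a))
      * ((LBINT\<^sup>+z. ennreal (cmod (stft gaussian f z)))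
          * (LBINT\<^sup>+z. ennreal (cmod (stft gaussian h z))))"
    by (simp add: nn_integral_stft_wigner[OF f h]
      gauss_nn_integral ennreal_mult mult.assoc del: DIM_prod)
  also have "2 ^ ?D * (1 / sqrt 2) ^ ?D * (1 / sqrt 2) ^ DIM('a) = sqrt 2 ^ DIM('a)"
    by (simp add: power_add power_one_over two_power_eq_sqrt_power)
  finally show ?thesis .
qed

lemma S0_wigner:
  fixes f h :: "'a::euclidean_space \<Rightarrow> complex"
  assumes f: "f \<in> S0" and h: "h \<in> S0"
  shows "wigner f h \<in> S0" and "S0_norm (wigner f h) \<le> sqrt 2 ^ DIM('a) * S0_norm f * S0_norm h"
proof -
  have bound: "(LBINT\<^sup>+r. ennreal (cmod (stft gaussian (wigner f h) r)))
      \<le> ennreal (sqrt 2 ^ DIM('a) * S0_norm f * S0_norm h)"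
    using nn_integral_stft_gaussian_wigner_le[OF S0_L2[OF f] S0_L2[OF h]]
    by (simp add: ennreal_S0_norm[OF f, symmetric]
      ennreal_S0_norm[OF h, symmetric] S0_norm_nonneg mult.assoc
      flip: ennreal_mult)
  then show "wigner f h \<in> S0"
    unfolding S0_iff_nn_integral
    using L2_wigner[OF S0_L2[OF f] S0_L2[OF h]] by (auto elim: order.strict_trans1)
  from bound show "S0_norm (wigner f h) \<le> sqrt 2 ^ DIM('a) * S0_norm f * S0_norm h"
    unfolding ennreal_S0_norm[OF \<open>wigner f h \<in> S0\<close>, symmetric]
    by (subst (asm) ennreal_le_iff) (auto intro!: mult_nonneg_nonneg S0_norm_nonneg)
qed

section \<open>The Weyl pairing\<close>

lemma S0_dual_add: "\<sigma> \<in> S0_dual \<Longrightarrow> F \<in> S0 \<Longrightarrow> G \<in> S0 \<Longrightarrow> \<sigma> (\<lambda>w. F w + G w) = \<sigma> F + \<sigma> G"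
  by (simp add: S0_dual_def)

lemma S0_dual_scale: "\<sigma> \<in> S0_dual \<Longrightarrow> F \<in> S0 \<Longrightarrow> \<sigma> (\<lambda>w. c * F w) = cnj c * \<sigma> F"
  by (simp add: S0_dual_def)

lemma weyl_pair_add_left:
  assumes "\<sigma> \<in> S0_dual" "f \<in> S0" "f' \<in> S0" "h \<in> S0"
  shows "weyl_pair \<sigma> (\<lambda>t. f t + f' t) h = weyl_pair \<sigma> f h + weyl_pair \<sigma> f' h"
  using assms by (simp add: weyl_pair_def wigner_add_right S0_L2 S0_dual_add S0_wigner(1))

lemma weyl_pair_add_right:
  assumes "\<sigma> \<in> S0_dual" "f \<in> S0" "h \<in> S0" "h' \<in> S0"
  shows "weyl_pair \<sigma> f (\<lambda>t. h t + h' t) = weyl_pair \<sigma> f h + weyl_pair \<sigma> f h'"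
  using assms by (simp add: weyl_pair_def wigner_add_left S0_L2 S0_dual_add S0_wigner(1))

lemma weyl_pair_scale_left:
  assumes "\<sigma> \<in> S0_dual" "f \<in> S0" "h \<in> S0"
  shows "weyl_pair \<sigma> (\<lambda>t. c * f t) h = c * weyl_pair \<sigma> f h"
  using assms by (simp add: weyl_pair_def wigner_scale_right S0_dual_scale S0_wigner(1))

lemma weyl_pair_scale_right:
  assumes "\<sigma> \<in> S0_dual" "f \<in> S0" "h \<in> S0"
  shows "weyl_pair \<sigma> f (\<lambda>t. c * h t) = cnj c * weyl_pair \<sigma> f h"
  using assms by (simp add: weyl_pair_def wigner_scale_left S0_dual_scale S0_wigner(1))

lemma weyl_pair_diff_left:
  assumes "\<sigma> \<in> S0_dual" "f \<in> S0" "f' \<in> S0" "h \<in> S0"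
  shows "weyl_pair \<sigma> (\<lambda>t. f t - f' t) h = weyl_pair \<sigma> f h - weyl_pair \<sigma> f' h"
  using weyl_pair_add_left[OF assms(1,2) S0_scale[OF assms(3), of "-1"] assms(4)]
    weyl_pair_scale_left[OF assms(1,3,4), of "-1"] by simp

lemma weyl_pair_diff_right:
  assumes "\<sigma> \<in> S0_dual" "f \<in> S0" "h \<in> S0" "h' \<in> S0"
  shows "weyl_pair \<sigma> f (\<lambda>t. h t - h' t) = weyl_pair \<sigma> f h - weyl_pair \<sigma> f h'"
  using weyl_pair_add_right[OF assms(1,2,3) S0_scale[OF assms(4), of "-1"]]
    weyl_pair_scale_right[OF assms(1,2,4), of "-1"] by simp

lemma weyl_pair_bounded:
  fixes \<sigma> :: "('a::euclidean_space \<times> 'a \<Rightarrow> complex) \<Rightarrow> complex"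
  assumes "\<sigma> \<in> S0_dual"
  shows "\<exists>D. \<forall>f\<in>S0. \<forall>h\<in>S0. cmod (weyl_pair \<sigma> f h) \<le> D * S0_norm f * S0_norm h"
proof -
  obtain C where C: "\<And>F. F \<in> S0 \<Longrightarrow> cmod (\<sigma> F) \<le> C * S0_norm F"
    using assms unfolding S0_dual_def by blast
  have "cmod (weyl_pair \<sigma> f h) \<le> (max 0 C * sqrt 2 ^ DIM('a)) * S0_norm f * S0_norm h"
    if f: "f \<in> S0" and h: "h \<in> S0" for f h :: "'a \<Rightarrow> complex"
  proof -
    have "cmod (weyl_pair \<sigma> f h) \<le> C * S0_norm (wigner h f)"
      unfolding weyl_pair_def by (rule C[OF S0_wigner(1)[OF h f]])
    also have "\<dots> \<le> max 0 C * (sqrt 2 ^ DIM('a) * S0_norm h * S0_norm f)"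
      by (intro mult_mono S0_wigner(2)[OF h f] S0_norm_nonneg) simp_all
    finally show ?thesis by (simp only: mult_ac)
  qed
  then show ?thesis by blast
qed

lemma weyl_pair_tfs_tendsto:
  fixes g :: "'a::euclidean_space \<Rightarrow> complex"
  assumes \<sigma>: "\<sigma> \<in> S0_dual" and g: "g \<in> S0" and a: "a \<longlonglongrightarrow> l" and b: "b \<longlonglongrightarrow> m"
  shows "(\<lambda>n. weyl_pair \<sigma> (tfs (b n) g) (tfs (a n) g)) \<longlonglongrightarrow> weyl_pair \<sigma> (tfs m g) (tfs l g)"
proof -
  obtain D where D: "\<And>f h. f \<in> S0 \<Longrightarrow> h \<in> S0 \<Longrightarrow> cmod (weyl_pair \<sigma> f h) \<le> D * S0_norm f * S0_norm h"
    using weyl_pair_bounded[OF \<sigma>] by blast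
  let ?a = "\<lambda>n t. tfs (a n) g t - tfs l g t" and ?b = "\<lambda>n t. tfs (b n) g t - tfs m g t"
  note S0 = S0_tfs[OF g] S0_diff[OF S0_tfs[OF g] S0_tfs[OF g]]
  have "weyl_pair \<sigma> (tfs (b n) g) (tfs (a n) g) - weyl_pair \<sigma> (tfs m g) (tfs l g)
      = weyl_pair \<sigma> (?b n) (tfs (a n) g) + weyl_pair \<sigma> (tfs m g) (?a n)" for n
    by (simp add: weyl_pair_diff_left weyl_pair_diff_right \<sigma> S0)
  then have diff_le:
    "norm (weyl_pair \<sigma> (tfs (b n) g) (tfs (a n) g) - weyl_pair \<sigma> (tfs m g) (tfs l g))
      \<le> D * S0_norm (?b n) * S0_norm g + D * S0_norm g * S0_norm (?a n)" for n
    using D[OF S0(2) S0(1), of "b n" m "a n"] D[OF S0(1) S0(2), of m "a n" l]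
      norm_triangle_ineq[of "weyl_pair \<sigma> (?b n) (tfs (a n) g)" "weyl_pair \<sigma> (tfs m g) (?a n)"]
    unfolding S0_norm_tfs[OF g] by simp
  have "(\<lambda>n. D * S0_norm (?b n) * S0_norm g + D * S0_norm g * S0_norm (?a n))
      \<longlonglongrightarrow> D * 0 * S0_norm g + D * S0_norm g * 0"
    by (intro tendsto_intros S0_norm_tfs_diff_tendsto g a b)
  then have "(\<lambda>n. D * S0_norm (?b n) * S0_norm g + D * S0_norm g * S0_norm (?a n)) \<longlonglongrightarrow> 0" by simp
  from Lim_null_comparison[OF always_eventually[OF allI[OF diff_le]] this]
  show ?thesis by (rule LIM_zero_cancel)
qed

section \<open>Tight Gabor frames\<close>

lemma tight_gabor_frame_L2: "tight_gabor_frame \<Lambda> g \<Longrightarrow> g \<in> L2"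
  by (simp add: tight_gabor_frame_def)

lemma tight_frame_normsq_has_sum:
  assumes "tight_gabor_frame \<Lambda> g" and "f \<in> L2"
  shows "((\<lambda>l. complex_of_real ((cmod (l2_inner f (tfs l g)))\<^sup>2))
      has_sum complex_of_real (l2_normsq f)) \<Lambda>"
  using assms unfolding tight_gabor_frame_def by (intro has_sum_of_real) auto

lemma complex_polarization:
  "a * cnj b = (of_real ((cmod (a + b))\<^sup>2) - of_real ((cmod (a - b))\<^sup>2)
     + \<i> * of_real ((cmod (a + \<i> * b))\<^sup>2) - \<i> * of_real ((cmod (a - \<i> * b))\<^sup>2)) / 4"
  by (simp add: complex_norm_square del: of_real_power) (simp add: algebra_simps)

lemma tight_frame_inner_has_sum:
  assumes frame: "tight_gabor_frame \<Lambda> g" and f: "f \<in> L2" and h: "h \<in> L2"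
  shows "((\<lambda>l. l2_inner f (tfs l g) * cnj (l2_inner h (tfs l g))) has_sum l2_inner f h) \<Lambda>"
proof -
  have g: "g \<in> L2" by (rule tight_gabor_frame_L2[OF frame])
  have i_h: "(\<lambda>t. \<i> * h t) \<in> L2" by (rule L2_scale[OF h])
  let ?N = "\<lambda>u l. complex_of_real ((cmod (l2_inner u (tfs l g)))\<^sup>2)"
  have "((\<lambda>l. (?N (\<lambda>t. f t + h t) l + - ?N (\<lambda>t. f t - h t) l
        + \<i> * ?N (\<lambda>t. f t + \<i> * h t) l + - (\<i> * ?N (\<lambda>t. f t - \<i> * h t) l)) * (1/4)) has_sum
      (of_real (l2_normsq (\<lambda>t. f t + h t)) + - of_real (l2_normsq (\<lambda>t. f t - h t))
        + \<i> * of_real (l2_normsq (\<lambda>t. f t + \<i> * h t)) +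
            - (\<i> * of_real (l2_normsq (\<lambda>t. f t - \<i> * h t)))) * (1/4)) \<Lambda>"
    by (intro has_sum_cmult_left has_sum_add has_sum_uminusI has_sum_cmult_right
      tight_frame_normsq_has_sum[OF frame] L2_add L2_diff f h i_h)
  moreover have coeff: "l2_inner f (tfs l g) * cnj (l2_inner h (tfs l g))
      = (?N (\<lambda>t. f t + h t) l + - ?N (\<lambda>t. f t - h t) l
      + \<i> * ?N (\<lambda>t. f t + \<i> * h t) l + - (\<i> * ?N (\<lambda>t. f t - \<i> * h t) l)) * (1/4)" for l
    unfolding complex_polarization[of "l2_inner f (tfs l g)"]
    by (simp add: l2_inner_add_left l2_inner_diff_left l2_inner_scale_left L2_tfs f g h i_h)
  ultimately show ?thesis
    unfolding coeff l2_inner_polarization[OF f h] by simp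
qed

lemma tight_frame_separates_gaussian:
  fixes g :: "'a::euclidean_space \<Rightarrow> complex"
  assumes frame: "tight_gabor_frame \<Lambda> g"
  obtains m where "m \<in> \<Lambda>" "l2_inner gaussian (tfs m g) \<noteq> 0"
proof (rule ccontr)
  assume "\<not> thesis"
  then have "((\<lambda>l. complex_of_real ((cmod (l2_inner gaussian (tfs l g)))\<^sup>2)) has_sum 0) \<Lambda>"
    using that by (intro has_sum_0) auto
  then have "complex_of_real (l2_normsq (gaussian :: 'a \<Rightarrow> complex)) = 0"
    using tight_frame_normsq_has_sum[OF frame gaussian_L2] by (rule has_sum_unique[rotated])
  then show False using gaussian_normsq_pos[where 'a='a] by simp
qed

lemma S0_of_tight_frame:
  fixes g :: "'a::euclidean_space \<Rightarrow> complex"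
  assumes frame: "tight_gabor_frame \<Lambda> g" and integrable: "integrable lborel (stft g g)"
  shows "g \<in> S0"
proof -
  have g: "g \<in> L2" by (rule tight_gabor_frame_L2[OF frame])
  obtain m where m: "l2_inner gaussian (tfs m g) \<noteq> 0"
    using tight_frame_separates_gaussian[OF frame] by blast
  have "integrable lborel (stft (tfs m g) g)"
  proof (rule integrable_dominated)
    show "integrable lborel (\<lambda>z. cmod (stft g g (z - (- m))))"
      using lborel_integrable_shift[OF integrable] by (rule integrable_norm)
    show "stft (tfs m g) g \<in> borel_measurable lborel"
      using stft_measurable[OF L2_measurable[OF g] L2_measurable[OF L2_tfs[OF g]]] by simp
  qed (simp add: cmod_stft_window_tfs)
  from S0_of_integrable_stft[OF g L2_tfs[OF g] this m] show ?thesis .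
qed

lemma ennreal_norm_has_sum_le:
  fixes f :: "'m \<Rightarrow> complex"
  assumes "(f has_sum s) A"
  shows "ennreal (norm s) \<le> (\<integral>\<^sup>+m. ennreal (norm (f m)) \<partial>count_space A)"
proof -
  have "Infinite_Set_Sum.abs_summable_on f A"
    using has_sum_imp_summable[OF assms]
      summable_on_iff_abs_summable_on_complex abs_summable_equivalent by blast
  then have "s = (\<integral>m. f m \<partial>count_space A)"
    using infsetsum_infsum[of f A] infsumI[OF assms] by (simp add: infsetsum_def)
  then show ?thesis by (simp add: ennreal_norm_integral_le)
qed

lemma nn_integral_count_space_eq_infsum:
  fixes c :: "'m \<Rightarrow> real"
  assumes "c summable_on A" and "\<And>m. 0 \<le> c m"
  shows "(\<integral>\<^sup>+m. ennreal (c m) \<partial>count_space A) = ennreal (infsum c A)"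
proof -
  have "Infinite_Set_Sum.abs_summable_on c A"
    using assms by (subst abs_summable_equivalent[symmetric]) simp
  then show ?thesis
    using nn_integral_conv_infsetsum[of c A] infsetsum_infsum[of c A] assms(2) by simp
qed

lemma infsum_Diff_tendsto_0:
  fixes f :: "'m \<Rightarrow> 'a::banach"
  assumes f: "f summable_on A"
  shows "((\<lambda>S. infsum f (A - S)) \<longlongrightarrow> 0) (finite_subsets_at_top A)"
proof -
  have "((\<lambda>S. infsum f A - sum f S) \<longlongrightarrow> infsum f A - infsum f A) (finite_subsets_at_top A)"
    by (intro tendsto_intros infsum_tendsto f)
  moreover have "\<forall>\<^sub>F S in finite_subsets_at_top A. infsum f A - sum f S = infsum f (A - S)"
    using f by (auto simp: infsum_Diff intro!: eventually_finite_subsets_at_top_weakI)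
  ultimately show ?thesis by (simp add: filterlim_cong)
qed

lemma stft_frame_remainder_has_sum:
  fixes f g :: "'a::euclidean_space \<Rightarrow> complex"
  assumes frame: "tight_gabor_frame \<Lambda> g" and f: "f \<in> L2" and S: "finite S" "S \<subseteq> \<Lambda>"
  shows "((\<lambda>m. l2_inner f (tfs m g) * stft gaussian (tfs m g) z) has_sum
    stft gaussian (\<lambda>t. f t - (\<Sum>m\<in>S. l2_inner f (tfs m g) * tfs m g t)) z) (\<Lambda> - S)"
proof -
  have g: "g \<in> L2" by (rule tight_gabor_frame_L2[OF frame])
  let ?c = "\<lambda>m. l2_inner f (tfs m g)"
  have L2_sum: "(\<lambda>t. \<Sum>m\<in>F. ?c m * tfs m g t) \<in> L2" if "finite F" for F
    using that by (induction F rule: finite_induct) (simp_all add: L2_zero L2_add L2_scale L2_tfs g)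
  have "stft gaussian (\<lambda>t. \<Sum>m\<in>S. ?c m * tfs m g t) z = (\<Sum>m\<in>S. ?c m * stft gaussian (tfs m g) z)"
    unfolding stft_def
    by (subst l2_inner_sum_left)
      (auto simp: l2_inner_scale_left intro: L2_scale L2_tfs g gaussian_L2)
  then have "stft gaussian (\<lambda>t. f t - (\<Sum>m\<in>S. ?c m * tfs m g t)) z
      = stft gaussian f z - (\<Sum>m\<in>S. ?c m * stft gaussian (tfs m g) z)"
    by (simp add: stft_diff f L2_sum S gaussian_L2)
  moreover have "((\<lambda>m. ?c m * stft gaussian (tfs m g) z) has_sum stft gaussian f z) \<Lambda>"
    using tight_frame_inner_has_sum[OF frame f L2_tfs[OF gaussian_L2, of z]]
    by (simp add: stft_def cnj_l2_inner)
  ultimately show ?thesis using S by (auto intro: has_sum_Diff has_sum_finite)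
qed

lemma S0_norm_frame_remainder_le:
  fixes f g :: "'a::euclidean_space \<Rightarrow> complex"
  assumes frame: "tight_gabor_frame \<Lambda> g" and g: "g \<in> S0" and \<Lambda>: "countable \<Lambda>" and f: "f \<in> S0"
    and summable: "(\<lambda>m. cmod (l2_inner f (tfs m g))) summable_on \<Lambda>"
    and S: "finite S" "S \<subseteq> \<Lambda>"
  shows "S0_norm (\<lambda>t. f t - (\<Sum>m\<in>S. l2_inner f (tfs m g) * tfs m g t))
    \<le> (\<Sum>\<^sub>\<infinity>m\<in>\<Lambda> - S. cmod (l2_inner f (tfs m g))) * S0_norm g"
proof -
  define c where "c m = l2_inner f (tfs m g)" for m
  define V where "V m = stft gaussian (tfs m g)" for m
  define r where "r t = f t - (\<Sum>m\<in>S. c m * tfs m g t)" for t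
  have r: "r \<in> S0"
    unfolding r_def by (intro S0_diff S0_sum S0_scale S0_tfs f g S)
  have [measurable]: "V m \<in> borel_measurable borel" for m
    unfolding V_def by (intro stft_gaussian_measurable L2_tfs S0_L2 g)
  have V_norm: "(LBINT\<^sup>+z. ennreal (cmod (V m z))) = ennreal (S0_norm g)" for m
    using ennreal_S0_norm[OF S0_tfs[OF g]] by (simp add: V_def S0_norm_tfs[OF g])
  have "((\<lambda>m. c m * V m z) has_sum stft gaussian r z) (\<Lambda> - S)" for z
    using stft_frame_remainder_has_sum[OF frame S0_L2[OF f] S]
    by (simp add: c_def V_def r_def[abs_def])
  then have "ennreal (cmod (stft gaussian r z))
      \<le> (\<integral>\<^sup>+m. ennreal (cmod (c m * V m z)) \<partial>count_space (\<Lambda> - S))" for z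
    by (rule ennreal_norm_has_sum_le)
  then have "ennreal (S0_norm r)
      \<le> (LBINT\<^sup>+z. (\<integral>\<^sup>+m. ennreal (cmod (c m * V m z)) \<partial>count_space (\<Lambda> - S)))"
    unfolding ennreal_S0_norm[OF r] by (intro nn_integral_mono)
  also have "\<dots> = (\<integral>\<^sup>+m. (LBINT\<^sup>+z. ennreal (cmod (c m * V m z))) \<partial>count_space (\<Lambda> - S))"
    using \<Lambda> by (intro nn_integral_count_space_nn_integral) auto
  also have "\<dots> = (\<integral>\<^sup>+m. ennreal (cmod (c m)) \<partial>count_space (\<Lambda> - S)) * ennreal (S0_norm g)"
    by (simp add: norm_mult ennreal_mult nn_integral_cmult V_norm nn_integral_multc)
  also have "\<dots> = ennreal ((\<Sum>\<^sub>\<infinity>m\<in>\<Lambda> - S. cmod (c m)) * S0_norm g)"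
    using summable_on_subset_banach[OF summable, of "\<Lambda> - S"]
    by (simp add: c_def nn_integral_count_space_eq_infsum ennreal_mult infsum_nonneg S0_norm_nonneg)
  finally show ?thesis
    by (simp add: r_def[abs_def] c_def infsum_nonneg S0_norm_nonneg)
qed

lemma S0_functional_sum:
  fixes F :: "'m \<Rightarrow> 'a::euclidean_space \<Rightarrow> complex"
  assumes add: "\<And>u v. u \<in> S0 \<Longrightarrow> v \<in> S0 \<Longrightarrow> B (\<lambda>t. u t + v t) = B u + B v"
    and scale: "\<And>c u. u \<in> S0 \<Longrightarrow> B (\<lambda>t. c * u t) = (c * B u :: complex)"
    and "finite S" and F: "\<And>m. F m \<in> S0"
  shows "B (\<lambda>t. \<Sum>m\<in>S. c m * F m t) = (\<Sum>m\<in>S. c m * B (F m))"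
  using \<open>finite S\<close>
proof (induction S rule: finite_induct)
  case empty
  then show ?case using scale[OF F, of 0] by simp
next
  case (insert m S)
  then show ?case by (simp add: add scale S0_scale S0_sum F)
qed

lemma frame_expansion_functional:
  fixes f g :: "'a::euclidean_space \<Rightarrow> complex"
  assumes frame: "tight_gabor_frame \<Lambda> g" and g: "g \<in> S0" and \<Lambda>: "countable \<Lambda>" and f: "f \<in> S0"
    and summable: "(\<lambda>m. cmod (l2_inner f (tfs m g))) summable_on \<Lambda>"
    and add: "\<And>u v. u \<in> S0 \<Longrightarrow> v \<in> S0 \<Longrightarrow> B (\<lambda>t. u t + v t) = B u + B v"
    and scale: "\<And>c u. u \<in> S0 \<Longrightarrow> B (\<lambda>t. c * u t) = c * B u"
    and bound: "\<And>u. u \<in> S0 \<Longrightarrow> cmod (B u) \<le> D * S0_norm u"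
  shows "((\<lambda>m. l2_inner f (tfs m g) * B (tfs m g)) has_sum B f) \<Lambda>"
proof -
  define c where "c m = l2_inner f (tfs m g)" for m
  define tail where "tail S = (\<Sum>\<^sub>\<infinity>m\<in>\<Lambda> - S. cmod (c m))" for S
  have sum: "B (\<lambda>t. \<Sum>m\<in>S. c m * tfs m g t) = (\<Sum>m\<in>S. c m * B (tfs m g))" if "finite S" for S
    by (rule S0_functional_sum[OF add scale that S0_tfs[OF g]])
  have diff: "B (\<lambda>t. u t - v t) = B u - B v" if "u \<in> S0" "v \<in> S0" for u v
    using add[OF that(1) S0_scale[OF that(2), of "-1"]] scale[OF that(2), of "-1"] by simp
  have remainder_le: "cmod ((\<Sum>m\<in>S. c m * B (tfs m g)) - B f)
      \<le> \<bar>D\<bar> * S0_norm g * tail S" if S: "finite S" "S \<subseteq> \<Lambda>" for S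
  proof -
    let ?p = "\<lambda>t. \<Sum>m\<in>S. c m * tfs m g t"
    have p: "?p \<in> S0" by (intro S0_sum S0_scale S0_tfs g S)
    have "cmod ((\<Sum>m\<in>S. c m * B (tfs m g)) - B f) = cmod (B (\<lambda>t. f t - ?p t))"
      by (simp add: diff[OF f p] sum[OF S(1)] norm_minus_commute)
    also have "\<dots> \<le> \<bar>D\<bar> * S0_norm (\<lambda>t. f t - ?p t)"
      by (rule order.trans[OF bound[OF S0_diff[OF f p]]]) (simp add: mult_right_mono S0_norm_nonneg)
    also have "\<dots> \<le> \<bar>D\<bar> * (tail S * S0_norm g)"
      unfolding tail_def c_def
      by (intro mult_left_mono S0_norm_frame_remainder_le[OF frame g \<Lambda> f summable S]) simp
    finally show ?thesis by (simp add: mult_ac)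
  qed
  have "(tail \<longlongrightarrow> 0) (finite_subsets_at_top \<Lambda>)"
    unfolding tail_def[abs_def] c_def by (rule infsum_Diff_tendsto_0[OF summable])
  then have "((\<lambda>S. \<bar>D\<bar> * S0_norm g * tail S) \<longlongrightarrow> 0) (finite_subsets_at_top \<Lambda>)"
    using tendsto_mult_right_zero by blast
  then have "((\<lambda>S. (\<Sum>m\<in>S. c m * B (tfs m g)) - B f) \<longlongrightarrow> 0) (finite_subsets_at_top \<Lambda>)"
    by (rule Lim_null_comparison[rotated])
      (rule eventually_finite_subsets_at_top_weakI, rule remainder_le)
  then show ?thesis
    unfolding has_sum_def c_def by (rule LIM_zero_cancel)
qed

section \<open>Solid sequence spaces and convolution algebras\<close>

locale add_subgroup =
  fixes \<Lambda> :: "'b::ab_group_add set"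
  assumes zero_mem: "0 \<in> \<Lambda>"
    and add_mem: "x \<in> \<Lambda> \<Longrightarrow> y \<in> \<Lambda> \<Longrightarrow> x + y \<in> \<Lambda>"
    and uminus_mem: "x \<in> \<Lambda> \<Longrightarrow> - x \<in> \<Lambda>"
begin

lemma diff_mem: "x \<in> \<Lambda> \<Longrightarrow> y \<in> \<Lambda> \<Longrightarrow> x - y \<in> \<Lambda>"
  using add_mem[OF _ uminus_mem, of x y] by simp

lemma bij_betw_minus: "x \<in> \<Lambda> \<Longrightarrow> bij_betw (\<lambda>k. x - k) \<Lambda> \<Lambda>"
  by (rule bij_betw_byWitness[of _ "\<lambda>k. x - k"]) (auto intro: diff_mem)

lemma sum_mset_mem: "set_mset M \<subseteq> \<Lambda> \<Longrightarrow> sum_mset M \<in> \<Lambda>"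
  by (induction M) (auto intro: zero_mem add_mem)

end

locale solid_seq_space =
  fixes \<Lambda> :: "'b set" and X :: "('b \<Rightarrow> complex) set" and n :: "('b \<Rightarrow> complex) \<Rightarrow> real"
  assumes banach: "banach_seq_space \<Lambda> X n" and solid: "solid \<Lambda> X n"
begin

lemma eq_0_outside: "a \<in> X \<Longrightarrow> x \<notin> \<Lambda> \<Longrightarrow> a x = 0"
  using banach unfolding banach_seq_space_def by blast

lemma norm_nonneg: "a \<in> X \<Longrightarrow> 0 \<le> n a"
  using banach unfolding banach_seq_space_def by blast

lemma norm_eq_0_iff: "a \<in> X \<Longrightarrow> n a = 0 \<longleftrightarrow> a = (\<lambda>_. 0)"
  using banach unfolding banach_seq_space_def by blast

lemma scale_mem: "a \<in> X \<Longrightarrow> (\<lambda>x. c * a x) \<in> X"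
  using banach unfolding banach_seq_space_def by blast

lemma norm_scale: "a \<in> X \<Longrightarrow> n (\<lambda>x. c * a x) = cmod c * n a"
  using banach unfolding banach_seq_space_def by blast

lemma plus_mem: "a \<in> X \<Longrightarrow> b \<in> X \<Longrightarrow> (\<lambda>x. a x + b x) \<in> X"
  using banach unfolding banach_seq_space_def by blast

lemma minus_mem: "a \<in> X \<Longrightarrow> b \<in> X \<Longrightarrow> (\<lambda>x. a x - b x) \<in> X"
  using plus_mem[of a "\<lambda>x. - 1 * b x"] scale_mem[of b "- 1"] by simp

lemma norm_minus_commute: "a \<in> X \<Longrightarrow> b \<in> X \<Longrightarrow> n (\<lambda>x. a x - b x) = n (\<lambda>x. b x - a x)"
  using norm_scale[OF minus_mem, of a b "- 1"] by simp

lemma solid_mem: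
  "b \<in> X \<Longrightarrow> (\<And>x. x \<notin> \<Lambda> \<Longrightarrow> a x = 0) \<Longrightarrow> (\<And>x. cmod (a x) \<le> cmod (b x)) \<Longrightarrow> a \<in> X"
  using solid unfolding solid_def by blast

lemma norm_mono:
  "b \<in> X \<Longrightarrow> (\<And>x. x \<notin> \<Lambda> \<Longrightarrow> a x = 0) \<Longrightarrow> (\<And>x. cmod (a x) \<le> cmod (b x)) \<Longrightarrow> n a \<le> n b"
  using solid unfolding solid_def by blast

lemma cmod_mem: "a \<in> X \<Longrightarrow> (\<lambda>x. complex_of_real (cmod (a x))) \<in> X"
  by (rule solid_mem) (auto simp: eq_0_outside)

lemma norm_cmod_le: "a \<in> X \<Longrightarrow> n (\<lambda>x. complex_of_real (cmod (a x))) \<le> n a"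
  by (rule norm_mono) (auto simp: eq_0_outside)

end

lemma conv_finite_left:
  assumes F: "finite F" "F \<subseteq> \<Lambda>" and a: "\<And>x. x \<notin> F \<Longrightarrow> a x = 0" and x: "x \<in> \<Lambda>"
  shows "conv \<Lambda> a c x = (\<Sum>\<mu>\<in>F. a \<mu> * c (x - \<mu>))"
proof -
  have "(\<Sum>\<^sub>\<infinity>\<mu>\<in>\<Lambda>. a \<mu> * c (x - \<mu>)) = (\<Sum>\<^sub>\<infinity>\<mu>\<in>F. a \<mu> * c (x - \<mu>))"
    using F by (intro infsum_cong_neutral) (auto simp: a)
  then show ?thesis using F x by (simp add: conv_def)
qed

locale solid_conv_algebra = add_subgroup \<Lambda>
  for \<Lambda> :: "'b::ab_group_add set" +
  fixes A :: "('b \<Rightarrow> complex) set" and n :: "('b \<Rightarrow> complex) \<Rightarrow> real"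
  assumes algebra: "solid_inv_conv_alg \<Lambda> A n"
begin

sublocale solid_seq_space \<Lambda> A n
  using algebra by unfold_locales (auto simp: solid_inv_conv_alg_def)

lemma conv_mem: "a \<in> A \<Longrightarrow> b \<in> A \<Longrightarrow> conv \<Lambda> a b \<in> A"
  using algebra unfolding solid_inv_conv_alg_def by blast

lemma norm_conv_le: "a \<in> A \<Longrightarrow> b \<in> A \<Longrightarrow> n (conv \<Lambda> a b) \<le> n a * n b"
  using algebra unfolding solid_inv_conv_alg_def by blast

lemma norm_invol_le: "a \<in> A \<Longrightarrow> n (invol a) \<le> n a"
  using algebra unfolding solid_inv_conv_alg_def by blast

lemma delta_mem: "l \<in> \<Lambda> \<Longrightarrow> delta l \<in> A"
  using algebra unfolding solid_inv_conv_alg_def by blast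

lemma conv_delta:
  assumes "l \<in> \<Lambda>" "m \<in> \<Lambda>"
  shows "conv \<Lambda> (delta l) (delta m) = delta (l + m)"
proof (rule ext)
  fix x
  show "conv \<Lambda> (delta l) (delta m) x = delta (l + m) x"
  proof (cases "x \<in> \<Lambda>")
    case True
    then have "conv \<Lambda> (delta l) (delta m) x = (\<Sum>\<mu>\<in>{l}. delta l \<mu> * delta m (x - \<mu>))"
      using assms by (intro conv_finite_left) (auto simp: delta_def)
    then show ?thesis by (auto simp: delta_def algebra_simps)
  next
    case False
    then have "x \<noteq> l + m" using add_mem assms by blast
    then show ?thesis using False by (simp add: conv_def delta_def)
  qed
qed

lemma norm_delta_ge_1:
  assumes l: "l \<in> \<Lambda>" shows "1 \<le> n (delta l)"
proof -
  have "delta 0 \<noteq> (\<lambda>_::'b. 0)" by (auto simp: delta_def fun_eq_iff)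
  then have "0 < n (delta 0)"
    using norm_eq_0_iff[OF delta_mem[OF zero_mem]] norm_nonneg[OF delta_mem[OF zero_mem]] by auto
  moreover have "n (delta 0) \<le> n (delta 0) * n (delta 0)"
    using norm_conv_le[OF delta_mem delta_mem, OF zero_mem zero_mem]
    by (simp add: conv_delta zero_mem)
  ultimately have "1 \<le> n (delta 0)" by simp
  also have "\<dots> \<le> n (delta l) * n (delta (- l))"
    using norm_conv_le[OF delta_mem delta_mem, OF l uminus_mem[OF l]]
    by (simp add: conv_delta l uminus_mem)
  also have "\<dots> \<le> n (delta l) * n (delta l)"
  proof (intro mult_left_mono norm_nonneg delta_mem l)
    have "invol (delta l) = delta (- l)"
      by (auto simp: invol_def delta_def fun_eq_iff)
    then show "n (delta (- l)) \<le> n (delta l)"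
      using norm_invol_le[OF delta_mem[OF l]] by simp
  qed
  finally have "1 \<le> (n (delta l))\<^sup>2" by (simp add: power2_eq_square)
  then show ?thesis using norm_nonneg[OF delta_mem[OF l]] by (simp add: power2_nonneg_ge_1_iff)
qed

lemma cmod_le_norm:
  assumes a: "a \<in> A" shows "cmod (a x) \<le> n a"
proof (cases "x \<in> \<Lambda>")
  case True
  have "cmod (a x) * 1 \<le> cmod (a x) * n (delta x)"
    by (intro mult_left_mono norm_delta_ge_1 True) simp
  also have "\<dots> = n (\<lambda>y. a x * delta x y)"
    by (rule norm_scale[symmetric, OF delta_mem[OF True]])
  also have "\<dots> \<le> n a"
    using True by (intro norm_mono[OF a]) (auto simp: delta_def)
  finally show ?thesis by simp
qed (simp add: eq_0_outside a norm_nonneg)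

end

subsection \<open>Solid convolution algebras are contained in \<open>\<ell>\<^sup>1\<close>\<close>

definition iterated_sumset :: "'b::comm_monoid_add set \<Rightarrow> nat \<Rightarrow> 'b set" where
  "iterated_sumset F k = sum_mset ` multisets_of_size F k"

lemma finite_iterated_sumset: "finite F \<Longrightarrow> finite (iterated_sumset F k)"
  by (auto simp: iterated_sumset_def)

lemma card_multisets_of_size_le:
  assumes F: "finite F"
  shows "card (multisets_of_size F k) \<le> Suc k ^ card F"
proof -
  have "inj_on (\<lambda>M. restrict (count M) F) (multisets_of_size F k)"
  proof (rule inj_onI, rule multiset_eqI)
    fix M N x
    assume M: "M \<in> multisets_of_size F k" and N: "N \<in> multisets_of_size F k"
      and same_counts: "restrict (count M) F = restrict (count N) F"
    show "count M x = count N x"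
    proof (cases "x \<in> F")
      case True
      then show ?thesis using fun_cong[OF same_counts, of x] by simp
    next
      case False
      then have "x \<notin># M" "x \<notin># N" using M N by (auto simp: multisets_of_size_def)
      then show ?thesis by (simp add: not_in_iff)
    qed
  qed
  moreover have "(\<lambda>M. restrict (count M) F) ` multisets_of_size F k \<subseteq> F \<rightarrow>\<^sub>E {..k}"
    using count_le_size by (auto simp: multisets_of_size_def)
  ultimately have "card (multisets_of_size F k) \<le> card (F \<rightarrow>\<^sub>E {..k})"
    using F by (intro card_inj_on_le finite_PiE) auto
  then show ?thesis using F by (simp add: card_PiE)
qed

lemma card_iterated_sumset_le: "finite F \<Longrightarrow> card (iterated_sumset F k) \<le> Suc k ^ card F"
  unfolding iterated_sumset_def
  by (rule order.trans[OF card_image_le card_multisets_of_size_le]) auto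

lemma iterated_sumset_Suc:
  "\<mu> \<in> F \<Longrightarrow> y \<in> iterated_sumset F k \<Longrightarrow> \<mu> + y \<in> iterated_sumset F (Suc k)"
proof -
  assume "\<mu> \<in> F" "y \<in> iterated_sumset F k"
  then obtain M where "M \<in> multisets_of_size F k" "y = sum_mset M"
    by (auto simp: iterated_sumset_def)
  then show ?thesis
    unfolding iterated_sumset_def using \<open>\<mu> \<in> F\<close>
    by (intro image_eqI[of _ _ "add_mset \<mu> M"]) (auto simp: multisets_of_size_def)
qed

lemma (in add_subgroup) iterated_sumset_subset: "F \<subseteq> \<Lambda> \<Longrightarrow> iterated_sumset F k \<subseteq> \<Lambda>"
  by (auto simp: iterated_sumset_def multisets_of_size_def intro: sum_mset_mem)

lemma le_of_power_le_polynomial_power: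
  fixes s r C :: real
  assumes s: "0 \<le> s" and r: "0 \<le> r" and C: "0 < C"
    and power_le: "\<And>k. s ^ k \<le> C * real (Suc k) ^ N * r ^ k"
  shows "s \<le> r"
proof (rule LIMSEQ_le_const)
  have "(\<lambda>k. root k (C * 2 ^ N) * root k (real k) ^ N * r) \<longlonglongrightarrow> 1 * 1 ^ N * r"
    using C by (intro tendsto_intros LIMSEQ_root LIMSEQ_root_const) simp
  then show "(\<lambda>k. root k (C * 2 ^ N) * root k (real k) ^ N * r) \<longlonglongrightarrow> r" by simp
  have "s \<le> root k (C * 2 ^ N) * root k (real k) ^ N * r" if k: "k \<ge> 1" for k
  proof -
    have "s ^ k \<le> C * real (Suc k) ^ N * r ^ k" by (rule power_le)
    also have "\<dots> \<le> C * (2 * real k) ^ N * r ^ k"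
      using k C r by (intro mult_right_mono mult_left_mono power_mono) auto
    finally have "root k (s ^ k) \<le> root k (C * 2 ^ N * real k ^ N * r ^ k)"
      using k by (simp add: power_mult_distrib mult.assoc)
    then show ?thesis
      using k s r by (simp add: real_root_mult real_root_power real_root_power_cancel)
  qed
  then show "\<exists>K. \<forall>k\<ge>K. s \<le> root k (C * 2 ^ N) * root k (real k) ^ N * r" by blast
qed

context solid_conv_algebra
begin

abbreviation conv_power :: "('b \<Rightarrow> complex) \<Rightarrow> nat \<Rightarrow> 'b \<Rightarrow> complex" where
  "conv_power a k \<equiv> (conv \<Lambda> a ^^ k) (delta 0)"

lemma conv_power_mem: "a \<in> A \<Longrightarrow> conv_power a k \<in> A"
  by (induction k) (simp_all add: delta_mem zero_mem conv_mem)

lemma norm_conv_power_le: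
  assumes a: "a \<in> A"
  shows "n (conv_power a k) \<le> n a ^ k * n (delta 0)"
proof (induction k)
  case (Suc k)
  have "n (conv_power a (Suc k)) \<le> n a * n (conv_power a k)"
    using norm_conv_le[OF a conv_power_mem[OF a]] by simp
  also have "\<dots> \<le> n a * (n a ^ k * n (delta 0))"
    by (intro mult_left_mono Suc norm_nonneg a)
  finally show ?case by (simp add: mult.assoc)
qed simp

context
  fixes a :: "'b \<Rightarrow> complex" and F
  assumes F: "finite F" "F \<subseteq> \<Lambda>" and support: "\<And>x. x \<notin> F \<Longrightarrow> a x = 0"
begin

lemma conv_power_eq_0:
  "x \<notin> iterated_sumset F k \<Longrightarrow> conv_power a k x = 0"
proof (induction k arbitrary: x)
  case 0
  then show ?case by (simp add: iterated_sumset_def delta_def)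
next
  case (Suc k)
  show ?case
  proof (cases "x \<in> \<Lambda>")
    case True
    have "conv_power a k (x - \<mu>) = 0" if "\<mu> \<in> F" for \<mu>
      using Suc iterated_sumset_Suc[OF that, of "x - \<mu>" k] by auto
    then show ?thesis
      using conv_finite_left[OF F support True] by simp
  qed (simp add: conv_def)
qed

lemma sum_conv_power:
  "(\<Sum>x\<in>iterated_sumset F k. conv_power a k x) = (\<Sum>x\<in>F. a x) ^ k"
proof (induction k)
  case 0
  then show ?case by (simp add: iterated_sumset_def delta_def)
next
  case (Suc k)
  let ?S = "iterated_sumset F" and ?b = "conv_power a k"
  have translate: "(\<Sum>x\<in>?S (Suc k). ?b (x - \<mu>)) = (\<Sum>y\<in>?S k. ?b y)" if \<mu>: "\<mu> \<in> F" for \<mu>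
  proof -
    have "(\<Sum>y\<in>?S k. ?b y) = (\<Sum>x\<in>(+) \<mu> ` ?S k. ?b (x - \<mu>))"
      by (simp add: sum.reindex)
    also have "\<dots> = (\<Sum>x\<in>?S (Suc k). ?b (x - \<mu>))"
    proof (rule sum.mono_neutral_left)
      show "\<forall>x\<in>?S (Suc k) - (+) \<mu> ` ?S k. ?b (x - \<mu>) = 0"
        by (auto intro!: conv_power_eq_0) (metis add.commute diff_add_cancel image_eqI)
    qed (use \<mu> F in \<open>auto intro: finite_iterated_sumset iterated_sumset_Suc\<close>)
    finally show ?thesis ..
  qed
  have "(\<Sum>x\<in>?S (Suc k). conv_power a (Suc k) x) = (\<Sum>x\<in>?S (Suc k). \<Sum>\<mu>\<in>F. a \<mu> * ?b (x - \<mu>))"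
    using iterated_sumset_subset[OF F(2), of "Suc k"]
    by (intro sum.cong) (auto simp: conv_finite_left[OF F support])
  also have "\<dots> = (\<Sum>\<mu>\<in>F. a \<mu> * (\<Sum>x\<in>?S (Suc k). ?b (x - \<mu>)))"
    unfolding sum_distrib_left by (rule sum.swap)
  finally show ?case
    by (simp add: translate Suc flip: sum_distrib_right)
qed

text \<open>The \<open>k\<close>-th convolution power has total mass \<open>(\<Sum>a)\<^sup>k\<close>, but is supported on polynomially many
  points at each of which it is at most \<open>n a ^ k\<close> up to a constant.\<close>
lemma cmod_sum_le_norm:
  assumes a: "a \<in> A"
  shows "cmod (\<Sum>x\<in>F. a x) \<le> n a"
proof (rule le_of_power_le_polynomial_power)
  show "0 < n (delta 0)" using norm_delta_ge_1[OF zero_mem] by simp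
  show "cmod (\<Sum>x\<in>F. a x) ^ k \<le> n (delta 0) * real (Suc k) ^ card F * n a ^ k" for k
  proof -
    have "cmod (\<Sum>x\<in>F. a x) ^ k = cmod (\<Sum>x\<in>iterated_sumset F k. conv_power a k x)"
      by (simp add: sum_conv_power norm_power)
    also have "\<dots> \<le> (\<Sum>x\<in>iterated_sumset F k. n a ^ k * n (delta 0))"
      by (rule sum_norm_le)
        (rule order.trans[OF cmod_le_norm[OF conv_power_mem[OF a]] norm_conv_power_le[OF a]])
    also have "\<dots> = real (card (iterated_sumset F k)) * (n a ^ k * n (delta 0))"
      by simp
    also have "\<dots> \<le> real (Suc k ^ card F) * (n a ^ k * n (delta 0))"
      using card_iterated_sumset_le[OF F(1), of k]
      by (intro mult_right_mono mult_nonneg_nonneg zero_le_power norm_nonneg a delta_mem zero_mem)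
        (simp only: of_nat_le_iff)
    finally show ?thesis by (simp add: mult_ac)
  qed
qed (simp_all add: norm_nonneg a)

end

lemma sum_cmod_le_norm:
  assumes a: "a \<in> A" and F: "finite F" "F \<subseteq> \<Lambda>"
  shows "(\<Sum>x\<in>F. cmod (a x)) \<le> n a"
proof -
  let ?r = "\<lambda>x. complex_of_real (if x \<in> F then cmod (a x) else 0)"
  have "?r \<in> A" and "n ?r \<le> n a"
    using F by (auto intro!: solid_mem[OF a] norm_mono[OF a])
  then have "cmod (\<Sum>x\<in>F. ?r x) \<le> n a"
    using cmod_sum_le_norm[of F ?r] F by fastforce
  moreover have "(\<Sum>x\<in>F. ?r x) = complex_of_real (\<Sum>x\<in>F. cmod (a x))"
    by simp
  ultimately show ?thesis
    by (simp only: norm_of_real abs_of_nonneg[OF sum_nonneg] norm_ge_zero)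
qed

lemma abs_summable:
  assumes a: "a \<in> A" shows "(\<lambda>x. cmod (a x)) summable_on \<Lambda>"
  by (rule nonneg_bdd_above_summable_on)
    (use sum_cmod_le_norm[OF a] in \<open>auto intro!: bdd_aboveI[of _ "n a"]\<close>)

end

section \<open>Kernels with convolution-dominated off-diagonal decay\<close>

definition conv_dominated
  :: "'b::ab_group_add set \<Rightarrow> ('b \<Rightarrow> 'b \<Rightarrow> complex) \<Rightarrow> ('b \<Rightarrow> complex) \<Rightarrow> bool" where
  "conv_dominated \<Lambda> K a \<longleftrightarrow> (\<forall>l\<in>\<Lambda>. \<forall>k\<in>\<Lambda>. cmod (K l k) \<le> cmod (a (l - k)))"

lemma (in add_subgroup) conv_dominated_diagonal_le:
  assumes "conv_dominated \<Lambda> K a" and "l \<in> \<Lambda>" "\<mu> \<in> \<Lambda>"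
  shows "cmod (K l (l - \<mu>)) \<le> cmod (a \<mu>)"
proof -
  have "l - \<mu> \<in> \<Lambda>" using assms by (intro diff_mem)
  then have "cmod (K l (l - \<mu>)) \<le> cmod (a (l - (l - \<mu>)))"
    using assms unfolding conv_dominated_def by blast
  then show ?thesis by simp
qed

definition kernel_op :: "'b set \<Rightarrow> ('b \<Rightarrow> 'b \<Rightarrow> complex) \<Rightarrow> ('b \<Rightarrow> complex) \<Rightarrow> 'b \<Rightarrow> complex" where
  "kernel_op \<Lambda> K y l = (if l \<in> \<Lambda> then (\<Sum>\<^sub>\<infinity>k\<in>\<Lambda>. K l k * y k) else 0)"

locale solid_conv_module = solid_conv_algebra \<Lambda> A nA + module: solid_seq_space \<Lambda> Y nY
  for \<Lambda> :: "'b::ab_group_add set" and A nA Y nY +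
  assumes conv_ok: "a \<in> A \<Longrightarrow> c \<in> Y \<Longrightarrow> conv_ok \<Lambda> a c"
    and conv_module_mem: "a \<in> A \<Longrightarrow> c \<in> Y \<Longrightarrow> conv \<Lambda> a c \<in> Y"
    and norm_conv_module_le: "a \<in> A \<Longrightarrow> c \<in> Y \<Longrightarrow> nY (conv \<Lambda> a c) \<le> nA a * nY c"
begin

lemma cmod_conv_has_sum:
  assumes a: "a \<in> A" and y: "y \<in> Y" and l: "l \<in> \<Lambda>"
  shows "((\<lambda>k. cmod (a (l - k)) * cmod (y k)) has_sum
    cmod (conv \<Lambda> (\<lambda>x. complex_of_real (cmod (a x))) (\<lambda>x. complex_of_real (cmod (y x))) l)) \<Lambda>"
proof -
  let ?a = "\<lambda>x. complex_of_real (cmod (a x))" and ?y = "\<lambda>x. complex_of_real (cmod (y x))"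
  have "(\<lambda>\<mu>. ?a \<mu> * ?y (l - \<mu>)) summable_on \<Lambda>"
    using conv_ok[OF cmod_mem[OF a] module.cmod_mem[OF y]] l by (simp add: conv_ok_def)
  then have "((\<lambda>\<mu>. ?a \<mu> * ?y (l - \<mu>)) has_sum conv \<Lambda> ?a ?y l) \<Lambda>"
    using l by (simp add: conv_def)
  then have "((\<lambda>k. ?a (l - k) * ?y k) has_sum conv \<Lambda> ?a ?y l) \<Lambda>"
    using has_sum_reindex_bij_betw[OF bij_betw_minus[OF l], of "\<lambda>\<mu>. ?a \<mu> * ?y (l - \<mu>)"] by simp
  then have complex: "((\<lambda>k. complex_of_real (cmod (a (l - k)) * cmod (y k)))
      has_sum conv \<Lambda> ?a ?y l) \<Lambda>"
    by simp
  have summable: "(\<lambda>k. cmod (a (l - k)) * cmod (y k)) summable_on \<Lambda>"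
    using has_sum_imp_summable[OF complex] unfolding summable_on_iff_abs_summable_on_complex
    by (simp add: norm_mult)
  have "conv \<Lambda> ?a ?y l = complex_of_real (\<Sum>\<^sub>\<infinity>k\<in>\<Lambda>. cmod (a (l - k)) * cmod (y k))"
    by (rule has_sum_unique[OF complex has_sum_of_real[OF has_sum_infsum[OF summable]]])
  then have "cmod (conv \<Lambda> ?a ?y l) = (\<Sum>\<^sub>\<infinity>k\<in>\<Lambda>. cmod (a (l - k)) * cmod (y k))"
    by (simp only: norm_of_real) (simp add: infsum_nonneg)
  then show ?thesis using has_sum_infsum[OF summable] by simp
qed

lemma kernel_summable:
  assumes a: "a \<in> A" and y: "y \<in> Y" and K: "conv_dominated \<Lambda> K a" and l: "l \<in> \<Lambda>"
  shows "(\<lambda>k. cmod (K l k * y k)) summable_on \<Lambda>"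
proof (rule summable_on_comparison_test[OF has_sum_imp_summable[OF cmod_conv_has_sum[OF a y l]]])
  show "cmod (K l k * y k) \<le> cmod (a (l - k)) * cmod (y k)" if "k \<in> \<Lambda>" for k
    using K l that by (simp add: conv_dominated_def norm_mult mult_right_mono)
qed simp

lemma cmod_kernel_op_le:
  assumes a: "a \<in> A" and y: "y \<in> Y" and K: "conv_dominated \<Lambda> K a"
  shows "cmod (kernel_op \<Lambda> K y l)
    \<le> cmod (conv \<Lambda> (\<lambda>x. complex_of_real (cmod (a x))) (\<lambda>x. complex_of_real (cmod (y x))) l)"
proof (cases "l \<in> \<Lambda>")
  case l: True
  have "cmod (kernel_op \<Lambda> K y l) \<le> (\<Sum>\<^sub>\<infinity>k\<in>\<Lambda>. cmod (K l k * y k))"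
    using l norm_infsum_bound[OF kernel_summable[OF a y K l]] by (simp add: kernel_op_def)
  also have "\<dots> \<le> cmod (conv \<Lambda> (\<lambda>x. complex_of_real (cmod (a x)))
      (\<lambda>x. complex_of_real (cmod (y x))) l)"
  proof (rule has_sum_mono[OF has_sum_infsum[OF kernel_summable[OF a y K l]]
    cmod_conv_has_sum[OF a y l]])
    show "cmod (K l k * y k) \<le> cmod (a (l - k)) * cmod (y k)" if "k \<in> \<Lambda>" for k
      using K l that by (simp add: conv_dominated_def norm_mult mult_right_mono)
  qed
  finally show ?thesis .
qed (simp add: kernel_op_def)

lemma kernel_op_mem:
  assumes "a \<in> A" "y \<in> Y" "conv_dominated \<Lambda> K a"
  shows "kernel_op \<Lambda> K y \<in> Y"
  by (rule module.solid_mem[OF conv_module_mem[OF cmod_mem module.cmod_mem] _ cmod_kernel_op_le])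
     (use assms in \<open>auto simp: kernel_op_def\<close>)

lemma norm_kernel_op_le:
  assumes a: "a \<in> A" and y: "y \<in> Y" and K: "conv_dominated \<Lambda> K a"
  shows "nY (kernel_op \<Lambda> K y) \<le> nA a * nY y"
proof -
  let ?a = "\<lambda>x. complex_of_real (cmod (a x))" and ?y = "\<lambda>x. complex_of_real (cmod (y x))"
  note mem = cmod_mem[OF a] module.cmod_mem[OF y]
  have "nY (kernel_op \<Lambda> K y) \<le> nY (conv \<Lambda> ?a ?y)"
    by (rule module.norm_mono[OF conv_module_mem[OF mem] _ cmod_kernel_op_le[OF a y K]])
      (simp add: kernel_op_def)
  also have "\<dots> \<le> nA ?a * nY ?y"
    by (rule norm_conv_module_le[OF mem])
  also have "\<dots> \<le> nA a * nY y"
    by (intro mult_mono norm_cmod_le module.norm_cmod_le norm_nonneg module.norm_nonneg a y mem)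
  finally show ?thesis .
qed

lemma kernel_op_minus:
  assumes a: "a \<in> A" and y: "y \<in> Y" and z: "z \<in> Y" and K: "conv_dominated \<Lambda> K a"
  shows "kernel_op \<Lambda> K (\<lambda>k. y k - z k) l = kernel_op \<Lambda> K y l - kernel_op \<Lambda> K z l"
proof (cases "l \<in> \<Lambda>")
  case l: True
  have "(\<lambda>k. K l k * y k) summable_on \<Lambda>" "(\<lambda>k. K l k * z k) summable_on \<Lambda>"
    using kernel_summable[OF a y K l] kernel_summable[OF a z K l]
    by (simp_all add: summable_on_iff_abs_summable_on_complex)
  from has_sum_add[OF has_sum_infsum[OF this(1)] has_sum_uminusI[OF has_sum_infsum[OF this(2)]]]
  show ?thesis
    using l by (simp add: kernel_op_def right_diff_distrib infsumI)
qed (simp add: kernel_op_def)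

end

lemma (in solid_conv_algebra) solid_conv_module_self: "solid_conv_module \<Lambda> A n A n"
  using algebra by unfold_locales (auto simp: solid_inv_conv_alg_def)

lemma (in solid_conv_algebra) finite_support_mem:
  assumes "finite {x. b x \<noteq> 0}" "{x. b x \<noteq> 0} \<subseteq> \<Lambda>"
  shows "b \<in> A"
proof -
  have "(\<lambda>x. \<Sum>l\<in>S. b l * delta l x) \<in> A" if "finite S" "S \<subseteq> \<Lambda>" for S
    using that
  proof (induction S rule: finite_induct)
    case empty
    then show ?case using scale_mem[OF delta_mem[OF zero_mem], of 0] by simp
  qed (simp add: plus_mem scale_mem delta_mem)
  moreover have "(\<Sum>l | b l \<noteq> 0. b l * delta l x) = b x" for x
    using assms(1) by (simp add: delta_def if_distrib if_distribR sum.delta' cong: if_cong)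
  ultimately show ?thesis using assms by fastforce
qed

section \<open>Lattices and Wiener amalgam spaces\<close>

lemma add_subgroup_lat:
  assumes T: "linear T"
  shows "add_subgroup (lat T)"
proof
  show "0 \<in> lat T"
    unfolding lat_def by (rule image_eqI[of _ _ 0]) (auto simp: linear_0[OF T])
next
  fix x y assume "x \<in> lat T" "y \<in> lat T"
  then obtain u v where "x = T u" "y = T v" "\<forall>i\<in>Basis. u \<bullet> i \<in> \<int>" "\<forall>i\<in>Basis. v \<bullet> i \<in> \<int>"
    by (auto simp: lat_def)
  then show "x + y \<in> lat T" unfolding lat_def
    by (intro image_eqI[of _ _ "u + v"]) (auto simp: linear_add[OF T] inner_add_left)
next
  fix x assume "x \<in> lat T"
  then obtain u where "x = T u" "\<forall>i\<in>Basis. u \<bullet> i \<in> \<int>" by (auto simp: lat_def)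
  then show "- x \<in> lat T" unfolding lat_def
    by (intro image_eqI[of _ _ "- u"]) (auto simp: linear_neg[OF T])
qed

lemma countable_lat: "countable (lat (T :: 'b::euclidean_space \<Rightarrow> 'b))"
proof -
  let ?Z = "{x::'b. \<forall>i\<in>Basis. x \<bullet> i \<in> \<int>}" and ?coords = "\<lambda>x::'b. restrict (\<lambda>i. x \<bullet> i) Basis"
  have "countable (Basis \<rightarrow>\<^sub>E (\<int> :: real set) :: ('b \<Rightarrow> real) set)"
    by (intro countable_PiE) (auto simp: countable_int Ints_def)
  then have "countable (?coords ` ?Z)"
    by (rule countable_subset[rotated]) auto
  moreover have "inj_on ?coords ?Z"
  proof (rule inj_onI, rule euclidean_eqI)
    fix x y i :: 'b assume "?coords x = ?coords y" and i: "i \<in> Basis"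
    then have "?coords x i = ?coords y i" by (simp only:)
    then show "x \<bullet> i = y \<bullet> i" using i by simp
  qed
  ultimately have "countable ?Z" by (rule countable_image_inj_on)
  then show ?thesis unfolding lat_def by (rule countable_image)
qed

lemma lat_fund_cover:
  fixes T :: "'b::euclidean_space \<Rightarrow> 'b"
  assumes T: "linear T" "bij T"
  shows "\<exists>l\<in>lat T. z \<in> (+) l ` fund T"
proof -
  obtain x where x: "z = T x" using T(2) by (metis bij_pointE)
  define y where "y = (\<Sum>i\<in>Basis. of_int \<lfloor>x \<bullet> i\<rfloor> *\<^sub>R i)"
  have y: "y \<bullet> i = of_int \<lfloor>x \<bullet> i\<rfloor>" if "i \<in> Basis" for i using that by (simp add: y_def)
  have "T y \<in> lat T" unfolding lat_def using y by auto
  moreover have "T (x - y) \<in> fund T"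
    unfolding fund_def using y by (intro imageI) (auto simp: inner_diff_left, linarith+)
  moreover have "z = T y + T (x - y)" by (simp add: x linear_diff[OF T(1)])
  ultimately show ?thesis by blast
qed

lemma fund_measurable:
  fixes T :: "'b::euclidean_space \<Rightarrow> 'b"
  assumes T: "linear T" "bij T"
  shows "fund T \<in> sets borel"
proof -
  obtain T' where T': "linear T'" "\<And>x. T' (T x) = x" "\<And>x. T (T' x) = x"
    using linear_injective_isomorphism[OF T(1) bij_is_inj[OF T(2)]] by blast
  have [measurable]: "T' \<in> borel_measurable borel"
    using T'(1) by (intro borel_measurable_continuous_onI linear_continuous_on)
      (simp add: linear_conv_bounded_linear)
  have "fund T = {z \<in> space borel. \<forall>i\<in>Basis. 0 \<le> T' z \<bullet> i \<and> T' z \<bullet> i < 1}"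
    unfolding fund_def using T' by (auto simp: image_iff) metis
  also have "\<dots> \<in> sets borel" by measurable
  finally show ?thesis .
qed

lemma bounded_fund:
  assumes T: "linear T"
  shows "bounded (fund T)"
proof (rule bounded_subset)
  show "bounded (T ` cbox 0 One)"
    using T by (intro bounded_linear_image bounded_cbox) (simp add: linear_conv_bounded_linear)
  show "fund T \<subseteq> T ` cbox 0 One"
    unfolding fund_def by (intro image_mono) (auto simp: mem_box less_imp_le)
qed

lemma translation_vimage: "(+) l ` S = (+) (- l) -` (S :: 'b::ab_group_add set)"
  by (auto simp: image_iff) (metis add.commute add_diff_cancel diff_add_cancel uminus_add_conv_diff)

lemma translation_measurable:
  fixes S :: "'b::euclidean_space set"
  assumes "S \<in> sets borel"
  shows "(+) l ` S \<in> sets borel"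
  unfolding translation_vimage using measurable_sets[of "(+) (- l)" borel borel S] assms by simp

lemma emeasure_lborel_translation:
  fixes S :: "'b::euclidean_space set"
  assumes "S \<in> sets borel"
  shows "emeasure lborel ((+) l ` S) = emeasure lborel S"
proof -
  have "emeasure lborel S = emeasure (distr lborel borel ((+) (- l))) S"
    by (simp add: lborel_distr_plus)
  also have "\<dots> = emeasure lborel ((+) l ` S)"
    using assms by (simp add: emeasure_distr translation_vimage)
  finally show ?thesis ..
qed

subsection \<open>Essential suprema\<close>

lemma open_AE_notin_imp_empty:
  fixes V :: "'b::euclidean_space set"
  assumes "open V" "AE x in lborel. x \<notin> V"
  shows "V = {}"
proof (rule ccontr)
  assume "V \<noteq> {}"
  have "V \<in> null_sets lborel" using assms by (subst AE_iff_null_sets) auto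
  then have "negligible V" by (simp add: negligible_iff_null_sets null_sets_completionI)
  then show False using open_not_negligible[OF assms(1) \<open>V \<noteq> {}\<close>] by blast
qed

lemma le_esssup:
  assumes "\<not> (AE x in M. x \<notin> V)" and s: "\<And>x. x \<in> V \<Longrightarrow> s \<le> F x"
  shows "s \<le> esssup M F"
proof (rule ccontr)
  assume not_le: "\<not> s \<le> esssup M F"
  have "AE x in M. x \<notin> V"
    using esssup_AE[of F M] by eventually_elim (use s not_le order.trans in blast)
  with assms(1) show False ..
qed

lemma le_esssup_lborel:
  fixes F :: "'b::euclidean_space \<Rightarrow> ereal"
  assumes "open V" "V \<noteq> {}" "\<And>x. x \<in> V \<Longrightarrow> s \<le> F x"
  shows "s \<le> esssup lborel F"
  using assms open_AE_notin_imp_empty by (intro le_esssup[where V=V]) blast+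

lemma le_esssup_restrict_lborel:
  fixes F :: "'b::euclidean_space \<Rightarrow> ereal"
  assumes S: "S \<in> sets borel" and V: "open V" "V \<noteq> {}" "V \<subseteq> S" and s: "\<And>x. x \<in> V \<Longrightarrow> s \<le> F x"
  shows "s \<le> esssup (restrict_space lborel S) F"
proof (rule le_esssup[OF _ s])
  show "\<not> (AE x in restrict_space lborel S. x \<notin> V)"
  proof
    assume "AE x in restrict_space lborel S. x \<notin> V"
    then have "AE x in lborel. x \<in> S \<longrightarrow> x \<notin> V"
      using S by (subst (asm) AE_restrict_space_iff) simp_all
    then have "AE x in lborel. x \<notin> V"
      by eventually_elim (use V(3) in blast)
    then show False using open_AE_notin_imp_empty V by blast
  qed
qed

lemma locsup_eq: "locsup T F l = esssup (restrict_space lborel ((+) l ` fund T)) F"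
  by (simp add: locsup_def)

lemma le_locsup:
  fixes T :: "'b::euclidean_space \<Rightarrow> 'b"
  assumes T: "linear T" "bij T" and U: "open U" "\<mu> \<in> U" and s: "\<And>x. x \<in> U \<Longrightarrow> s \<le> F x"
  shows "s \<le> locsup T F \<mu>"
  unfolding locsup_eq
proof (rule le_esssup_restrict_lborel)
  let ?P = "(+) \<mu> ` T ` box 0 One"
  show "(+) \<mu> ` fund T \<in> sets borel"
    by (rule translation_measurable[OF fund_measurable[OF T]])
  have "open (T ` box 0 One)"
    using open_surjective_linear_image[OF _ T(1) bij_is_surj[OF T(2)]] open_box by blast
  then show "open (U \<inter> ?P)" by (intro open_Int U open_translation)
  show "U \<inter> ?P \<subseteq> (+) \<mu> ` fund T"
    unfolding fund_def by (force simp: mem_box less_imp_le)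
  have "(0::'b) \<in> closure (box 0 One)"
    by (subst closure_box) (auto simp: box_ne_empty mem_box)
  then have "T 0 \<in> closure (T ` box 0 One)"
    using closure_linear_image_subset[OF T(1)] by blast
  then have "\<mu> \<in> closure ?P"
    by (simp add: closure_translation linear_0[OF T(1)] image_iff)
  then show "U \<inter> ?P \<noteq> {}"
    using U open_Int_closure_eq_empty[OF U(1)] by blast
qed (use s in blast)

lemma continuous_le_locsup:
  fixes T :: "'b::euclidean_space \<Rightarrow> 'b" and F :: "'b \<Rightarrow> real"
  assumes T: "linear T" "bij T" and F: "continuous_on UNIV F"
  shows "ereal (F \<mu>) \<le> locsup T (\<lambda>z. ereal (F z)) \<mu>"
proof (rule dense_le)
  fix s assume s: "s < ereal (F \<mu>)"
  have "continuous_on UNIV (\<lambda>z. ereal (F z))" using F by (intro continuous_intros)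
  then have "open {z. s < ereal (F z)}"
    by (intro open_Collect_less continuous_on_const)
  then show "s \<le> locsup T (\<lambda>z. ereal (F z)) \<mu>"
    by (rule le_locsup[OF T]) (use s in auto)
qed

lemma le_cmod_amalg_seq:
  assumes "l \<in> lat T" and fin: "locsup T F l \<noteq> \<infinity>"
    and le_locsup: "ereal r \<le> locsup T F l" and "0 \<le> r"
  shows "r \<le> cmod (amalg_seq T F l)"
proof -
  obtain q where "locsup T F l = ereal q"
    using fin le_locsup by (cases "locsup T F l") auto
  then show ?thesis using assms by (simp add: amalg_seq_def)
qed

lemma AE_cmod_le_amalg_seq:
  fixes T :: "'b::euclidean_space \<Rightarrow> 'b" and V :: "'b \<Rightarrow> complex"
  assumes T: "linear T" "bij T" and l: "l \<in> lat T"
    and fin: "locsup T (\<lambda>z. ereal (cmod (V z))) l \<noteq> \<infinity>"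
  shows "AE z in lborel. z \<in> (+) l ` fund T
      \<longrightarrow> cmod (V z) \<le> cmod (amalg_seq T (\<lambda>z. ereal (cmod (V z))) l)"
proof -
  have "AE z in restrict_space lborel ((+) l ` fund T). ereal (cmod (V z))
      \<le> locsup T (\<lambda>z. ereal (cmod (V z))) l"
    unfolding locsup_eq by (rule esssup_AE)
  then have "AE z in lborel. z \<in> (+) l ` fund T
      \<longrightarrow> ereal (cmod (V z)) \<le> locsup T (\<lambda>z. ereal (cmod (V z))) l"
    by (subst (asm) AE_restrict_space_iff) (simp_all add: translation_measurable fund_measurable T)
  then show ?thesis
    by eventually_elim (auto intro: le_cmod_amalg_seq[OF l fin])
qed

lemma nn_integral_cell_le_amalg_seq:
  fixes T :: "'b::euclidean_space \<Rightarrow> 'b" and V :: "'b \<Rightarrow> complex"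
  assumes T: "linear T" "bij T" and l: "l \<in> lat T"
    and fin: "locsup T (\<lambda>z. ereal (cmod (V z))) l \<noteq> \<infinity>"
  shows "(LBINT\<^sup>+z. ennreal (cmod (V z)) * indicator ((+) l ` fund T) z)
    \<le> ennreal (cmod (amalg_seq T (\<lambda>z. ereal (cmod (V z))) l)) * emeasure lborel (fund T)"
proof -
  let ?v = "ennreal (cmod (amalg_seq T (\<lambda>z. ereal (cmod (V z))) l))" and ?C = "(+) l ` fund T"
  have "AE z in lborel. ennreal (cmod (V z)) * indicator ?C z \<le> ?v * indicator ?C z"
    using AE_cmod_le_amalg_seq[OF T l fin]
    by eventually_elim (auto simp: indicator_def intro: ennreal_leI)
  then have "(LBINT\<^sup>+z. ennreal (cmod (V z)) * indicator ?C z) \<le> (LBINT\<^sup>+z. ?v * indicator ?C z)"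
    by (rule nn_integral_mono_AE)
  also have "\<dots> = ?v * emeasure lborel ?C"
    by (rule nn_integral_cmult_indicator) (simp add: translation_measurable fund_measurable T)
  finally show ?thesis by (simp add: emeasure_lborel_translation fund_measurable T)
qed

lemma nn_integral_lborel_le_cells:
  fixes T :: "'b::euclidean_space \<Rightarrow> 'b"
  assumes T: "linear T" "bij T" and [measurable]: "f \<in> borel_measurable borel"
  shows "(LBINT\<^sup>+z. f z) \<le> (\<integral>\<^sup>+l. (LBINT\<^sup>+z. f z * indicator ((+) l ` fund T) z) \<partial>count_space (lat T))"
proof -
  have [measurable]: "(+) l ` fund T \<in> sets borel" for l
    by (intro translation_measurable fund_measurable T)
  have "f z \<le> (\<integral>\<^sup>+l. f z * indicator ((+) l ` fund T) z \<partial>count_space (lat T))" for z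
  proof -
    obtain l where l: "l \<in> lat T" "z \<in> (+) l ` fund T" using lat_fund_cover[OF T] by blast
    have "f z = (\<integral>\<^sup>+k. f z * indicator {l} k \<partial>count_space (lat T))"
      using l by (subst nn_integral_cmult_indicator) auto
    also have "\<dots> \<le> (\<integral>\<^sup>+k. f z * indicator ((+) k ` fund T) z \<partial>count_space (lat T))"
      using l by (intro nn_integral_mono) (auto simp: indicator_def)
    finally show ?thesis .
  qed
  then have "(LBINT\<^sup>+z. f z)
      \<le> (LBINT\<^sup>+z. (\<integral>\<^sup>+l. f z * indicator ((+) l ` fund T) z \<partial>count_space (lat T)))"
    by (intro nn_integral_mono)
  also have "\<dots> = (\<integral>\<^sup>+l. (LBINT\<^sup>+z. f z * indicator ((+) l ` fund T) z) \<partial>count_space (lat T))"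
    by (rule nn_integral_count_space_nn_integral[OF countable_lat]) measurable
  finally show ?thesis .
qed

lemma wiener_amalgam_integrable:
  fixes T :: "'b::euclidean_space \<Rightarrow> 'b" and V :: "'b \<Rightarrow> complex"
  assumes T: "linear T" "bij T" and A: "solid_inv_conv_alg (lat T) A nA"
    and V: "V \<in> borel_measurable lborel" and WA: "in_WA T A (\<lambda>z. ereal (cmod (V z)))"
  shows "integrable lborel V"
proof -
  interpret add_subgroup "lat T" by (rule add_subgroup_lat[OF T(1)])
  interpret solid_conv_algebra "lat T" A nA by unfold_locales (rule A)
  let ?v = "amalg_seq T (\<lambda>z. ereal (cmod (V z)))"
  have v: "?v \<in> A" and fin: "\<And>l. l \<in> lat T \<Longrightarrow> locsup T (\<lambda>z. ereal (cmod (V z))) l \<noteq> \<infinity>"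
    using WA by (auto simp: in_WA_def)
  have "(LBINT\<^sup>+z. ennreal (cmod (V z)))
      \<le> (\<integral>\<^sup>+l. (LBINT\<^sup>+z. ennreal (cmod (V z)) * indicator ((+) l ` fund T) z) \<partial>count_space (lat T))"
    using V by (intro nn_integral_lborel_le_cells T) simp
  also have "\<dots> \<le> (\<integral>\<^sup>+l. ennreal (cmod (?v l)) * emeasure lborel (fund T) \<partial>count_space (lat T))"
    by (intro nn_integral_mono) (simp add: nn_integral_cell_le_amalg_seq[OF T] fin)
  also have "\<dots> < \<infinity>"
    using emeasure_bounded_finite[OF bounded_fund[OF T(1)]]
    by (simp add: nn_integral_multc
      nn_integral_count_space_eq_infsum[OF abs_summable[OF v]] ennreal_mult_less_top)
  finally show ?thesis using V by (simp add: integrable_iff_bounded)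
qed

section \<open>Almost diagonalisation\<close>

definition gram :: "('a::euclidean_space \<Rightarrow> complex) \<Rightarrow> 'a \<times> 'a \<Rightarrow> 'a \<times> 'a \<Rightarrow> complex" where
  "gram g l k = l2_inner (tfs k g) (tfs l g)"

lemma conv_dominated_gram_amalg_seq:
  fixes T :: "'a::euclidean_space \<times> 'a \<Rightarrow> 'a \<times> 'a"
  assumes T: "linear T" "bij T" and g: "g \<in> L2"
    and WA: "in_WA T A (\<lambda>z. ereal (cmod (stft g g z)))"
  shows "conv_dominated (lat T) (gram g) (amalg_seq T (\<lambda>z. ereal (cmod (stft g g z))))"
  unfolding conv_dominated_def
proof (intro ballI)
  fix l k assume lk: "l \<in> lat T" "k \<in> lat T"
  have "cmod (gram g l k) = cmod (stft g g (l - k))"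
    using cmod_stft_tfs[of g g k l] L2_measurable[OF g] by (simp add: gram_def stft_def)
  also have "\<dots> \<le> cmod (amalg_seq T (\<lambda>z. ereal (cmod (stft g g z))) (l - k))"
  proof (rule le_cmod_amalg_seq)
    show "l - k \<in> lat T" by (rule add_subgroup.diff_mem[OF add_subgroup_lat[OF T(1)] lk])
    then show "locsup T (\<lambda>z. ereal (cmod (stft g g z))) (l - k) \<noteq> \<infinity>"
      using WA by (simp add: in_WA_def)
    show "ereal (cmod (stft g g (l - k))) \<le> locsup T (\<lambda>z. ereal (cmod (stft g g z))) (l - k)"
      by (intro continuous_le_locsup T continuous_on_norm stft_continuous g)
  qed simp
  finally show "cmod (gram g l k) \<le> cmod (amalg_seq T (\<lambda>z. ereal (cmod (stft g g z))) (l - k))" .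
qed

lemma cmod_gabor_matrix:
  fixes g :: "'a::euclidean_space \<Rightarrow> complex"
  assumes \<sigma>: "\<sigma> \<in> S0_dual" and g: "g \<in> S0"
  shows "cmod (gabor_matrix \<sigma> g l m) = cmod (\<sigma> (tfs ((1/2) *\<^sub>R (l + m), jmap (l - m)) (wigner g g)))"
  unfolding gabor_matrix_def weyl_pair_def
    wigner_tfs_tfs[OF S0_measurable[OF g] S0_measurable[OF g]]
    S0_dual_scale[OF \<sigma> S0_tfs[OF S0_wigner(1)[OF g g]]]
  by (simp add: norm_mult)

lemma cmod_gabor_matrix_midpoint:
  fixes g :: "'a::euclidean_space \<Rightarrow> complex"
  assumes \<sigma>: "\<sigma> \<in> S0_dual" and g: "g \<in> S0"
  shows "cmod (gabor_matrix \<sigma> g (z + (1/2) *\<^sub>R \<zeta>) (z - (1/2) *\<^sub>R \<zeta>))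
      = cmod (\<sigma> (tfs (z, jmap \<zeta>) (wigner g g)))"
proof -
  have "(1/2) *\<^sub>R (z + (1/2) *\<^sub>R \<zeta> + (z - (1/2) *\<^sub>R \<zeta>)) = z"
    and "z + (1/2) *\<^sub>R \<zeta> - (z - (1/2) *\<^sub>R \<zeta>) = \<zeta>"
    by (simp_all flip: scaleR_add_left scaleR_2)
  then show ?thesis by (simp only: cmod_gabor_matrix[OF \<sigma> g])
qed

lemma continuous_gabor_matrix:
  fixes g :: "'a::euclidean_space \<Rightarrow> complex"
  assumes \<sigma>: "\<sigma> \<in> S0_dual" and g: "g \<in> S0"
  shows "continuous_on UNIV (\<lambda>p. gabor_matrix \<sigma> g (fst p) (snd p))"
proof (rule continuous_at_imp_continuous_on, rule ballI, rule continuous_at_sequentiallyI)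
  fix p :: "('a \<times> 'a) \<times> ('a \<times> 'a)" and u assume "u \<longlonglongrightarrow> p"
  then show "(\<lambda>n. gabor_matrix \<sigma> g (fst (u n)) (snd (u n))) \<longlonglongrightarrow> gabor_matrix \<sigma> g (fst p) (snd p)"
    unfolding gabor_matrix_def by (intro weyl_pair_tfs_tendsto \<sigma> g tendsto_fst tendsto_snd)
qed

lemma gabor_matrix_le_locsup:
  fixes T :: "'a::euclidean_space \<times> 'a \<Rightarrow> 'a \<times> 'a"
  assumes T: "linear T" "bij T" and \<sigma>: "\<sigma> \<in> S0_dual" and g: "g \<in> S0"
  shows "ereal (cmod (gabor_matrix \<sigma> g l m))
      \<le> locsup T (grand_symbol \<sigma> (wigner g g) \<circ> jmap) (l - m)"
proof (rule dense_le)
  fix s assume s: "s < ereal (cmod (gabor_matrix \<sigma> g l m))"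
  define P where "P y = cmod (gabor_matrix \<sigma> g (fst y + (1/2) *\<^sub>R snd y) (fst y - (1/2) *\<^sub>R snd y))"
    for y :: "('a \<times> 'a) \<times> ('a \<times> 'a)"
  have P_eq: "P (z, \<zeta>) = cmod (\<sigma> (tfs (z, jmap \<zeta>) (wigner g g)))" for z \<zeta>
    by (simp add: P_def cmod_gabor_matrix_midpoint[OF \<sigma> g])
  have "continuous_on UNIV P"
    unfolding P_def
    by (intro continuous_on_norm continuous_on_compose2[OF continuous_gabor_matrix[OF \<sigma> g],
      of UNIV "\<lambda>y. (fst y + (1/2) *\<^sub>R snd y, fst y - (1/2) *\<^sub>R snd y)", unfolded fst_conv snd_conv]
        continuous_intros) simp
  then have "continuous_on UNIV (\<lambda>y. ereal (P y))" by (intro continuous_intros)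
  then have "open {y. s < ereal (P y)}" by (intro open_Collect_less continuous_on_const)
  moreover have "((1/2) *\<^sub>R (l + m), l - m) \<in> {y. s < ereal (P y)}"
    using s by (simp add: P_eq cmod_gabor_matrix[OF \<sigma> g])
  ultimately obtain Q U where Q: "open Q" and U: "open U"
    and mem: "((1/2) *\<^sub>R (l + m), l - m) \<in> Q \<times> U" and subset: "Q \<times> U \<subseteq> {y. s < ereal (P y)}"
    by (rule open_prod_elim) blast
  show "s \<le> locsup T (grand_symbol \<sigma> (wigner g g) \<circ> jmap) (l - m)"
  proof (rule le_locsup[OF T U])
    show "l - m \<in> U" using mem by blast
    show "s \<le> (grand_symbol \<sigma> (wigner g g) \<circ> jmap) \<zeta>" if "\<zeta> \<in> U" for \<zeta>
      unfolding grand_symbol_def comp_def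
    proof (rule le_esssup_lborel[OF Q])
      show "s \<le> ereal (cmod (\<sigma> (tfs (z, jmap \<zeta>) (wigner g g))))" if "z \<in> Q" for z
      proof -
        have "(z, \<zeta>) \<in> {y. s < ereal (P y)}" using subset \<open>\<zeta> \<in> U\<close> that by blast
        then show ?thesis by (simp add: P_eq)
      qed
    qed (use mem in blast)
  qed
qed

lemma conv_dominated_gabor_matrix_amalg_seq:
  fixes T :: "'a::euclidean_space \<times> 'a \<Rightarrow> 'a \<times> 'a"
  assumes T: "linear T" "bij T" and \<sigma>: "\<sigma> \<in> S0_dual" and g: "g \<in> S0"
    and WA: "in_WA T A (grand_symbol \<sigma> (wigner g g) \<circ> jmap)"
  shows "conv_dominated (lat T) (gabor_matrix \<sigma> g)
      (amalg_seq T (grand_symbol \<sigma> (wigner g g) \<circ> jmap))"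
  unfolding conv_dominated_def
proof (intro ballI)
  fix l k assume "l \<in> lat T" "k \<in> lat T"
  then have "l - k \<in> lat T" by (rule add_subgroup.diff_mem[OF add_subgroup_lat[OF T(1)]])
  then show "cmod (gabor_matrix \<sigma> g l k)
      \<le> cmod (amalg_seq T (grand_symbol \<sigma> (wigner g g) \<circ> jmap) (l - k))"
    using WA by (intro le_cmod_amalg_seq gabor_matrix_le_locsup[OF T \<sigma> g]) (auto simp: in_WA_def)
qed

subsection \<open>The diagonal suprema of the Gabor matrix\<close>

lemma bdd_above_gabor_matrix_diagonal:
  assumes \<Lambda>: "add_subgroup \<Lambda>" and w: "conv_dominated \<Lambda> (gabor_matrix \<sigma> g) w" and \<mu>: "\<mu> \<in> \<Lambda>"
  shows "bdd_above ((\<lambda>l. cmod (gabor_matrix \<sigma> g l (l - \<mu>))) ` \<Lambda>)"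
  by (rule bdd_aboveI2) (rule add_subgroup.conv_dominated_diagonal_le[OF \<Lambda> w _ \<mu>])

lemma cmod_gabor_diag_le:
  assumes \<Lambda>: "add_subgroup \<Lambda>" and w: "conv_dominated \<Lambda> (gabor_matrix \<sigma> g) w"
  shows "cmod (gabor_diag \<Lambda> \<sigma> g \<mu>) \<le> cmod (w \<mu>)"
proof (cases "\<mu> \<in> \<Lambda>")
  case \<mu>: True
  have zero: "0 \<in> \<Lambda>" by (rule add_subgroup.zero_mem[OF \<Lambda>])
  have "(SUP l\<in>\<Lambda>. cmod (gabor_matrix \<sigma> g l (l - \<mu>))) \<le> cmod (w \<mu>)"
    using zero add_subgroup.conv_dominated_diagonal_le[OF \<Lambda> w _ \<mu>] by (intro cSUP_least) auto
  moreover have "0 \<le> (SUP l\<in>\<Lambda>. cmod (gabor_matrix \<sigma> g l (l - \<mu>)))"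
    by (rule cSUP_upper2[OF bdd_above_gabor_matrix_diagonal[OF \<Lambda> w \<mu>] zero]) simp
  ultimately show ?thesis using \<mu> by (simp add: gabor_diag_def)
qed (simp add: gabor_diag_def)

lemma conv_dominated_gabor_diag:
  assumes \<Lambda>: "add_subgroup \<Lambda>" and w: "conv_dominated \<Lambda> (gabor_matrix \<sigma> g) w"
  shows "conv_dominated \<Lambda> (gabor_matrix \<sigma> g) (gabor_diag \<Lambda> \<sigma> g)"
  unfolding conv_dominated_def
proof (intro ballI)
  fix l k assume l: "l \<in> \<Lambda>" and k: "k \<in> \<Lambda>"
  have diff_mem: "l - k \<in> \<Lambda>" by (rule add_subgroup.diff_mem[OF \<Lambda> l k])
  have "cmod (gabor_matrix \<sigma> g l (l - (l - k)))
      \<le> (SUP l'\<in>\<Lambda>. cmod (gabor_matrix \<sigma> g l' (l' - (l - k))))"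
    by (rule cSUP_upper[OF l bdd_above_gabor_matrix_diagonal[OF \<Lambda> w diff_mem]])
  also have "\<dots> \<le> cmod (gabor_diag \<Lambda> \<sigma> g (l - k))" using diff_mem by (simp add: gabor_diag_def)
  finally show "cmod (gabor_matrix \<sigma> g l k) \<le> cmod (gabor_diag \<Lambda> \<sigma> g (l - k))" by simp
qed

section \<open>Weyl operators on Gabor coefficients\<close>

definition synthesis :: "('a::euclidean_space \<Rightarrow> complex) \<Rightarrow> ('a \<times> 'a \<Rightarrow> complex) \<Rightarrow> 'a \<Rightarrow> complex" where
  "synthesis g b t = (\<Sum>m | b m \<noteq> 0. b m * tfs m g t)"

lemma synthesis_mem_L0:
  "finite {m. b m \<noteq> 0} \<Longrightarrow> {m. b m \<noteq> 0} \<subseteq> \<Lambda> \<Longrightarrow> synthesis g b \<in> L0 \<Lambda> g"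
  unfolding L0_def synthesis_def[abs_def] by blast

lemma L0_eq_synthesis:
  assumes "f \<in> L0 \<Lambda> g"
  obtains b where "finite {m. b m \<noteq> 0}" "{m. b m \<noteq> 0} \<subseteq> \<Lambda>" "f = synthesis g b"
proof -
  obtain S c where S: "finite S" "S \<subseteq> \<Lambda>" and f: "f = (\<lambda>t. \<Sum>m\<in>S. c m * tfs m g t)"
    using assms unfolding L0_def by blast
  let ?b = "\<lambda>m. if m \<in> S then c m else 0"
  have support: "{m. ?b m \<noteq> 0} \<subseteq> S" by auto
  then have "f = synthesis g ?b"
    unfolding f synthesis_def[abs_def] using S by (intro ext sum.mono_neutral_cong_right) auto
  with support S show thesis by (intro that[of ?b]) (auto intro: finite_subset)
qed

lemma tfs_mem_L0: "l \<in> \<Lambda> \<Longrightarrow> tfs l g \<in> L0 \<Lambda> g"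
  unfolding L0_def by (intro CollectI exI[of _ "{l}"] exI[of _ "\<lambda>_. 1"]) auto

lemma L0_S0:
  assumes g: "g \<in> S0" and "f \<in> L0 \<Lambda> g" shows "f \<in> S0"
proof -
  obtain S c where S: "finite S" and f: "f = (\<lambda>t. \<Sum>m\<in>S. c m * tfs m g t)"
    using assms(2) unfolding L0_def by blast
  show ?thesis unfolding f by (intro S0_sum S0_scale S0_tfs S g)
qed

lemma coeff_synthesis:
  assumes g: "g \<in> L2" and b: "finite {m. b m \<noteq> 0}" "{m. b m \<noteq> 0} \<subseteq> \<Lambda>"
  shows "coeff \<Lambda> g (synthesis g b) = kernel_op \<Lambda> (gram g) b"
proof (rule ext)
  fix l
  have "l2_inner (synthesis g b) (tfs l g) = (\<Sum>m | b m \<noteq> 0. gram g l m * b m)"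
    unfolding synthesis_def[abs_def]
    by (subst l2_inner_sum_left)
      (auto simp: l2_inner_scale_left gram_def mult.commute intro: L2_scale L2_tfs g)
  also have "\<dots> = (\<Sum>\<^sub>\<infinity>m\<in>\<Lambda>. gram g l m * b m)"
    using has_sum_finite_neutralI[OF b, of "\<lambda>m. gram g l m * b m"]
    by (intro infsumI[symmetric]) auto
  finally show "coeff \<Lambda> g (synthesis g b) l = kernel_op \<Lambda> (gram g) b l"
    by (simp add: coeff_def kernel_op_def)
qed

locale gabor_conv_algebra = solid_conv_algebra \<Lambda> A nA
  for \<Lambda> :: "('a::euclidean_space \<times> 'a) set" and A nA +
  fixes g :: "'a \<Rightarrow> complex" and v :: "'a \<times> 'a \<Rightarrow> complex"
  assumes countable: "countable \<Lambda>" and frame: "tight_gabor_frame \<Lambda> g" and window: "g \<in> S0"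
    and v_mem: "v \<in> A" and gram_dominated: "conv_dominated \<Lambda> (gram g) v"
begin

lemma coeff_L0_summable:
  assumes "f \<in> L0 \<Lambda> g"
  shows "(\<lambda>m. cmod (l2_inner f (tfs m g))) summable_on \<Lambda>"
proof -
  interpret self: solid_conv_module \<Lambda> A nA A nA by (rule solid_conv_module_self)
  obtain b where b: "finite {m. b m \<noteq> 0}" "{m. b m \<noteq> 0} \<subseteq> \<Lambda>" and f: "f = synthesis g b"
    using L0_eq_synthesis[OF assms] .
  have "coeff \<Lambda> g f \<in> A"
    unfolding f coeff_synthesis[OF S0_L2[OF window] b]
    by (rule self.kernel_op_mem[OF v_mem finite_support_mem[OF b] gram_dominated])
  from abs_summable[OF this] show ?thesis
    by (rule summable_on_cong[THEN iffD1, rotated]) (simp add: coeff_def)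
qed

lemma gabor_diag_mem:
  assumes "w \<in> A" and "conv_dominated \<Lambda> (gabor_matrix \<sigma> g) w"
  shows "gabor_diag \<Lambda> \<sigma> g \<in> A"
  by (rule solid_mem[OF assms(1) _ cmod_gabor_diag_le[OF add_subgroup_axioms assms(2)]])
    (simp add: gabor_diag_def)

lemma norm_gabor_diag_le:
  assumes "w \<in> A" and "conv_dominated \<Lambda> (gabor_matrix \<sigma> g) w"
  shows "nA (gabor_diag \<Lambda> \<sigma> g) \<le> nA w"
  by (rule norm_mono[OF assms(1) _ cmod_gabor_diag_le[OF add_subgroup_axioms assms(2)]])
    (simp add: gabor_diag_def)

lemma weyl_coeff_eq_kernel_op:
  assumes \<sigma>: "\<sigma> \<in> S0_dual" and f: "f \<in> L0 \<Lambda> g"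
  shows "weyl_coeff \<Lambda> \<sigma> g f = kernel_op \<Lambda> (gabor_matrix \<sigma> g) (coeff \<Lambda> g f)"
proof (rule ext)
  fix l
  obtain D where D: "\<And>u h. u \<in> S0 \<Longrightarrow> h \<in> S0 \<Longrightarrow> cmod (weyl_pair \<sigma> u h) \<le> D * S0_norm u * S0_norm h"
    using weyl_pair_bounded[OF \<sigma>] by blast
  have "((\<lambda>m. l2_inner f (tfs m g) * weyl_pair \<sigma> (tfs m g) (tfs l g))
      has_sum weyl_pair \<sigma> f (tfs l g)) \<Lambda>"
  proof (rule frame_expansion_functional[OF frame window
    countable L0_S0[OF window f] coeff_L0_summable[OF f]])
    show "cmod (weyl_pair \<sigma> u (tfs l g)) \<le> D * S0_norm g * S0_norm u" if "u \<in> S0" for u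
      using D[OF that S0_tfs[OF window, of l]] by (simp add: S0_norm_tfs[OF window] mult_ac)
  qed (auto intro: weyl_pair_add_left weyl_pair_scale_left \<sigma> S0_tfs window)
  then have "weyl_pair \<sigma> f (tfs l g)
      = (\<Sum>\<^sub>\<infinity>m\<in>\<Lambda>. l2_inner f (tfs m g) * weyl_pair \<sigma> (tfs m g) (tfs l g))"
    by (rule infsumI[symmetric])
  also have "\<dots> = (\<Sum>\<^sub>\<infinity>m\<in>\<Lambda>. gabor_matrix \<sigma> g l m * coeff \<Lambda> g f m)"
    by (rule infsum_cong) (simp add: gabor_matrix_def coeff_def)
  finally show "weyl_coeff \<Lambda> \<sigma> g f l = kernel_op \<Lambda> (gabor_matrix \<sigma> g) (coeff \<Lambda> g f) l"
    by (simp add: weyl_coeff_def kernel_op_def)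
qed

lemma kernel_op_gram_weyl_coeff:
  assumes \<sigma>: "\<sigma> \<in> S0_dual" and f: "f \<in> S0"
  shows "kernel_op \<Lambda> (gram g) (weyl_coeff \<Lambda> \<sigma> g f) = weyl_coeff \<Lambda> \<sigma> g f"
proof (rule ext)
  fix l
  obtain D where D: "\<And>u h. u \<in> S0 \<Longrightarrow> h \<in> S0 \<Longrightarrow> cmod (weyl_pair \<sigma> u h) \<le> D * S0_norm u * S0_norm h"
    using weyl_pair_bounded[OF \<sigma>] by blast
  show "kernel_op \<Lambda> (gram g) (weyl_coeff \<Lambda> \<sigma> g f) l = weyl_coeff \<Lambda> \<sigma> g f l"
  proof (cases "l \<in> \<Lambda>")
    case l: True
    have "((\<lambda>m. l2_inner (tfs l g) (tfs m g) * cnj (weyl_pair \<sigma> f (tfs m g)))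
        has_sum cnj (weyl_pair \<sigma> f (tfs l g))) \<Lambda>"
    proof (rule frame_expansion_functional[OF frame window countable
      S0_tfs[OF window] coeff_L0_summable[OF tfs_mem_L0[OF l]]])
      show "cmod (cnj (weyl_pair \<sigma> f u)) \<le> D * S0_norm f * S0_norm u" if "u \<in> S0" for u
        using D[OF f that] by simp
    qed (auto simp: weyl_pair_add_right weyl_pair_scale_right \<sigma> f)
    then have "((\<lambda>m. cnj (cnj (gram g l m) * cnj (weyl_pair \<sigma> f (tfs m g))))
        has_sum cnj (cnj (weyl_pair \<sigma> f (tfs l g)))) \<Lambda>"
      by (simp only: has_sum_cnj_iff gram_def cnj_l2_inner)
    then have "(\<Sum>\<^sub>\<infinity>m\<in>\<Lambda>. gram g l m * weyl_pair \<sigma> f (tfs m g)) = weyl_pair \<sigma> f (tfs l g)"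
      by (intro infsumI) simp
    then show ?thesis
      using l by (simp add: kernel_op_def weyl_coeff_def cong: infsum_cong)
  qed (simp add: kernel_op_def weyl_coeff_def)
qed

end

locale gabor_conv_module = gabor_conv_algebra \<Lambda> A nA g v + solid_conv_module \<Lambda> A nA Y nY
  for \<Lambda> :: "('a::euclidean_space \<times> 'a) set" and A nA Y nY g v +
  assumes module_finite_support_mem: "finite {x. b x \<noteq> 0} \<Longrightarrow> {x. b x \<noteq> 0} \<subseteq> \<Lambda> \<Longrightarrow> b \<in> Y"
    and finite_support_dense: "c \<in> Y \<Longrightarrow> e > 0 \<Longrightarrow> \<exists>b\<in>Y. finite {x. b x \<noteq> 0} \<and> nY (\<lambda>x. c x - b x) < e"
begin

lemma coeff_L0_mem:
  assumes "f \<in> L0 \<Lambda> g" shows "coeff \<Lambda> g f \<in> Y"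
proof -
  obtain b where b: "finite {m. b m \<noteq> 0}" "{m. b m \<noteq> 0} \<subseteq> \<Lambda>" and f: "f = synthesis g b"
    using L0_eq_synthesis[OF assms] .
  show ?thesis
    unfolding f coeff_synthesis[OF S0_L2[OF window] b]
    by (rule kernel_op_mem[OF v_mem module_finite_support_mem[OF b] gram_dominated])
qed

text \<open>Synthesising a finite sequence close to \<open>y\<close> applies the bounded Gram operator to the error.\<close>
lemma coeff_L0_approx_gram_fixed:
  assumes y: "y \<in> Y" and fixed: "kernel_op \<Lambda> (gram g) y = y" and e: "e > 0"
  shows "\<exists>h\<in>L0 \<Lambda> g. nY (\<lambda>l. coeff \<Lambda> g h l - y l) < e"
proof -
  have v_pos: "nA v + 1 > 0" using norm_nonneg[OF v_mem] by linarith
  then obtain b where b: "b \<in> Y" "finite {x. b x \<noteq> 0}"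
    and close: "nY (\<lambda>x. y x - b x) < e / (nA v + 1)"
    using finite_support_dense[OF y, of "e / (nA v + 1)"] e by auto
  have support: "{x. b x \<noteq> 0} \<subseteq> \<Lambda>" using module.eq_0_outside[OF b(1)] by blast
  have "(\<lambda>l. coeff \<Lambda> g (synthesis g b) l - y l) = kernel_op \<Lambda> (gram g) (\<lambda>k. b k - y k)"
    by (rule ext) (simp add: coeff_synthesis[OF S0_L2[OF window] b(2) support]
      kernel_op_minus[OF v_mem b(1) y gram_dominated] fixed)
  then have "nY (\<lambda>l. coeff \<Lambda> g (synthesis g b) l - y l) = nY (kernel_op \<Lambda> (gram g) (\<lambda>k. b k - y k))"
    by simp
  also have "\<dots> \<le> nA v * nY (\<lambda>k. b k - y k)"
    by (rule norm_kernel_op_le[OF v_mem module.minus_mem[OF b(1) y] gram_dominated])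
  also have "\<dots> \<le> (nA v + 1) * nY (\<lambda>k. y k - b k)"
    by (simp add: module.norm_minus_commute[OF b(1) y]
      mult_right_mono module.norm_nonneg module.minus_mem b y)
  also have "\<dots> < e" using close v_pos by (simp add: pos_less_divide_eq mult.commute)
  finally show ?thesis using synthesis_mem_L0[OF b(2) support] by blast
qed

context
  fixes \<sigma> d f
  assumes \<sigma>: "\<sigma> \<in> S0_dual" and d: "d \<in> A" "conv_dominated \<Lambda> (gabor_matrix \<sigma> g) d"
    and f: "f \<in> L0 \<Lambda> g"
begin

lemma weyl_coeff_mem: "weyl_coeff \<Lambda> \<sigma> g f \<in> Y"
  unfolding weyl_coeff_eq_kernel_op[OF \<sigma> f] by (rule kernel_op_mem[OF d(1) coeff_L0_mem[OF f] d(2)])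

lemma norm_weyl_coeff_le: "nY (weyl_coeff \<Lambda> \<sigma> g f) \<le> nA d * nY (coeff \<Lambda> g f)"
  unfolding weyl_coeff_eq_kernel_op[OF \<sigma> f]
  by (rule norm_kernel_op_le[OF d(1) coeff_L0_mem[OF f] d(2)])

lemma weyl_coeff_L0_approx:
  "e > 0 \<Longrightarrow> \<exists>h\<in>L0 \<Lambda> g. nY (\<lambda>l. coeff \<Lambda> g h l - weyl_coeff \<Lambda> \<sigma> g f l) < e"
  by (rule coeff_L0_approx_gram_fixed[OF weyl_coeff_mem
    kernel_op_gram_weyl_coeff[OF \<sigma> L0_S0[OF window f]]])

end

end

theorem mainTheorem9:
  fixes T :: "'a::euclidean_space \<times> 'a \<Rightarrow> 'a \<times> 'a"
    and A :: "('a \<times> 'a \<Rightarrow> complex) set" and nA :: "('a \<times> 'a \<Rightarrow> complex) \<Rightarrow> real"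
    and Y :: "('a \<times> 'a \<Rightarrow> complex) set" and nY :: "('a \<times> 'a \<Rightarrow> complex) \<Rightarrow> real"
    and g :: "'a \<Rightarrow> complex"
    and \<sigma> :: "('a \<times> 'a \<Rightarrow> complex) \<Rightarrow> complex"
  assumes T: "linear T" "bij T"
    and A: "solid_inv_conv_alg (lat T) A nA"
    and g_WA: "stft g g \<in> borel_measurable lborel"
              "in_WA T A (\<lambda>z. ereal (cmod (stft g g z)))"
    and frame: "tight_gabor_frame (lat T) g"
    and Y: "banach_seq_space (lat T) Y nY" "solid (lat T) Y nY"
    and Y_fin: "\<forall>b. finite {x. b x \<noteq> 0} \<and> {x. b x \<noteq> 0} \<subseteq> lat T \<longrightarrow> b \<in> Y"
    and Y_dense: "\<forall>c\<in>Y. \<forall>e>0. \<exists>b\<in>Y. finite {x. b x \<noteq> 0} \<and> nY (\<lambda>x. c x - b x) < e"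
    and AY: "\<forall>a\<in>A. \<forall>c\<in>Y. conv_ok (lat T) a c \<and> conv (lat T) a c \<in> Y
                 \<and> nY (conv (lat T) a c) \<le> nA a * nY c"
    and \<sigma>_dist: "\<sigma> \<in> S0_dual"
    and \<sigma>_sym: "in_WA T A (grand_symbol \<sigma> (wigner g g) \<circ> jmap)"
  shows "(\<forall>\<mu>\<in>lat T. bdd_above ((\<lambda>l. cmod (gabor_matrix \<sigma> g l (l - \<mu>))) ` lat T))
       \<and> gabor_diag (lat T) \<sigma> g \<in> A
       \<and> nA (gabor_diag (lat T) \<sigma> g) \<le> WA_norm T nA (grand_symbol \<sigma> (wigner g g) \<circ> jmap)
       \<and> (\<forall>f\<in>L0 (lat T) g.
            weyl_coeff (lat T) \<sigma> g f \<in> Y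
          \<and> nY (weyl_coeff (lat T) \<sigma> g f) \<le> nA (gabor_diag (lat T) \<sigma> g) * nY (coeff (lat T) g f)
          \<and> (\<forall>e>0. \<exists>h\<in>L0 (lat T) g.
                nY (\<lambda>l. coeff (lat T) g h l - weyl_coeff (lat T) \<sigma> g f l) < e))"
proof -
  let ?v = "amalg_seq T (\<lambda>z. ereal (cmod (stft g g z)))"
    and ?w = "amalg_seq T (grand_symbol \<sigma> (wigner g g) \<circ> jmap)"
  interpret add_subgroup "lat T" by (rule add_subgroup_lat[OF T(1)])
  have g: "g \<in> S0" by (rule S0_of_tight_frame[OF frame wiener_amalgam_integrable[OF T A g_WA]])
  have "conv_dominated (lat T) (gram g) ?v"
    by (rule conv_dominated_gram_amalg_seq[OF T S0_L2[OF g] g_WA(2)])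
  moreover have "?v \<in> A" using g_WA(2) by (simp add: in_WA_def)
  ultimately interpret gabor_conv_module "lat T" A nA Y nY g ?v
    using A countable_lat[of T] frame g Y Y_fin Y_dense AY by unfold_locales blast+
  have w: "?w \<in> A" using \<sigma>_sym by (simp add: in_WA_def)
  have dominated: "conv_dominated (lat T) (gabor_matrix \<sigma> g) ?w"
    by (rule conv_dominated_gabor_matrix_amalg_seq[OF T \<sigma>_dist g \<sigma>_sym])
  note diag = gabor_diag_mem[OF w dominated]
    conv_dominated_gabor_diag[OF add_subgroup_axioms dominated]
  show ?thesis
    unfolding WA_norm_def
    by (intro conjI ballI allI impI
      bdd_above_gabor_matrix_diagonal[OF add_subgroup_axioms dominated] diag(1)
      norm_gabor_diag_le[OF w dominated] weyl_coeff_mem[OF \<sigma>_dist diag]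
        norm_weyl_coeff_le[OF \<sigma>_dist diag]
      weyl_coeff_L0_approx[OF \<sigma>_dist diag])
qed

end
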